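(* Assume $n\ge3$, $G=\operatorname{Euc}(n)$, $H=O(n-1)$. Let $p:\mathcal P\to N$ be an $H$-principal fiber bundle over a manifold $N$ and let $\vartheta\in\Omega^1(\mathcal P,\mathfrak m)$ be the $\mathfrak m$-part $\operatorname{pr}_{\mathfrak m}\circ\,\omega'$ of some Cartan connection $\omega'$ of type $(G,H)$ on $\mathcal P$. Among all Cartan geometries $(p:\mathcal P\to N,\omega)$ of type $(G,H)$ whose Cartan connections share this same $\mathfrak m$-part $\operatorname{pr}_{\mathfrak m}\circ\,\omega=\vartheta$, there exists a unique one whose Cartan connection is normal. Equivalently, the condition $\partial^*T^\omega=0$ determines the principal-connection part $\gamma=\operatorname{pr}_{\mathfrak h}\circ\,\omega$ uniquely: there is exactly one $H$-principal connection $\gamma$ on $\mathcal P$ such that $\omega=\gamma+\vartheta$ satisfies $\partial^*T^\omega=0$.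
   Context: All manifolds are smooth, Hausdorff, connected and second countable. Groups. $G=\operatorname{Euc}(n)=\mathbb R^n\rtimes O(n)$ is realized as the matrices $\begin{pmatrix}1&0\\ v&A\end{pmatrix}$ with $v\in\mathbb R^n$, $A\in O(n)$; its Lie algebra $\mathfrak g$ consists of the matrices $\begin{pmatrix}0&0\\ v&B\end{pmatrix}$ with $v\in\mathbb R^n$, $B\in\mathfrak o(n)$. $H=O(n-1)\subset O(n)\subset G$ is embedded by $h\mapsto\begin{pmatrix}1&0\\0&h\end{pmatrix}\in O(n)$, with Lie algebra $\mathfrak h=\mathfrak o(n-1)$. Model. For $v_0\in\mathbb R$, $v,w\in\mathbb R^{n-1}$ put $$(v_0,v,w):=\begin{pmatrix}0&0&0\\ v_0&0&-w^t\\ v&w&0\end{pmatrix}\in\mathfrak g .$$ These matrices form an $\operatorname{Ad}(H)$-invariant complement $\mathfrak m$ of $\mathfrak h$ in $\mathfrak g$, so $\mathfrak g=\mathfrak h\oplus\mathfrak m$ and $[\mathfrak h,\mathfrak m]\subset\mathfrak m$; $\operatorname{pr}_{\mathfrak h},\operatorname{pr}_{\mathfrak m}$ are the projections. $\mathfrak m$ is identified with $\mathfrak g/\mathfrak h$, and $H$ acts on it by $\underline{\operatorname{Ad}}(h)(v_0,v,w)=(v_0,hv,hw)$. With $(E_1,\dots,E_{n-1})$ the canonical basis of $\mathbb R^{n-1}$, put $e_0=(1,0,0)$, $e_i=(0,E_i,0)$, $b_i=(0,0,E_i)$. Let $\langle\cdot,\cdot\rangle_{\mathfrak m}$ be the ($H$-invariant)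 inner product on $\mathfrak m$ for which $(e_0,e_1,\dots,e_{n-1},b_1,\dots,b_{n-1})$ is orthonormal, and fix an $H$-invariant Euclidean inner product $\langle\cdot,\cdot\rangle_{\mathfrak h}$ on $\mathfrak h$. Cartan geometry of type $(G,H)$ on $N$: an $H$-principal fiber bundle $p:\mathcal P\to N$ (right action $r^h$) with a $1$-form $\omega\in\Omega^1(\mathcal P,\mathfrak g)$ (Cartan connection) such that each $\omega(u):T_u\mathcal P\to\mathfrak g$ is a linear isomorphism, $(r^h)^*\omega=\operatorname{Ad}(h^{-1})\circ\omega$ for $h\in H$, and $\omega(\zeta_X)=X$ for every $X\in\mathfrak h$, where $\zeta_X$ is the fundamental vector field of $X$. The part $\gamma=\operatorname{pr}_{\mathfrak h}\circ\,\omega$ is an $H$-principal connection on $\mathcal P$. For $X\in\mathfrak g$, $\omega^{-1}(X)\in\mathfrak X(\mathcal P)$ is the vector field with $\omega(\omega^{-1}(X))=X$. The curvature form is $K^\omega=d\omega+\frac12[\omega,\omega]$, i.e. $K^\omega(\xi,\eta)=d\omega(\xi,\eta)+[\omega(\xi),\omega(\eta)]$. Spencer differential. $\partial:\mathfrak m^*\otimes\mathfrak h\to\Lambda^2\mathfrak m^*\otimes\mathfrak m$, $(\partial A)(X,Y)=[A(X),Y]-[A(Y),X]$ for $X,Y\in\mathfrak m$. Its adjoint $\partial^*:\Lambda^2\mathfrak m^*\otimes\mathfrak m\to\mathfrak m^*\otimes\mathfrak h$ is defined by $\langle\partial A,T\rangle_{\Lambda^2\mathfrak m^*\otimes\mathfrak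 m}=\langle A,\partial^*T\rangle_{\mathfrak m^*\otimes\mathfrak h}$, with the canonical inner products induced by $\langle\cdot,\cdot\rangle_{\mathfrak m}$ and $\langle\cdot,\cdot\rangle_{\mathfrak h}$: for an orthonormal basis $(x_i)$ of $\mathfrak m$, $\langle A,A'\rangle=\sum_i\langle A(x_i),A'(x_i)\rangle_{\mathfrak h}$ and $\langle T,T'\rangle=\sum_{i<j}\langle T(x_i,x_j),T'(x_i,x_j)\rangle_{\mathfrak m}$. Torsion and normality. The torsion of $\omega$ is $T^\omega:\mathcal P\to\Lambda^2\mathfrak m^*\otimes\mathfrak m$, $T^\omega(u)(X,Y)=\operatorname{pr}_{\mathfrak m}\big[K^\omega(u)(\omega^{-1}(X)(u),\omega^{-1}(Y)(u))\big]$. The Cartan connection $\omega$ is normal if $\partial^*T^\omega=0$ (pointwise on $\mathcal P$). *)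

theory Defs
  imports "HOL-Analysis.Analysis"
begin

section \<open>Smooth maps\<close>

text \<open>\<open>Ck_on k W f\<close> is meant for open \<open>W\<close> and finite-dimensional domains, where it says that \<open>f\<close> is
  of class C^k on \<open>W\<close>.\<close>

primrec Ck_on :: "nat \<Rightarrow> 'a::real_normed_vector set \<Rightarrow> ('a \<Rightarrow> 'b::real_normed_vector) \<Rightarrow> bool" where
  "Ck_on 0 W f \<longleftrightarrow> continuous_on W f"
| "Ck_on (Suc k) W f \<longleftrightarrow>
     (\<forall>x\<in>W. f differentiable (at x)) \<and> (\<forall>v. Ck_on k W (\<lambda>x. frechet_derivative f (at x) v))"

text \<open>On an arbitrary subset of a Euclidean space, smooth means: locally the restriction of a
  C^infinity map defined on an open set. On open sets this is the usual notion; on (pieces of)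
  embedded submanifolds it agrees with smoothness for the submanifold structure.\<close>

definition smooth_on :: "'a::real_normed_vector set \<Rightarrow> ('a \<Rightarrow> 'b::real_normed_vector) \<Rightarrow> bool" where
  "smooth_on S f \<longleftrightarrow>
     (\<forall>x\<in>S. \<exists>W g. open W \<and> x \<in> W \<and> (\<forall>k. Ck_on k W g) \<and> (\<forall>y\<in>S \<inter> W. f y = g y))"


section \<open>Manifolds\<close>

text \<open>A chart is a pair of a domain and a coordinate map; the values of the coordinate map outside
  the domain are irrelevant.\<close>

type_synonym ('p, 'e) chart = "'p set \<times> ('p \<Rightarrow> 'e)"

definition chart_inv :: "('p, 'e) chart \<Rightarrow> 'e \<Rightarrow> 'p" where
  "chart_inv c = inv_into (fst c) (snd c)"

definition is_chart :: "('p::topological_space, 'e::real_normed_vector) chart \<Rightarrow> bool" where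
  "is_chart c \<longleftrightarrow> open (fst c) \<and> open (snd c ` fst c) \<and>
     homeomorphism (fst c) (snd c ` fst c) (snd c) (chart_inv c)"

text \<open>Smooth manifolds are types: the underlying topological space is the whole type, the smooth
  structure is given by a (not necessarily maximal) smooth atlas.\<close>

definition smooth_atlas :: "('p::topological_space, 'e::real_normed_vector) chart set \<Rightarrow> bool" where
  "smooth_atlas A \<longleftrightarrow> (\<forall>c\<in>A. is_chart c) \<and> (\<Union>c\<in>A. fst c) = UNIV \<and>
     (\<forall>c\<in>A. \<forall>d\<in>A. smooth_on (snd c ` (fst c \<inter> fst d)) (snd d \<circ> chart_inv c))"

definition chart_at :: "('p, 'e) chart set \<Rightarrow> 'p \<Rightarrow> ('p, 'e) chart" where
  "chart_at A u = (SOME c. c \<in> A \<and> u \<in> fst c)"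

definition euclidean_atlas :: "('a, 'a) chart set" where
  "euclidean_atlas = {(UNIV, id)}"

definition prod_atlas :: "('p, 'e) chart set \<Rightarrow> ('q, 'f) chart set \<Rightarrow> ('p \<times> 'q, 'e \<times> 'f) chart set" where
  "prod_atlas A B = (\<lambda>(c, d). (fst c \<times> fst d, map_prod (snd c) (snd d))) ` (A \<times> B)"

definition smooth_map_on ::
  "('p::topological_space, 'e::real_normed_vector) chart set \<Rightarrow>
   ('q::topological_space, 'f::real_normed_vector) chart set \<Rightarrow> 'p set \<Rightarrow> ('p \<Rightarrow> 'q) \<Rightarrow> bool" where
  "smooth_map_on A B S f \<longleftrightarrow> continuous_on S f \<and>
     (\<forall>c\<in>A. \<forall>d\<in>B. smooth_on (snd c ` (fst c \<inter> S \<inter> f -` fst d)) (snd d \<circ> f \<circ> chart_inv c))"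

definition diffeo_on ::
  "('p::topological_space, 'e::real_normed_vector) chart set \<Rightarrow>
   ('q::topological_space, 'f::real_normed_vector) chart set \<Rightarrow> 'p set \<Rightarrow> 'q set \<Rightarrow> ('p \<Rightarrow> 'q) \<Rightarrow> bool" where
  "diffeo_on A B S T f \<longleftrightarrow> bij_betw f S T \<and> smooth_map_on A B S f \<and> smooth_map_on B A T (inv_into S f)"


section \<open>Tangent vectors and differential forms\<close>

text \<open>A tangent vector at \<open>u\<close> is the family of its coordinate vectors in all charts of the atlas
  around \<open>u\<close>, related by the derivatives of the coordinate changes. The components at all other
  pairs are set to 0, and the vector space operations are componentwise.\<close>

type_synonym ('p, 'e) tvec = "('p, 'e) chart \<Rightarrow> 'e"

definition tangent_space :: "('p, 'e::real_normed_vector) chart set \<Rightarrow> 'p \<Rightarrow> ('p, 'e) tvec set" where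
  "tangent_space A u = {\<xi>.
     (\<forall>c\<in>A. \<forall>d\<in>A. u \<in> fst c \<inter> fst d \<longrightarrow>
        \<xi> d = frechet_derivative (snd d \<circ> chart_inv c) (at (snd c u)) (\<xi> c)) \<and>
     (\<forall>c. \<not> (c \<in> A \<and> u \<in> fst c) \<longrightarrow> \<xi> c = 0)}"

text \<open>The tangent vector at \<open>u\<close> with coordinates \<open>v\<close> in the chart \<open>c\<close>.\<close>

definition coord_vec ::
  "('p, 'e::real_normed_vector) chart set \<Rightarrow> ('p, 'e) chart \<Rightarrow> 'p \<Rightarrow> 'e \<Rightarrow> ('p, 'e) tvec" where
  "coord_vec A c u v = (\<lambda>d. if d \<in> A \<and> u \<in> fst d
     then frechet_derivative (snd d \<circ> chart_inv c) (at (snd c u)) v else 0)"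

definition tangent_map ::
  "('p, 'e::real_normed_vector) chart set \<Rightarrow> ('q, 'f::real_normed_vector) chart set \<Rightarrow>
   ('p \<Rightarrow> 'q) \<Rightarrow> 'p \<Rightarrow> ('p, 'e) tvec \<Rightarrow> ('q, 'f) tvec" where
  "tangent_map A B f u \<xi> = (\<lambda>d. if d \<in> B \<and> f u \<in> fst d
     then (let c = chart_at A u in
       frechet_derivative (snd d \<circ> f \<circ> chart_inv c) (at (snd c u)) (\<xi> c)) else 0)"

definition velocity0 ::
  "('p, 'e::real_normed_vector) chart set \<Rightarrow> (real \<Rightarrow> 'p) \<Rightarrow> ('p, 'e) tvec" where
  "velocity0 A \<gamma> = (\<lambda>d. if d \<in> A \<and> \<gamma> 0 \<in> fst d then vector_derivative (snd d \<circ> \<gamma>) (at 0) else 0)"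

text \<open>Smooth 1-forms with values in a subspace \<open>V\<close>. A form at \<open>u\<close> is set to 0 off the
  tangent space at \<open>u\<close>, so that equality of functions is equality of forms.\<close>

definition one_form ::
  "('p, 'e::real_normed_vector) chart set \<Rightarrow> 'v::real_normed_vector set \<Rightarrow>
   ('p \<Rightarrow> ('p, 'e) tvec \<Rightarrow> 'v) \<Rightarrow> bool" where
  "one_form A V \<omega> \<longleftrightarrow>
     (\<forall>u. \<forall>\<xi>\<in>tangent_space A u. \<omega> u \<xi> \<in> V) \<and>
     (\<forall>u \<xi>. \<xi> \<notin> tangent_space A u \<longrightarrow> \<omega> u \<xi> = 0) \<and>
     (\<forall>u. \<forall>\<xi>\<in>tangent_space A u. \<forall>\<eta>\<in>tangent_space A u. \<omega> u (\<lambda>c. \<xi> c + \<eta> c) = \<omega> u \<xi> + \<omega> u \<eta>) \<and>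
     (\<forall>u. \<forall>\<xi>\<in>tangent_space A u. \<forall>a. \<omega> u (\<lambda>c. a *\<^sub>R \<xi> c) = a *\<^sub>R \<omega> u \<xi>) \<and>
     (\<forall>c\<in>A. \<forall>v. smooth_on (snd c ` fst c)
        (\<lambda>x. \<omega> (chart_inv c x) (coord_vec A c (chart_inv c x) v)))"

text \<open>The exterior derivative is computed in coordinates, extending both tangent vectors to vector
  fields with constant coefficients (whose Lie bracket vanishes); for smooth forms it does not
  depend on the chart.\<close>

definition ext_deriv ::
  "('p, 'e::real_normed_vector) chart set \<Rightarrow> ('p \<Rightarrow> ('p, 'e) tvec \<Rightarrow> 'v::real_normed_vector) \<Rightarrow>
   'p \<Rightarrow> ('p, 'e) tvec \<Rightarrow> ('p, 'e) tvec \<Rightarrow> 'v" where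
  "ext_deriv A \<omega> u \<xi> \<eta> =
     (let c = chart_at A u;
          loc = (\<lambda>v x. \<omega> (chart_inv c x) (coord_vec A c (chart_inv c x) v))
      in frechet_derivative (loc (\<eta> c)) (at (snd c u)) (\<xi> c)
       - frechet_derivative (loc (\<xi> c)) (at (snd c u)) (\<eta> c))"


section \<open>The matrix groups and Lie algebras\<close>

text \<open>Throughout, \<open>'k\<close> indexes the coordinates of R^(n-1), so \<open>'k option\<close> indexes those of R^n
  (with \<open>None\<close> the distinguished first one) and \<open>'k option option\<close> the rows of the matrices
  representing Euc(n).\<close>

type_synonym 'k mat = "real ^ 'k option option ^ 'k option option"

text \<open>\<open>block a v A\<close> is the matrix with rows \<open>(a, 0)\<close> and \<open>(v, A)\<close>.\<close>

definition block :: "real \<Rightarrow> real ^ 'n \<Rightarrow> real ^ 'n ^ 'n \<Rightarrow> real ^ 'n option ^ 'n option" where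
  "block a v A = (\<chi> i j. case i of
      None \<Rightarrow> (case j of None \<Rightarrow> a | Some j' \<Rightarrow> 0)
    | Some i' \<Rightarrow> (case j of None \<Rightarrow> v $ i' | Some j' \<Rightarrow> A $ i' $ j'))"

definition Euc :: "(real ^ ('n::finite) option ^ 'n option) set" where
  "Euc = {block 1 v A | v A. orthogonal_matrix A}"

definition euc :: "(real ^ ('n::finite) option ^ 'n option) set" where
  "euc = {block 0 v B | v B. transpose B = - B}"

definition Hgrp :: "'k::finite mat set" where
  "Hgrp = {block 1 0 (block 1 0 h) | h. orthogonal_matrix h}"

definition halg :: "'k::finite mat set" where
  "halg = {block 0 0 (block 0 0 B) | B. transpose B = - B}"

definition lie :: "real ^ 'n ^ 'n \<Rightarrow> real ^ 'n ^ 'n \<Rightarrow> real ^ 'n ^ 'n" where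
  "lie X Y = X ** Y - Y ** X"

definition Ad :: "real ^ 'n ^ 'n \<Rightarrow> real ^ 'n ^ 'n \<Rightarrow> real ^ 'n ^ 'n" where
  "Ad g X = g ** X ** matrix_inv g"

definition mexp :: "real ^ 'n ^ 'n \<Rightarrow> real ^ 'n ^ 'n" where
  "mexp X = (\<Sum>i. (1 / fact i) *\<^sub>R ((\<lambda>B. X ** B) ^^ i) (mat 1))"

text \<open>\<open>mvec v0 v w\<close> is the matrix with rows \<open>(0, 0, 0)\<close>, \<open>(v0, 0, -w^t)\<close>, \<open>(v, w, 0)\<close>.\<close>

definition mvec :: "real \<Rightarrow> real ^ 'k \<Rightarrow> real ^ 'k \<Rightarrow> 'k::finite mat" where
  "mvec v0 v w = (\<chi> i j. case (i, j) of
      (Some None, None) \<Rightarrow> v0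
    | (Some None, Some (Some b)) \<Rightarrow> - w $ b
    | (Some (Some a), None) \<Rightarrow> v $ a
    | (Some (Some a), Some None) \<Rightarrow> w $ a
    | _ \<Rightarrow> 0)"

definition mcompl :: "'k::finite mat set" where
  "mcompl = {mvec v0 v w | v0 v w. True}"

definition m0 :: "'k::finite mat \<Rightarrow> real" where
  "m0 X = X $ Some None $ None"

definition m1 :: "'k::finite mat \<Rightarrow> real ^ 'k" where
  "m1 X = (\<chi> a. X $ Some (Some a) $ None)"

definition m2 :: "'k::finite mat \<Rightarrow> real ^ 'k" where
  "m2 X = (\<chi> a. X $ Some (Some a) $ Some None)"

text \<open>The projections of \<open>euc\<close> onto the summands of its decomposition into \<open>halg\<close> and \<open>mcompl\<close>;
  see the lemmas at the end of this section.\<close>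

definition pr_m :: "'k::finite mat \<Rightarrow> 'k mat" where
  "pr_m X = mvec (m0 X) (m1 X) (m2 X)"

definition pr_h :: "'k::finite mat \<Rightarrow> 'k mat" where
  "pr_h X = X - pr_m X"

definition ip_m :: "'k::finite mat \<Rightarrow> 'k mat \<Rightarrow> real" where
  "ip_m X Y = m0 X * m0 Y + m1 X \<bullet> m1 Y + m2 X \<bullet> m2 Y"

definition mbasis :: "'k::finite mat set" where
  "mbasis = {mvec 1 0 0} \<union> range (\<lambda>i. mvec 0 (axis i 1) 0) \<union> range (\<lambda>i. mvec 0 0 (axis i 1))"

definition invariant_ip_h :: "('k::finite mat \<Rightarrow> 'k mat \<Rightarrow> real) \<Rightarrow> bool" where
  "invariant_ip_h ip \<longleftrightarrow>
     (\<forall>X\<in>halg. \<forall>Y\<in>halg. \<forall>Z\<in>halg. \<forall>a b. ip (a *\<^sub>R X + b *\<^sub>R Y) Z = a * ip X Z + b * ip Y Z) \<and>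
     (\<forall>X\<in>halg. \<forall>Y\<in>halg. ip X Y = ip Y X) \<and>
     (\<forall>X\<in>halg. X \<noteq> 0 \<longrightarrow> ip X X > 0) \<and>
     (\<forall>h\<in>Hgrp. \<forall>X\<in>halg. \<forall>Y\<in>halg. ip (Ad h X) (Ad h Y) = ip X Y)"

lemma mvec_coords [simp]: "m0 (mvec v0 v w) = v0" "m1 (mvec v0 v w) = v" "m2 (mvec v0 v w) = w"
  by (simp_all add: m0_def m1_def m2_def mvec_def vec_eq_iff)

lemma mbasis_orthonormal:
  "\<forall>x\<in>mbasis. \<forall>y\<in>mbasis. ip_m x y = (if x = y then 1 else (0::real))"
proof -
  have inj: "mvec a v w = mvec a' v' w' \<longleftrightarrow> a = a' \<and> v = v' \<and> w = w'" for a a' :: real and v v' w w' :: "real^'a"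
    by (metis mvec_coords)
  have nz: "axis i (1::real) \<noteq> 0" "0 \<noteq> axis i (1::real)" for i :: 'a
    by (simp_all add: axis_eq_0_iff eq_commute[of 0])
  show ?thesis
    by (auto simp: mbasis_def ip_m_def inj nz inner_axis_axis axis_eq_axis)
qed

lemma Hgrp_subset_Euc: "(Hgrp :: 'k::finite mat set) \<subseteq> Euc"
proof -
  have "orthogonal_matrix (block 1 0 h)" if "orthogonal_matrix h" for h :: "real^'k^'k"
    using that unfolding orthogonal_matrix_def
    by (auto simp: vec_eq_iff matrix_matrix_mult_def transpose_def mat_def block_def
        UNIV_option_conv sum.reindex split: option.splits)
  then show ?thesis by (auto simp: Hgrp_def Euc_def)
qed

lemma pr_m_in_mcompl: "pr_m (X::'k::finite mat) \<in> mcompl"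
  by (auto simp: pr_m_def mcompl_def)

lemma pr_m_mcompl: "(Z::'k::finite mat) \<in> mcompl \<Longrightarrow> pr_m Z = Z"
  by (auto simp: pr_m_def mcompl_def)

lemma pr_m_halg: "(Y::'k::finite mat) \<in> halg \<Longrightarrow> pr_m Y = 0"
  by (auto simp: pr_m_def halg_def m0_def m1_def m2_def mvec_def block_def vec_eq_iff split: option.splits)

lemma skew_iff: "transpose B = - B \<longleftrightarrow> (\<forall>i j. B $ i $ j + B $ j $ i = 0)"
  for B :: "real ^ 'n ^ 'n"
  by (auto simp: vec_eq_iff transpose_def eq_neg_iff_add_eq_0)

lemma halg_subset_euc: "(halg :: 'k::finite mat set) \<subseteq> euc"
proof -
  have "transpose (block 0 0 B) = - block 0 0 B" if "transpose B = - B" for B :: "real^'k^'k"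
    using that unfolding skew_iff by (auto simp: block_def split: option.splits)
  then show ?thesis by (auto simp: halg_def euc_def)
qed

lemma mcompl_subset_euc: "(mcompl :: 'k::finite mat set) \<subseteq> euc"
proof
  fix Z :: "'k mat" assume "Z \<in> mcompl"
  then obtain v0 v w where Z: "Z = mvec v0 v w" by (auto simp: mcompl_def)
  have "Z = block 0 (\<chi> i. Z $ Some i $ None) (\<chi> i j. Z $ Some i $ Some j)"
    by (auto simp: Z vec_eq_iff mvec_def block_def split: option.splits)
  moreover have "transpose (\<chi> i j. Z $ Some i $ Some j) = - (\<chi> i j. Z $ Some i $ Some j)"
    by (auto simp: Z vec_eq_iff mvec_def transpose_def split: option.splits)
  ultimately show "Z \<in> euc" by (auto simp: euc_def)
qed

lemma pr_h_euc:
  assumes "(X::'k::finite mat) \<in> euc"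
  shows "pr_h X \<in> halg"
proof -
  from assms obtain v B where X: "X = block 0 v B" and B: "transpose B = - B"
    by (auto simp: euc_def)
  define C where "C = (\<chi> i j. B $ Some i $ Some j)"
  have B': "B $ i $ j + B $ j $ i = 0" for i j using B unfolding skew_iff by blast
  have B0: "B $ i $ i = 0" for i using B'[of i i] by linarith
  have B1: "B $ None $ Some j = - B $ Some j $ None" for j
    using B'[of None "Some j"] by linarith
  have "pr_h X = block 0 0 (block 0 0 C)"
    by (auto simp: X C_def pr_h_def pr_m_def m0_def m1_def m2_def vec_eq_iff mvec_def block_def
        B0 B1 split: option.splits)
  moreover have "transpose C = - C"
    unfolding skew_iff C_def by (simp add: B')
  ultimately show ?thesis by (auto simp: halg_def)
qed


section \<open>The Spencer differential and its adjoint\<close>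

text \<open>The space of linear maps from \<open>mcompl\<close> to \<open>halg\<close>, extended by 0 off \<open>mcompl\<close>.\<close>

definition hom_mh :: "('k::finite mat \<Rightarrow> 'k mat) set" where
  "hom_mh = {A. (\<forall>X\<in>mcompl. A X \<in> halg) \<and> (\<forall>X. X \<notin> mcompl \<longrightarrow> A X = 0) \<and>
     (\<forall>X\<in>mcompl. \<forall>Y\<in>mcompl. \<forall>a b. A (a *\<^sub>R X + b *\<^sub>R Y) = a *\<^sub>R A X + b *\<^sub>R A Y)}"

definition spencer :: "('k::finite mat \<Rightarrow> 'k mat) \<Rightarrow> 'k mat \<Rightarrow> 'k mat \<Rightarrow> 'k mat" where
  "spencer A X Y = lie (A X) Y - lie (A Y) X"

definition ip_hom ::
  "('k::finite mat \<Rightarrow> 'k mat \<Rightarrow> real) \<Rightarrow> ('k mat \<Rightarrow> 'k mat) \<Rightarrow> ('k mat \<Rightarrow> 'k mat) \<Rightarrow> real" where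
  "ip_hom ip A A' = (\<Sum>x\<in>mbasis. ip (A x) (A' x))"

text \<open>For alternating arguments, half of the sum over all pairs of basis vectors is the sum over
  the pairs \<open>(x_i, x_j)\<close> with \<open>i < j\<close>, for any enumeration of the basis.\<close>

definition ip_alt ::
  "('k::finite mat \<Rightarrow> 'k mat \<Rightarrow> 'k mat) \<Rightarrow> ('k mat \<Rightarrow> 'k mat \<Rightarrow> 'k mat) \<Rightarrow> real" where
  "ip_alt T T' = (1/2) * (\<Sum>x\<in>mbasis. \<Sum>y\<in>mbasis. ip_m (T x y) (T' x y))"

definition spencer_adj ::
  "('k::finite mat \<Rightarrow> 'k mat \<Rightarrow> real) \<Rightarrow> ('k mat \<Rightarrow> 'k mat \<Rightarrow> 'k mat) \<Rightarrow> 'k mat \<Rightarrow> 'k mat" where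
  "spencer_adj ip T =
     (THE B. B \<in> hom_mh \<and> (\<forall>A\<in>hom_mh. ip_alt (spencer A) T = ip_hom ip A B))"


section \<open>Principal bundles and Cartan connections\<close>

text \<open>\<open>Hgrp\<close> carries its smooth structure as a closed submanifold of the space of matrices; it
  enters through smoothness of maps on subsets of products with that space.\<close>

definition principal_bundle ::
  "('p::topological_space, 'e::real_normed_vector) chart set \<Rightarrow>
   ('b::topological_space, 'f::real_normed_vector) chart set \<Rightarrow>
   ('p \<Rightarrow> 'b) \<Rightarrow> ('p \<Rightarrow> 'k::finite mat \<Rightarrow> 'p) \<Rightarrow> bool" where
  "principal_bundle AP AN p r \<longleftrightarrow>
     smooth_map_on AP AN UNIV p \<and>
     smooth_map_on (prod_atlas AP euclidean_atlas) AP (UNIV \<times> Hgrp) (\<lambda>(u, h). r u h) \<and>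
     (\<forall>u. r u (mat 1) = u) \<and>
     (\<forall>u. \<forall>g\<in>Hgrp. \<forall>h\<in>Hgrp. r (r u g) h = r u (g ** h)) \<and>
     (\<forall>u. \<forall>h\<in>Hgrp. p (r u h) = p u) \<and>
     (\<forall>x. \<exists>U \<phi>. open U \<and> x \<in> U \<and>
        diffeo_on AP (prod_atlas AN euclidean_atlas) (p -` U) (U \<times> Hgrp) \<phi> \<and>
        (\<forall>u\<in>p -` U. fst (\<phi> u) = p u) \<and>
        (\<forall>u\<in>p -` U. \<forall>h\<in>Hgrp. snd (\<phi> (r u h)) = snd (\<phi> u) ** h))"

definition fundamental_field ::
  "('p, 'e::real_normed_vector) chart set \<Rightarrow> ('p \<Rightarrow> 'k::finite mat \<Rightarrow> 'p) \<Rightarrow> 'k mat \<Rightarrow> 'p \<Rightarrow> ('p, 'e) tvec" where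
  "fundamental_field AP r X u = velocity0 AP (\<lambda>t. r u (mexp (t *\<^sub>R X)))"

definition equivariant_form ::
  "('p, 'e::real_normed_vector) chart set \<Rightarrow> ('p \<Rightarrow> 'k::finite mat \<Rightarrow> 'p) \<Rightarrow>
   ('p \<Rightarrow> ('p, 'e) tvec \<Rightarrow> 'k mat) \<Rightarrow> bool" where
  "equivariant_form AP r \<omega> \<longleftrightarrow>
     (\<forall>h\<in>Hgrp. \<forall>u. \<forall>\<xi>\<in>tangent_space AP u.
        \<omega> (r u h) (tangent_map AP AP (\<lambda>u'. r u' h) u \<xi>) = Ad (matrix_inv h) (\<omega> u \<xi>))"

definition cartan_connection ::
  "('p, 'e::real_normed_vector) chart set \<Rightarrow> ('p \<Rightarrow> 'k::finite mat \<Rightarrow> 'p) \<Rightarrow>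
   ('p \<Rightarrow> ('p, 'e) tvec \<Rightarrow> 'k mat) \<Rightarrow> bool" where
  "cartan_connection AP r \<omega> \<longleftrightarrow>
     one_form AP euc \<omega> \<and>
     (\<forall>u. bij_betw (\<omega> u) (tangent_space AP u) euc) \<and>
     equivariant_form AP r \<omega> \<and>
     (\<forall>X\<in>halg. \<forall>u. \<omega> u (fundamental_field AP r X u) = X)"

definition principal_connection ::
  "('p, 'e::real_normed_vector) chart set \<Rightarrow> ('p \<Rightarrow> 'k::finite mat \<Rightarrow> 'p) \<Rightarrow>
   ('p \<Rightarrow> ('p, 'e) tvec \<Rightarrow> 'k mat) \<Rightarrow> bool" where
  "principal_connection AP r \<gamma> \<longleftrightarrow>
     one_form AP halg \<gamma> \<and>
     equivariant_form AP r \<gamma> \<and>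
     (\<forall>X\<in>halg. \<forall>u. \<gamma> u (fundamental_field AP r X u) = X)"

definition m_part :: "('p \<Rightarrow> ('p, 'e) tvec \<Rightarrow> 'k::finite mat) \<Rightarrow> 'p \<Rightarrow> ('p, 'e) tvec \<Rightarrow> 'k mat" where
  "m_part \<omega> = (\<lambda>u \<xi>. pr_m (\<omega> u \<xi>))"

definition cartan_curvature ::
  "('p, 'e::real_normed_vector) chart set \<Rightarrow> ('p \<Rightarrow> ('p, 'e) tvec \<Rightarrow> 'k::finite mat) \<Rightarrow>
   'p \<Rightarrow> ('p, 'e) tvec \<Rightarrow> ('p, 'e) tvec \<Rightarrow> 'k mat" where
  "cartan_curvature AP \<omega> u \<xi> \<eta> = ext_deriv AP \<omega> u \<xi> \<eta> + lie (\<omega> u \<xi>) (\<omega> u \<eta>)"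

definition const_field ::
  "('p, 'e::real_normed_vector) chart set \<Rightarrow> ('p \<Rightarrow> ('p, 'e) tvec \<Rightarrow> 'k::finite mat) \<Rightarrow>
   'k mat \<Rightarrow> 'p \<Rightarrow> ('p, 'e) tvec" where
  "const_field AP \<omega> X u = inv_into (tangent_space AP u) (\<omega> u) X"

definition torsion ::
  "('p, 'e::real_normed_vector) chart set \<Rightarrow> ('p \<Rightarrow> ('p, 'e) tvec \<Rightarrow> 'k::finite mat) \<Rightarrow>
   'p \<Rightarrow> 'k mat \<Rightarrow> 'k mat \<Rightarrow> 'k mat" where
  "torsion AP \<omega> u X Y =
     pr_m (cartan_curvature AP \<omega> u (const_field AP \<omega> X u) (const_field AP \<omega> Y u))"

definition normal_connection ::
  "('k::finite mat \<Rightarrow> 'k mat \<Rightarrow> real) \<Rightarrow> ('p, 'e::real_normed_vector) chart set \<Rightarrow>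
   ('p \<Rightarrow> ('p, 'e) tvec \<Rightarrow> 'k mat) \<Rightarrow> bool" where
  "normal_connection ip AP \<omega> \<longleftrightarrow> (\<forall>u. spencer_adj ip (torsion AP \<omega> u) = (\<lambda>_. 0))"

end

theory Submission
  imports Defs
begin

text \<open>
  Two Cartan connections with the same \<open>mcompl\<close>-part \<open>\<theta>\<close> differ, at every point \<open>u\<close>, by a linear map
  \<open>A\<close> from \<open>mcompl\<close> to \<open>halg\<close>, applied to \<open>\<theta>\<close>. The torsion is \<open>d\<theta> + pr_m [X, Y]\<close>, evaluated on the
  constant fields of the connection, and passing from one connection to the other moves these fields
  by fundamental fields. Infinitesimal equivariance of \<open>\<theta>\<close> says \<open>d\<theta>(\<zeta>_Z, \<eta>) = - [Z, \<theta>(\<eta>)]\<close>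
  (\<open>ext_deriv_fundamental_field\<close>), so the torsions differ exactly by the Spencer differential of \<open>A\<close>
  (\<open>torsion_change\<close>). Normality is therefore an affine linear equation for \<open>A\<close> at each point, and the
  theorem says that this equation has a unique solution which moreover depends smoothly and
  equivariantly on the point.

  Orthogonality of a tensor \<open>T\<close> to the image of the Spencer differential does not involve the inner
  product on \<open>halg\<close>: it says that for every \<open>X\<close> in \<open>mcompl\<close> the matrix \<open>contraction T X\<close>, the sum of
  the two diagonal blocks of \<open>T X\<close> on the two copies of R^(n-1) in \<open>mcompl\<close>, is symmetric
  (\<open>spencer_adj_zero_iff\<close>). In coordinates the equation for \<open>A\<close> splits into an equation
  for \<open>A e0\<close> and two copies of the system \<open>(4 + C + C^2) a = b\<close> for arrays \<open>a_kij\<close> that are skew in \<open>i, j\<close>,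
  where \<open>C\<close> permutes the three indices cyclically. The operator \<open>C\<close> satisfies \<open>C^3 = 1\<close>, so
  \<open>4 + C + C^2\<close> is \<open>6\<close> on the invariant arrays and \<open>3\<close> on a complement. This gives uniqueness
  (\<open>spencer_of_symmetric_zero\<close>) and an explicit solution (\<open>correction\<close>).

  Smoothness of the normalized connection follows from the explicit formula as soon as the torsion is
  smooth (\<open>Ck_on_torsion\<close>), which rests on the smooth dependence of the inverse of a linear map on
  parameters (\<open>Cinf_on_inverse_solution\<close>). Equivariance follows from uniqueness
  (\<open>correction_equivariant\<close>) once the torsion is known to be equivariant (\<open>torsion_equivariant\<close>).

  The analytic facts about \<open>d\<close> that enter, namely independence of the chart, compatibility with right
  translations, and the formula for \<open>d\<theta>(\<zeta>_Z, \<eta>)\<close>, are all instances of one statement on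
  Euclidean spaces: the exterior derivative commutes with pullbacks (\<open>pullback_form\<close>), a
  consequence of the symmetry of second derivatives.
\<close>

section \<open>Differential calculus on open sets\<close>

abbreviation fderiv :: "('a::real_normed_vector \<Rightarrow> 'b::real_normed_vector) \<Rightarrow> 'a \<Rightarrow> 'a \<Rightarrow> 'b" where
  "fderiv f x \<equiv> frechet_derivative f (at x)"

lemma frechet_derivative_eqI: "(f has_derivative f') (at x) \<Longrightarrow> fderiv f x = f'"
  by (rule frechet_derivative_at[symmetric])

lemmas differentiable_has_derivative = frechet_derivative_works[THEN iffD1]

lemma Ck_on_cong:
  assumes "open W" "Ck_on k W f" "\<And>x. x \<in> W \<Longrightarrow> f x = g x"
  shows "Ck_on k W g"
  using assms(2,3)
proof (induction k arbitrary: f g)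
  case 0
  then show ?case by (metis Ck_on.simps(1) continuous_on_cong)
next
  case (Suc k)
  have "g differentiable (at x)" if "x \<in> W" for x
  proof -
    have "f differentiable (at x)" using Suc.prems that by simp
    from has_derivative_transform_within_open[OF differentiable_has_derivative[OF this] assms(1) that]
    show ?thesis using Suc.prems by (auto simp: differentiable_def)
  qed
  moreover have "Ck_on k W (\<lambda>x. fderiv g x v)" for v
  proof (rule Suc.IH)
    show "Ck_on k W (\<lambda>x. fderiv f x v)" using Suc.prems by simp
    show "fderiv f x v = fderiv g x v" if "x \<in> W" for x
      using frechet_derivative_transform_within_open[of f x W g] Suc.prems that assms(1) by auto
  qed
  ultimately show ?case by simp
qed

lemma Ck_on_derivI:
  assumes "open W" "\<And>x. x \<in> W \<Longrightarrow> (f has_derivative f' x) (at x)" "\<And>v. Ck_on k W (\<lambda>x. f' x v)"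
  shows "Ck_on (Suc k) W f"
proof -
  have "Ck_on k W (\<lambda>x. fderiv f x v)" for v
    by (rule Ck_on_cong[OF assms(1) assms(3)[of v]]) (simp add: frechet_derivative_eqI[OF assms(2)])
  then show ?thesis using assms(2) by (auto simp: differentiable_def)
qed

lemma Ck_on_subset: "Ck_on k W f \<Longrightarrow> V \<subseteq> W \<Longrightarrow> Ck_on k V f"
  by (induction k arbitrary: f) (auto intro: continuous_on_subset)

lemma Ck_on_SucD: "Ck_on (Suc k) W f \<Longrightarrow> Ck_on k W f"
proof (induction k arbitrary: f)
  case 0
  then show ?case
    by (auto intro!: continuous_at_imp_continuous_on differentiable_imp_continuous_within)
qed simp

lemma Ck_on_imp_continuous_on: "Ck_on k W f \<Longrightarrow> continuous_on W f"
proof (induction k)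
  case (Suc k)
  then show ?case using Ck_on_SucD by blast
qed simp

text \<open>Through this lemma the local extensions in the definition of \<open>smooth_on\<close> patch together on open
  sets, see \<open>smooth_on_open_iff\<close>.\<close>

lemma Ck_on_local:
  assumes "\<And>x. x \<in> W \<Longrightarrow> \<exists>V. open V \<and> x \<in> V \<and> Ck_on k V f"
  shows "Ck_on k W f"
  using assms
proof (induction k arbitrary: f)
  case 0
  have "isCont f x" if "x \<in> W" for x
  proof -
    obtain V where "open V" "x \<in> V" "continuous_on V f" using 0[of x] \<open>x \<in> W\<close> by auto
    then show ?thesis by (simp add: continuous_on_eq_continuous_at)
  qed
  then show ?case by (simp add: continuous_at_imp_continuous_on)
next
  case (Suc k)
  have "Ck_on k W (\<lambda>x. fderiv f x v)" for v
    using Suc.prems by (intro Suc.IH) fastforce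
  moreover have "f differentiable at x" if "x \<in> W" for x
    using Suc.prems[OF that] by auto
  ultimately show ?case by simp
qed

lemma Ck_on_const: "Ck_on k W (\<lambda>x. c)"
  by (induction k arbitrary: c) auto

lemma Ck_on_bounded_linear:
  assumes "open W" "bounded_linear L" "Ck_on k W f"
  shows "Ck_on k W (\<lambda>x. L (f x))"
  using assms(3)
proof (induction k arbitrary: f)
  case 0
  then show ?case using assms(2) by (auto intro: bounded_linear.continuous_on)
next
  case (Suc k)
  show ?case
  proof (rule Ck_on_derivI[OF assms(1)])
    show "((\<lambda>x. L (f x)) has_derivative (\<lambda>v. L (fderiv f x v))) (at x)" if "x \<in> W" for x
      using Suc.prems that by (auto intro!: bounded_linear.has_derivative[OF assms(2)] differentiable_has_derivative)
    show "Ck_on k W (\<lambda>x. L (fderiv f x v))" for v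
      using Suc by auto
  qed
qed

lemma Ck_on_add:
  assumes "open W" "Ck_on k W f" "Ck_on k W g"
  shows "Ck_on k W (\<lambda>x. f x + g x)"
  using assms(2,3)
proof (induction k arbitrary: f g)
  case 0
  then show ?case by (auto intro: continuous_on_add)
next
  case (Suc k)
  show ?case
  proof (rule Ck_on_derivI[OF assms(1)])
    show "((\<lambda>x. f x + g x) has_derivative
        (\<lambda>v. fderiv f x v + fderiv g x v)) (at x)" if "x \<in> W" for x
      using Suc.prems that by (auto intro!: has_derivative_add differentiable_has_derivative)
    show "Ck_on k W (\<lambda>x. fderiv f x v + fderiv g x v)" for v
      using Suc by auto
  qed
qed

lemma Ck_on_bilinear:
  assumes "open W" "bounded_bilinear B" "Ck_on k W f" "Ck_on k W g"
  shows "Ck_on k W (\<lambda>x. B (f x) (g x))"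
  using assms(3,4)
proof (induction k arbitrary: f g)
  case 0
  then show ?case using assms(2) by (auto intro: bounded_bilinear.continuous_on)
next
  case (Suc k)
  show ?case
  proof (rule Ck_on_derivI[OF assms(1)])
    show "((\<lambda>x. B (f x) (g x)) has_derivative
        (\<lambda>v. B (f x) (fderiv g x v) + B (fderiv f x v) (g x))) (at x)"
      if "x \<in> W" for x
      using Suc.prems that
      by (auto intro!: bounded_bilinear.FDERIV[OF assms(2)] differentiable_has_derivative)
    show "Ck_on k W (\<lambda>x. B (f x) (fderiv g x v) + B (fderiv f x v) (g x))" for v
      using Suc.prems Suc.prems[THEN Ck_on_SucD] by (intro Ck_on_add[OF assms(1)] Suc.IH) simp_all
  qed
qed

lemma Ck_on_sum:
  assumes "open W" "\<And>i. i \<in> I \<Longrightarrow> Ck_on k W (f i)"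
  shows "Ck_on k W (\<lambda>x. \<Sum>i\<in>I. f i x)"
  using assms(2)
  by (induction I rule: infinite_finite_induct) (auto intro: Ck_on_const Ck_on_add[OF assms(1)])

lemma Ck_on_diff:
  assumes "open W" "Ck_on k W f" "Ck_on k W g"
  shows "Ck_on k W (\<lambda>x. f x - g x)"
  using Ck_on_add[OF assms(1,2) Ck_on_bounded_linear[OF assms(1) bounded_linear_minus[OF bounded_linear_ident] assms(3)]]
  by simp

lemma frechet_derivative_basis_sum:
  fixes x :: "'a::euclidean_space"
  assumes "g differentiable (at x)"
  shows "fderiv g x v = (\<Sum>b\<in>Basis. (v \<bullet> b) *\<^sub>R fderiv g x b)"
proof -
  interpret linear "fderiv g x" by (rule linear_frechet_derivative[OF assms])
  have "fderiv g x v = fderiv g x (\<Sum>b\<in>Basis. (v \<bullet> b) *\<^sub>R b)"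
    by (simp add: euclidean_representation)
  then show ?thesis by (simp add: sum scale)
qed

text \<open>The intermediate space is Euclidean because the chain rule is expanded in a basis of it: each
  directional derivative of the composite is a finite sum of products of C^k functions, to which
  the induction hypothesis applies.\<close>

lemma Ck_on_compose:
  fixes f :: "'a::real_normed_vector \<Rightarrow> 'b::euclidean_space" and g :: "'b \<Rightarrow> 'c::real_normed_vector"
  assumes "open W" "open V" "f ` W \<subseteq> V" "Ck_on k W f" "Ck_on k V g"
  shows "Ck_on k W (\<lambda>x. g (f x))"
  using assms(4,5)
proof (induction k arbitrary: g)
  case 0
  then show ?case using assms(3) by (auto intro: continuous_on_compose2)
next
  case (Suc k)
  have g: "g differentiable (at (f x))" if "x \<in> W" for x
    using Suc.prems that assms(3) by auto
  show ?case
  proof (rule Ck_on_derivI[OF assms(1)])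
    fix x assume x: "x \<in> W"
    have "((\<lambda>x. g (f x)) has_derivative
        (\<lambda>v. fderiv g (f x) (fderiv f x v))) (at x)"
      using diff_chain_at[of f "fderiv f x" x g "fderiv g (f x)"]
        differentiable_has_derivative[OF g[OF x]] differentiable_has_derivative[of f "at x"] Suc.prems x
      by (auto simp: o_def)
    then show "((\<lambda>x. g (f x)) has_derivative
        (\<lambda>v. \<Sum>b\<in>Basis. (fderiv f x v \<bullet> b) *\<^sub>R fderiv g (f x) b)) (at x)"
      by (subst (asm) frechet_derivative_basis_sum[OF g[OF x]])
  next
    fix v
    show "Ck_on k W (\<lambda>x. \<Sum>b\<in>Basis. (fderiv f x v \<bullet> b) *\<^sub>R fderiv g (f x) b)"
    proof (intro Ck_on_sum[OF assms(1)] Ck_on_bilinear[OF assms(1) bounded_bilinear_scaleR])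
      fix b
      show "Ck_on k W (\<lambda>x. fderiv f x v \<bullet> b)"
        using Suc.prems by (intro Ck_on_bounded_linear[OF assms(1) bounded_linear_inner_left]) simp
      show "Ck_on k W (\<lambda>x. fderiv g (f x) b)"
        using Suc.prems by (intro Suc.IH Ck_on_SucD[OF Suc.prems(1)]) simp
    qed
  qed
qed

abbreviation Cinf_on :: "'a::real_normed_vector set \<Rightarrow> ('a \<Rightarrow> 'b::real_normed_vector) \<Rightarrow> bool" where
  "Cinf_on W f \<equiv> \<forall>k. Ck_on k W f"

lemma smooth_on_open_iff:
  assumes "open S"
  shows "smooth_on S f \<longleftrightarrow> Cinf_on S f"
proof
  assume s: "smooth_on S f"
  show "Cinf_on S f"
  proof (intro allI Ck_on_local)
    fix k x assume "x \<in> S"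
    then obtain W g where W: "open W" "x \<in> W" "Cinf_on W g" "\<forall>y\<in>S \<inter> W. f y = g y"
      using s unfolding smooth_on_def by blast
    have "Ck_on k (S \<inter> W) f"
      by (rule Ck_on_cong[of _ _ g]) (use W assms Ck_on_subset in \<open>auto intro: Ck_on_subset[of k W]\<close>)
    then show "\<exists>V. open V \<and> x \<in> V \<and> Ck_on k V f"
      using W assms \<open>x \<in> S\<close> by (intro exI[of _ "S \<inter> W"]) auto
  qed
next
  assume "Cinf_on S f"
  then show "smooth_on S f" unfolding smooth_on_def using assms by blast
qed

lemma Cinf_on_frechet_derivative:
  assumes "Cinf_on W f"
  shows "Cinf_on W (\<lambda>x. fderiv f x v)"
  using assms by (metis Ck_on.simps(2))

lemma Cinf_on_differentiable: "Cinf_on W f \<Longrightarrow> x \<in> W \<Longrightarrow> f differentiable (at x)"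
  by (metis Ck_on.simps(2))

lemma Cinf_on_compose:
  fixes f :: "'a::real_normed_vector \<Rightarrow> 'b::euclidean_space" and g :: "'b \<Rightarrow> 'c::real_normed_vector"
  assumes "open W" "open V" "f ` W \<subseteq> V" "Cinf_on W f" "Cinf_on V g"
  shows "Cinf_on W (\<lambda>x. g (f x))"
  using Ck_on_compose[OF assms(1-3)] assms(4,5) by blast

lemma Cinf_on_Pair:
  assumes "open W" "Cinf_on W f" "Cinf_on W g"
  shows "Cinf_on W (\<lambda>x. (f x, g x))"
proof
  fix k
  have "Ck_on k W (\<lambda>x. (f x, 0) + (0, g x))"
    using assms(2,3)
    by (intro Ck_on_add[OF assms(1)]
      Ck_on_bounded_linear[OF assms(1), where L="\<lambda>a. (a, 0)"]
      Ck_on_bounded_linear[OF assms(1), where L="\<lambda>a. (0, a)"])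
      (auto intro: bounded_linear_Pair bounded_linear_ident bounded_linear_zero)
  then show "Ck_on k W (\<lambda>x. (f x, g x))" by simp
qed

lemma Cinf_on_bounded_linear':
  assumes "bounded_linear L"
  shows "Cinf_on W L"
proof
  have U: "Ck_on k UNIV L" for k
  proof (cases k)
    case 0
    then show ?thesis using assms by (auto intro: linear_continuous_on)
  next
    case (Suc j)
    have "Ck_on (Suc j) UNIV L"
      by (rule Ck_on_derivI[where f'="\<lambda>x. L"])
         (auto intro: Ck_on_const bounded_linear_imp_has_derivative[OF assms])
    then show ?thesis using Suc by simp
  qed
  show "Ck_on k W L" for k by (rule Ck_on_subset[OF U]) simp
qed

lemma Ck_on_euclidean_componentwise:
  fixes f :: "'a::real_normed_vector \<Rightarrow> 'b::euclidean_space"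
  assumes "open W" "\<And>b. b \<in> Basis \<Longrightarrow> Ck_on k W (\<lambda>x. f x \<bullet> b)"
  shows "Ck_on k W f"
proof -
  have "Ck_on k W (\<lambda>x. \<Sum>b\<in>Basis. (f x \<bullet> b) *\<^sub>R b)"
    by (intro Ck_on_sum assms Ck_on_bilinear[OF _ bounded_bilinear_scaleR] Ck_on_const)
  then show ?thesis by (simp add: euclidean_representation)
qed

lemma Ck_on_vec:
  fixes f :: "'a::real_normed_vector \<Rightarrow> 'b::euclidean_space ^ 'n"
  assumes "open W" "\<And>i. Ck_on k W (\<lambda>x. f x $ i)"
  shows "Ck_on k W f"
proof (rule Ck_on_euclidean_componentwise[OF assms(1)])
  fix b :: "'b^'n" assume "b \<in> Basis"
  then obtain i c where b: "b = axis i c" by (auto simp: Basis_vec_def)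
  have "Ck_on k W (\<lambda>x. f x $ i \<bullet> c)"
    by (rule Ck_on_bounded_linear[OF assms(1) bounded_linear_inner_left assms(2)])
  then show "Ck_on k W (\<lambda>x. f x \<bullet> b)" by (simp add: b inner_axis)
qed

lemma Ck_on_vec_nth: "open W \<Longrightarrow> Ck_on k W f \<Longrightarrow> Ck_on k W (\<lambda>x. f x $ i)"
  by (rule Ck_on_bounded_linear[OF _ bounded_linear_vec_nth])

lemma Ck_on_mult: "open W \<Longrightarrow> Ck_on k W f \<Longrightarrow> Ck_on k W g \<Longrightarrow> Ck_on k W (\<lambda>x. f x * g x :: real)"
  by (rule Ck_on_bilinear[OF _ bounded_bilinear_mult])

lemma Ck_on_minus: "open W \<Longrightarrow> Ck_on k W f \<Longrightarrow> Ck_on k W (\<lambda>x. - f x)"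
  by (rule Ck_on_bounded_linear[OF _ bounded_linear_minus[OF bounded_linear_ident]])

lemma Ck_on_divide: "open W \<Longrightarrow> Ck_on k W f \<Longrightarrow> Ck_on k W (\<lambda>x. f x / c :: real)"
  by (rule Ck_on_bounded_linear[OF _ bounded_linear_divide])

section \<open>Symmetry of second derivatives and pullbacks\<close>

text \<open>The mean value theorem is applied twice: first in direction \<open>v\<close>, to the difference of \<open>f\<close> in
  direction \<open>w\<close>, and then in direction \<open>w\<close>, to the derivative in direction \<open>v\<close>.\<close>

lemma C2_mixed_difference:
  fixes f :: "'a::real_normed_vector \<Rightarrow> real"
  assumes f: "\<And>x. x \<in> W \<Longrightarrow> f differentiable (at x)"
    and f2: "\<And>x. x \<in> W \<Longrightarrow> (\<lambda>x. fderiv f x v) differentiable (at x)"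
    and box: "\<And>s t. 0 \<le> s \<Longrightarrow> s \<le> h \<Longrightarrow> 0 \<le> t \<Longrightarrow> t \<le> h \<Longrightarrow> x + s *\<^sub>R v + t *\<^sub>R w \<in> W"
    and h: "h > 0"
  shows "\<exists>s t. 0 \<le> s \<and> s \<le> h \<and> 0 \<le> t \<and> t \<le> h \<and>
    f (x + h *\<^sub>R v + h *\<^sub>R w) - f (x + h *\<^sub>R v) - f (x + h *\<^sub>R w) + f x
      = h * h * fderiv (\<lambda>x. fderiv f x v) (x + s *\<^sub>R v + t *\<^sub>R w) w"
proof -
  define D where "D = (\<lambda>x. fderiv f x v)"
  define g where "g = (\<lambda>s. f (x + s *\<^sub>R v + h *\<^sub>R w) - f (x + s *\<^sub>R v + 0 *\<^sub>R w))"
  have fd: "((\<lambda>s. f (x + s *\<^sub>R v + t *\<^sub>R w)) has_real_derivative D (x + s *\<^sub>R v + t *\<^sub>R w)) (at s)"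
    if "0 \<le> s" "s \<le> h" "0 \<le> t" "t \<le> h" for s t
  proof -
    have "((\<lambda>s. x + s *\<^sub>R v + t *\<^sub>R w) has_derivative (\<lambda>r. r *\<^sub>R v)) (at s)"
      by (auto intro!: derivative_eq_intros)
    from diff_chain_at[OF this differentiable_has_derivative[OF f[OF box[OF that]]]]
    have "((\<lambda>s. f (x + s *\<^sub>R v + t *\<^sub>R w)) has_derivative
        (\<lambda>r. fderiv f (x + s *\<^sub>R v + t *\<^sub>R w) (r *\<^sub>R v))) (at s)"
      by (simp add: o_def)
    then show ?thesis
      unfolding has_field_derivative_def D_def
      by (simp add: linear_cmul[OF linear_frechet_derivative[OF f[OF box[OF that]]]] mult_commute_abs)
  qed
  have "\<exists>s. s > 0 \<and> s < h \<and>
      g h - g 0 = (h - 0) * (D (x + s *\<^sub>R v + h *\<^sub>R w) - D (x + s *\<^sub>R v + 0 *\<^sub>R w))"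
    unfolding g_def
    by (rule MVT2[OF h]) (intro DERIV_diff fd; use h in simp)
  then obtain s where s: "s > 0" "s < h"
    "g h - g 0 = h * (D (x + s *\<^sub>R v + h *\<^sub>R w) - D (x + s *\<^sub>R v + 0 *\<^sub>R w))" by auto
  have dd: "((\<lambda>t. D (x + s *\<^sub>R v + t *\<^sub>R w)) has_real_derivative
      fderiv D (x + s *\<^sub>R v + t *\<^sub>R w) w) (at t)"
    if "0 \<le> t" "t \<le> h" for t
  proof -
    have X: "x + s *\<^sub>R v + t *\<^sub>R w \<in> W" using box s that by simp
    have D: "D differentiable (at (x + s *\<^sub>R v + t *\<^sub>R w))"
      unfolding D_def by (rule f2[OF X])
    have "((\<lambda>t. x + s *\<^sub>R v + t *\<^sub>R w) has_derivative (\<lambda>r. r *\<^sub>R w)) (at t)"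
      by (auto intro!: derivative_eq_intros)
    from diff_chain_at[OF this differentiable_has_derivative[OF D]]
    have "((\<lambda>t. D (x + s *\<^sub>R v + t *\<^sub>R w)) has_derivative
        (\<lambda>r. fderiv D (x + s *\<^sub>R v + t *\<^sub>R w) (r *\<^sub>R w))) (at t)"
      by (simp add: o_def)
    then show ?thesis
      unfolding has_field_derivative_def
      by (simp add: linear_cmul[OF linear_frechet_derivative[OF D]] mult_commute_abs)
  qed
  have "\<exists>t. t > 0 \<and> t < h \<and> D (x + s *\<^sub>R v + h *\<^sub>R w) - D (x + s *\<^sub>R v + 0 *\<^sub>R w)
      = (h - 0) * fderiv D (x + s *\<^sub>R v + t *\<^sub>R w) w"
    by (rule MVT2[OF h]) (rule dd)
  then obtain t where "t > 0" "t < h" "D (x + s *\<^sub>R v + h *\<^sub>R w) - D (x + s *\<^sub>R v + 0 *\<^sub>R w)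
      = h * fderiv D (x + s *\<^sub>R v + t *\<^sub>R w) w" by auto
  with s show ?thesis unfolding g_def D_def
    by (intro exI[of _ s] exI[of _ t]) (simp add: algebra_simps)
qed

text \<open>The second difference is symmetric in \<open>v\<close> and \<open>w\<close>, hence equals \<open>h^2\<close> times either mixed derivative
  at points close to \<open>x\<close>; continuity of the second derivatives then gives equality at \<open>x\<close>.\<close>

lemma real_C2_symmetric:
  fixes f :: "'a::real_normed_vector \<Rightarrow> real"
  assumes "open W" "Ck_on 2 W f" "x \<in> W"
  shows "fderiv (\<lambda>x. fderiv f x v) x w
       = fderiv (\<lambda>x. fderiv f x w) x v"
proof -
  define P where "P = (\<lambda>v w y. fderiv (\<lambda>x. fderiv f x v) y w)"
  have C: "Ck_on (Suc (Suc 0)) W f" using assms(2) by (simp only: numeral_2_eq_2)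
  have cont: "isCont (P v w) x" for v w
    using C assms(1,3) unfolding P_def by (simp add: continuous_on_eq_continuous_at)
  have f: "f differentiable (at y)" "(\<lambda>x. fderiv f x v) differentiable (at y)"
    if "y \<in> W" for y v using C that by auto
  have "\<bar>P v w x - P w v x\<bar> \<le> e" if e: "e > 0" for e
  proof -
    have "\<exists>d>0. \<forall>y. dist y x < d \<longrightarrow> \<bar>P v w y - P v w x\<bar> < e/2" for v w
      using cont[of v w] e unfolding continuous_at_eps_delta dist_real_def by (meson half_gt_zero)
    then obtain d1 d2 where d: "d1 > 0" "\<And>y. dist y x < d1 \<Longrightarrow> \<bar>P v w y - P v w x\<bar> < e/2"
      "d2 > 0" "\<And>y. dist y x < d2 \<Longrightarrow> \<bar>P w v y - P w v x\<bar> < e/2" by metis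
    obtain d3 where d3: "d3 > 0" "\<And>y. dist y x < d3 \<Longrightarrow> y \<in> W"
      using assms(1,3) unfolding open_dist by blast
    define d where "d = min d1 (min d2 d3)"
    \<comment> \<open>This choice keeps the whole parallelogram with sides \<open>h v\<close> and \<open>h w\<close> within distance \<open>d\<close> of \<open>x\<close>.\<close>
    define h where "h = d / (2 * (norm v + norm w + 1))"
    have "d > 0" using d d3 by (simp add: d_def)
    then have h: "h > 0" by (simp add: h_def add_nonneg_pos)
    have small: "dist (x + s *\<^sub>R v + t *\<^sub>R w) x < d" if "0 \<le> s" "s \<le> h" "0 \<le> t" "t \<le> h" for s t
    proof -
      have "dist (x + s *\<^sub>R v + t *\<^sub>R w) x \<le> s * norm v + t * norm w"
        using norm_triangle_ineq[of "s *\<^sub>R v" "t *\<^sub>R w"] that by (simp add: dist_norm add.assoc)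
      also have "\<dots> \<le> h * norm v + h * norm w"
        using that by (intro add_mono mult_right_mono) auto
      also have "\<dots> \<le> h * (norm v + norm w + 1)" using h by (simp add: algebra_simps)
      also have "\<dots> = d / 2"
      proof -
        define N where "N = norm v + norm w + 1"
        have "N > 0" by (simp add: N_def add_nonneg_pos)
        then show ?thesis unfolding h_def N_def[symmetric] by simp
      qed
      also have "\<dots> < d" using \<open>d > 0\<close> by simp
      finally show ?thesis .
    qed
    obtain s t where st: "0 \<le> s" "s \<le> h" "0 \<le> t" "t \<le> h"
      "f (x + h *\<^sub>R v + h *\<^sub>R w) - f (x + h *\<^sub>R v) - f (x + h *\<^sub>R w) + f x
      = h * h * P v w (x + s *\<^sub>R v + t *\<^sub>R w)"
      using C2_mixed_difference[of W f v h x w, OF f(1,2) _ h] small d3 unfolding P_def d_def by force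
    have small': "dist (x + s *\<^sub>R w + t *\<^sub>R v) x < d" if "0 \<le> s" "s \<le> h" "0 \<le> t" "t \<le> h" for s t
      using small[of t s] that by (simp add: algebra_simps)
    obtain s' t' where st': "0 \<le> s'" "s' \<le> h" "0 \<le> t'" "t' \<le> h"
      "f (x + h *\<^sub>R w + h *\<^sub>R v) - f (x + h *\<^sub>R w) - f (x + h *\<^sub>R v) + f x
      = h * h * P w v (x + s' *\<^sub>R w + t' *\<^sub>R v)"
      using C2_mixed_difference[of W f w h x v, OF f(1,2) _ h] small' d3 unfolding P_def d_def by force
    have "h * h * P v w (x + s *\<^sub>R v + t *\<^sub>R w) = h * h * P w v (x + s' *\<^sub>R w + t' *\<^sub>R v)"
      unfolding st(5)[symmetric] st'(5)[symmetric] by (simp add: algebra_simps)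
    then have "P v w (x + s *\<^sub>R v + t *\<^sub>R w) = P w v (x + s' *\<^sub>R w + t' *\<^sub>R v)" using h by simp
    moreover have "\<bar>P v w (x + s *\<^sub>R v + t *\<^sub>R w) - P v w x\<bar> < e/2"
      using d(2) small[of s t] st by (simp add: d_def)
    moreover have "\<bar>P w v (x + s' *\<^sub>R w + t' *\<^sub>R v) - P w v x\<bar> < e/2"
      using d(4) small'[of s' t'] st' by (simp add: d_def)
    ultimately show ?thesis by linarith
  qed
  then have "\<bar>P v w x - P w v x\<bar> \<le> 0" by (meson field_le_epsilon add_0 order_refl dense_ge)
  then show ?thesis by (simp add: P_def)
qed

lemma frechet_derivative_bounded_linear:
  assumes "bounded_linear L" "f differentiable (at x)"
  shows "fderiv (\<lambda>x. L (f x)) x v = L (fderiv f x v)"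
  using frechet_derivative_eqI[OF bounded_linear.has_derivative[OF assms(1) differentiable_has_derivative[OF assms(2)]]]
  by simp

lemma C2_symmetric:
  fixes f :: "'a::real_normed_vector \<Rightarrow> 'b::euclidean_space"
  assumes W: "open W" and C: "Ck_on 2 W f" and x: "x \<in> W"
  shows "fderiv (\<lambda>x. fderiv f x v) x w
       = fderiv (\<lambda>x. fderiv f x w) x v"
proof (rule euclidean_eqI)
  fix b :: 'b assume "b \<in> Basis"
  have C': "Ck_on (Suc (Suc 0)) W f" using C by (simp only: numeral_2_eq_2)
  have L: "bounded_linear (\<lambda>y. y \<bullet> b)" by (rule bounded_linear_inner_left)
  have eq: "fderiv (\<lambda>x. fderiv f x v) x w \<bullet> b
      = fderiv (\<lambda>x. fderiv (\<lambda>x. f x \<bullet> b) x v) x w" for v w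
  proof -
    have "fderiv (\<lambda>x. fderiv f x v) x w \<bullet> b
        = fderiv (\<lambda>x. fderiv f x v \<bullet> b) x w"
      using frechet_derivative_bounded_linear[OF L, of "\<lambda>x. fderiv f x v" x w] C' x by simp
    also have "\<dots> = fderiv (\<lambda>x. fderiv (\<lambda>x. f x \<bullet> b) x v) x w"
    proof (subst frechet_derivative_transform_within_open[OF _ W x])
      show "(\<lambda>x. fderiv f x v \<bullet> b) differentiable at x"
        using C' x by (auto intro!: differentiable_inner)
      show "fderiv f y v \<bullet> b = fderiv (\<lambda>x. f x \<bullet> b) y v" if "y \<in> W" for y
        using frechet_derivative_bounded_linear[OF L, of f y v] C' that by simp
    qed simp
    finally show ?thesis .
  qed
  show "fderiv (\<lambda>x. fderiv f x v) x w \<bullet> b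
       = fderiv (\<lambda>x. fderiv f x w) x v \<bullet> b"
    unfolding eq by (rule real_C2_symmetric[OF W Ck_on_bounded_linear[OF W L C] x])
qed

text \<open>For a family \<open>\<alpha>\<close> that is linear in its first argument, i.e. a 1-form \<open>\<alpha>\<close> on \<open>V\<close>, the form \<open>\<beta>\<close> is the
  pullback along \<open>F\<close>, and the identity is \<open>d (F^* \<alpha>) = F^* (d \<alpha>)\<close>. Differentiating \<open>\<beta>\<close> produces, besides the
  expected term, \<open>\<alpha>\<close> applied to the second derivative of \<open>F\<close>, which is symmetric and cancels.\<close>

lemma pullback_form:
  fixes F :: "'a::real_normed_vector \<Rightarrow> 'e::euclidean_space" and \<alpha> :: "'e \<Rightarrow> 'e \<Rightarrow> 'v::real_normed_vector"
  assumes U: "open U" and F: "Ck_on 2 U F" "F ` U \<subseteq> V" and V: "open V"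
    and lin: "\<And>y. y \<in> V \<Longrightarrow> linear (\<lambda>w. \<alpha> w y)"
    and diff: "\<And>w y. y \<in> V \<Longrightarrow> \<alpha> w differentiable (at y)"
    and \<beta>: "\<And>x v. x \<in> U \<Longrightarrow> \<beta> v x = \<alpha> (fderiv F x v) (F x)"
    and x: "x \<in> U"
  shows pullback_differentiable: "\<beta> \<eta> differentiable (at x)"
    and exterior_derivative_pullback: "fderiv (\<beta> \<eta>) x \<xi> - fderiv (\<beta> \<xi>) x \<eta>
    = fderiv (\<alpha> (fderiv F x \<eta>)) (F x) (fderiv F x \<xi>)
    - fderiv (\<alpha> (fderiv F x \<xi>)) (F x) (fderiv F x \<eta>)"
proof -
  let ?D = "\<lambda>x. fderiv F x"
  have C: "Ck_on (Suc (Suc 0)) U F" using F(1) by (simp only: numeral_2_eq_2)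
  have Fx: "F x \<in> V" using x F by auto
  have expand: "\<alpha> w y = (\<Sum>b\<in>Basis. (w \<bullet> b) *\<^sub>R \<alpha> b y)" if "y \<in> V" for w y
  proof -
    have "\<alpha> w y = \<alpha> (\<Sum>b\<in>Basis. (w \<bullet> b) *\<^sub>R b) y" by (simp add: euclidean_representation)
    then show ?thesis using linear_sum[OF lin[OF that], of "\<lambda>b. (w \<bullet> b) *\<^sub>R b" Basis]
      linear_cmul[OF lin[OF that]] by simp
  qed
  have D\<alpha>: "fderiv (\<alpha> w) (F x) = (\<lambda>z. \<Sum>b\<in>Basis. (w \<bullet> b) *\<^sub>R fderiv (\<alpha> b) (F x) z)" for w
  proof (rule frechet_derivative_eqI, rule has_derivative_transform_within_open[OF _ V Fx])
    show "((\<lambda>y. \<Sum>b\<in>Basis. (w \<bullet> b) *\<^sub>R \<alpha> b y) has_derivative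
      (\<lambda>z. \<Sum>b\<in>Basis. (w \<bullet> b) *\<^sub>R fderiv (\<alpha> b) (F x) z)) (at (F x))"
      by (intro has_derivative_sum has_derivative_scaleR_right differentiable_has_derivative diff[OF Fx])
  qed (rule expand[symmetric])
  have has_D\<beta>: "(\<beta> \<eta> has_derivative (\<lambda>z. \<Sum>b\<in>Basis. (?D x \<eta> \<bullet> b) *\<^sub>R fderiv (\<alpha> b) (F x) (?D x z) +
        (fderiv (\<lambda>x. ?D x \<eta>) x z \<bullet> b) *\<^sub>R \<alpha> b (F x))) (at x)" for \<eta>
    proof (rule has_derivative_transform_within_open[OF _ U x])
      show "((\<lambda>x. \<Sum>b\<in>Basis. (?D x \<eta> \<bullet> b) *\<^sub>R \<alpha> b (F x)) has_derivative (\<lambda>z. \<Sum>b\<in>Basis. (?D x \<eta> \<bullet> b) *\<^sub>R fderiv (\<alpha> b) (F x) (?D x z) +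
        (fderiv (\<lambda>x. ?D x \<eta>) x z \<bullet> b) *\<^sub>R \<alpha> b (F x))) (at x)"
      proof (intro has_derivative_sum bounded_bilinear.FDERIV[OF bounded_bilinear_scaleR] has_derivative_inner_left)
        fix b
        show "((\<lambda>x. ?D x \<eta>) has_derivative fderiv (\<lambda>x. ?D x \<eta>) x) (at x)"
          using C x by (intro differentiable_has_derivative) auto
        have "(F has_derivative ?D x) (at x)" using C x by (intro differentiable_has_derivative) auto
        from diff_chain_at[OF this differentiable_has_derivative[OF diff[OF Fx, of b]]]
        show "((\<lambda>x. \<alpha> b (F x)) has_derivative (\<lambda>z. fderiv (\<alpha> b) (F x) (?D x z))) (at x)"
          by (simp add: o_def)
      qed
      show "(\<Sum>b\<in>Basis. (?D y \<eta> \<bullet> b) *\<^sub>R \<alpha> b (F y)) = \<beta> \<eta> y" if "y \<in> U" for y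
      proof -
        have "F y \<in> V" using F(2) that by auto
        then show ?thesis by (simp only: \<beta>[OF that] expand[of "F y", symmetric])
      qed
    qed
  then show "\<beta> \<eta> differentiable (at x)" unfolding differentiable_def by blast
  have D\<beta>: "fderiv (\<beta> \<eta>) x \<xi>
      = \<alpha> (fderiv (\<lambda>x. ?D x \<eta>) x \<xi>) (F x) + fderiv (\<alpha> (?D x \<eta>)) (F x) (?D x \<xi>)" for \<eta> \<xi>
    using frechet_derivative_eqI[OF has_D\<beta>]
    by (simp add: D\<alpha>[of "?D x \<eta>"] sum.distrib add.commute expand[OF Fx, of "frechet_derivative _ _ _"])
  show "fderiv (\<beta> \<eta>) x \<xi> - fderiv (\<beta> \<xi>) x \<eta>
    = fderiv (\<alpha> (fderiv F x \<eta>)) (F x) (fderiv F x \<xi>)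
    - fderiv (\<alpha> (fderiv F x \<xi>)) (F x) (fderiv F x \<eta>)"
    unfolding D\<beta> using C2_symmetric[OF U F(1) x] by simp
qed

lemma directional_derivative:
  assumes "f differentiable (at x)"
  shows "((\<lambda>t. f (x + t *\<^sub>R v)) has_vector_derivative fderiv f x v) (at 0)"
proof -
  have "((\<lambda>t. x + t *\<^sub>R v) has_derivative (\<lambda>r. r *\<^sub>R v)) (at 0)"
    by (auto intro!: derivative_eq_intros)
  then have "(f \<circ> (\<lambda>t. x + t *\<^sub>R v) has_derivative fderiv f x \<circ> (\<lambda>r. r *\<^sub>R v)) (at 0)"
    by (rule diff_chain_at) (use differentiable_has_derivative[OF assms] in simp)
  then show ?thesis
    by (simp add: has_vector_derivative_def o_def linear_cmul[OF linear_frechet_derivative[OF assms]])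
qed

section \<open>Smooth dependence of solutions of linear equations\<close>

text \<open>A product rule in which one factor need only be continuous, because the other one vanishes
  at the point. It is used for solutions of linear equations with parameters, which are known to
  be continuous before they are known to be differentiable.\<close>

lemma has_derivative_times_vanishing:
  fixes g :: "'a::real_normed_vector \<Rightarrow> real" and f :: "'a \<Rightarrow> 'b::real_normed_vector"
  assumes g: "isCont g x" and f: "(f has_derivative f') (at x)" and 0: "f x = 0"
  shows "((\<lambda>y. g y *\<^sub>R f y) has_derivative (\<lambda>v. g x *\<^sub>R f' v)) (at x)"
proof -
  interpret f': bounded_linear f' by (rule has_derivative_bounded_linear[OF f])
  have "((\<lambda>y. (g y - g x) *\<^sub>R f y) has_derivative (\<lambda>v. 0)) (at x)"
    unfolding has_derivative_at2
  proof (intro conjI)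
    obtain K where K: "\<And>v. norm (f' v) \<le> norm v * K" "K > 0" using f'.pos_bounded by blast
    have lim1: "((\<lambda>y. norm ((1 / norm (y - x)) *\<^sub>R (f y - (f x + f' (y - x)))) + K) \<longlongrightarrow> norm (0::'b) + K) (at x)"
      using f unfolding has_derivative_at2 by (intro tendsto_intros) auto
    have lim2: "((\<lambda>y. \<bar>g y - g x\<bar>) \<longlongrightarrow> \<bar>g x - g x\<bar>) (at x)"
      using g unfolding isCont_def by (intro tendsto_intros)
    have "((\<lambda>y. \<bar>g y - g x\<bar> * (norm ((1 / norm (y - x)) *\<^sub>R (f y - (f x + f' (y - x)))) + K)) \<longlongrightarrow> 0) (at x)"
      using tendsto_mult[OF lim2 lim1] by simp
    then show "((\<lambda>y. (1 / norm (y - x)) *\<^sub>R ((g y - g x) *\<^sub>R f y - ((g x - g x) *\<^sub>R f x + 0))) \<longlongrightarrow> 0) (at x)"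
    proof (rule Lim_null_comparison[rotated])
      show "\<forall>\<^sub>F y in at x. norm ((1 / norm (y - x)) *\<^sub>R ((g y - g x) *\<^sub>R f y - ((g x - g x) *\<^sub>R f x + 0)))
          \<le> \<bar>g y - g x\<bar> * (norm ((1 / norm (y - x)) *\<^sub>R (f y - (f x + f' (y - x)))) + K)"
      proof (rule eventually_at_topological[THEN iffD2], intro exI[of _ UNIV] conjI ballI impI)
        fix y assume "y \<noteq> x"
        then have n: "norm (y - x) > 0" by simp
        have "norm (f y) \<le> norm (f y - (f x + f' (y - x))) + norm (f' (y - x))"
          using norm_triangle_ineq[of "f y - (f x + f' (y - x))" "f' (y - x)"] 0 by simp
        also have "\<dots> \<le> norm (f y - (f x + f' (y - x))) + norm (y - x) * K" using K by simp
        finally have "norm (f y) / norm (y - x) \<le> norm (f y - (f x + f' (y - x))) / norm (y - x) + K"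
          using n by (simp add: field_simps)
        then have "\<bar>g y - g x\<bar> * (norm (f y) / norm (y - x))
          \<le> \<bar>g y - g x\<bar> * (norm (f y - (f x + f' (y - x))) / norm (y - x) + K)"
          by (intro mult_left_mono) auto
        then show "norm ((1 / norm (y - x)) *\<^sub>R ((g y - g x) *\<^sub>R f y - ((g x - g x) *\<^sub>R f x + 0)))
          \<le> \<bar>g y - g x\<bar> * (norm ((1 / norm (y - x)) *\<^sub>R (f y - (f x + f' (y - x)))) + K)"
          by (simp add: abs_mult divide_inverse mult.commute mult.left_commute)
      qed auto
    qed
  qed (rule bounded_linear_zero)
  moreover have "((\<lambda>y. g x *\<^sub>R f y) has_derivative (\<lambda>v. g x *\<^sub>R f' v)) (at x)"
    by (rule has_derivative_scaleR_right[OF f])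
  ultimately have "((\<lambda>y. (g y - g x) *\<^sub>R f y + g x *\<^sub>R f y) has_derivative (\<lambda>v. 0 + g x *\<^sub>R f' v)) (at x)"
    by (rule has_derivative_add)
  then show ?thesis by (simp add: scaleR_left_diff_distrib)
qed

text \<open>A lower bound \<open>c * norm v \<le> norm (L x0 v)\<close> persists with \<open>c/2\<close> for \<open>x\<close> near \<open>x0\<close>, so the solutions
  stay bounded, and \<open>L x0 (y x - y x0) = - (L x - L x0) (y x)\<close> tends to 0.\<close>

lemma inverse_solution_continuous:
  fixes L :: "'a::real_normed_vector \<Rightarrow> 'e::euclidean_space \<Rightarrow> 'v::euclidean_space"
  assumes lin: "\<And>x. x \<in> W \<Longrightarrow> linear (L x)" and inj: "inj (L x0)" and W: "open W" "x0 \<in> W"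
    and cont: "\<And>v. isCont (\<lambda>x. L x v) x0" and sol: "\<And>x. x \<in> W \<Longrightarrow> L x (y x) = X"
  shows "isCont y x0"
proof -
  obtain c where c: "c > 0" "\<And>v. c * norm v \<le> norm (L x0 v)"
    using linear_inj_bounded_below_pos[OF lin[OF W(2)] inj] by blast
  define e where "e = (\<lambda>x. \<Sum>b\<in>Basis. norm (L x b - L x0 b))"
  have e: "norm (L x v - L x0 v) \<le> e x * norm v" if "x \<in> W" for x v
  proof -
    have "linear (\<lambda>v. L x v - L x0 v)" by (intro linear_compose_sub lin that W)
    then have "L x v - L x0 v = (\<Sum>b\<in>Basis. (v \<bullet> b) *\<^sub>R (L x b - L x0 b))"
      using linear_sum[of "\<lambda>v. L x v - L x0 v" "\<lambda>b. (v \<bullet> b) *\<^sub>R b" Basis]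
        linear_cmul[of "\<lambda>v. L x v - L x0 v"] by (simp add: euclidean_representation)
    also have "norm \<dots> \<le> (\<Sum>b\<in>Basis. norm v * norm (L x b - L x0 b))"
      by (rule sum_norm_le) (auto intro!: mult_right_mono Basis_le_norm)
    also have "\<dots> = e x * norm v" by (simp add: e_def sum_distrib_left mult.commute)
    finally show ?thesis .
  qed
  have "(e \<longlongrightarrow> (\<Sum>b\<in>Basis. norm (L x0 b - L x0 b))) (at x0)"
    unfolding e_def using cont by (intro tendsto_intros) (auto simp: isCont_def)
  then have e0: "(e \<longlongrightarrow> 0) (at x0)" by simp
  then have ev: "\<forall>\<^sub>F x in at x0. e x < c / 2" by (rule order_tendstoD) (use c in simp)
  have evW: "\<forall>\<^sub>F x in at x0. x \<in> W" using W by (simp add: eventually_at_topological) blast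
  have "((\<lambda>x. e x * (2 * norm X / c / c)) \<longlongrightarrow> 0) (at x0)" by (rule tendsto_mult_left_zero[OF e0])
  then have "((\<lambda>x. y x - y x0) \<longlongrightarrow> 0) (at x0)"
  proof (rule Lim_null_comparison[rotated])
    show "\<forall>\<^sub>F x in at x0. norm (y x - y x0) \<le> e x * (2 * norm X / c / c)"
      using ev evW
    proof eventually_elim
      case (elim x)
      have e_nn: "e x \<ge> 0" by (simp add: e_def sum_nonneg)
      have "c * norm (y x) \<le> norm (L x (y x) - (L x (y x) - L x0 (y x)))" using c(2)[of "y x"] by simp
      also have "\<dots> \<le> norm X + e x * norm (y x)"
        using norm_triangle_ineq4[of X "L x (y x) - L x0 (y x)"] e[OF elim(2), of "y x"] sol[OF elim(2)] by simp
      also have "\<dots> \<le> norm X + c / 2 * norm (y x)" using elim by (intro add_left_mono mult_right_mono) auto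
      finally have b: "norm (y x) \<le> 2 * norm X / c" using c by (simp add: field_simps)
      have "c * norm (y x - y x0) \<le> norm (L x0 (y x - y x0))" by (rule c)
      also have "L x0 (y x - y x0) = - (L x (y x) - L x0 (y x))"
        using sol[OF elim(2)] sol[OF W(2)] by (simp add: linear_diff[OF lin[OF W(2)]])
      also have "norm \<dots> \<le> e x * norm (y x)" unfolding norm_minus_cancel by (rule e[OF elim(2)])
      also have "\<dots> \<le> e x * (2 * norm X / c)" by (rule mult_left_mono[OF b e_nn])
      finally show ?case using c by (simp add: field_simps)
    qed
  qed
  then show ?thesis unfolding isCont_def by (simp add: LIM_zero_iff)
qed

text \<open>Applying a left inverse \<open>M\<close> of \<open>L x0\<close> to the equation gives \<open>y x = y x0 - M ((L x - L x0) (y x))\<close>.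
  Expanded in a basis, the right-hand side is a sum of products of a continuous coefficient of \<open>y\<close>
  and a differentiable factor vanishing at \<open>x0\<close>.\<close>

lemma inverse_solution_derivative:
  fixes L :: "'a::real_normed_vector \<Rightarrow> 'e::euclidean_space \<Rightarrow> 'v::euclidean_space"
  assumes lin: "\<And>x. x \<in> W \<Longrightarrow> linear (L x)" and inj: "inj (L x0)" and W: "open W" "x0 \<in> W"
    and diff: "\<And>v. (\<lambda>x. L x v) differentiable (at x0)" and sol: "\<And>x. x \<in> W \<Longrightarrow> L x (y x) = X"
    and M: "linear M" "\<And>v. M (L x0 v) = v"
  shows "(y has_derivative (\<lambda>z. - (\<Sum>b\<in>Basis. (y x0 \<bullet> b) *\<^sub>R M (fderiv (\<lambda>x. L x b) x0 z)))) (at x0)"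
proof -
  have yc: "isCont y x0"
    by (rule inverse_solution_continuous[where L=L and X=X, OF lin inj W _ sol])
       (auto intro: differentiable_imp_continuous_within diff)
  have M': "bounded_linear M" using M(1) by (simp add: linear_conv_bounded_linear)
  have "((\<lambda>x. y x0 - (\<Sum>b\<in>Basis. (y x \<bullet> b) *\<^sub>R M (L x b - L x0 b))) has_derivative
      (\<lambda>z. 0 - (\<Sum>b\<in>Basis. (y x0 \<bullet> b) *\<^sub>R M (fderiv (\<lambda>x. L x b) x0 z - 0)))) (at x0)"
    using yc linear_0[OF M(1)]
    by (intro has_derivative_diff has_derivative_const has_derivative_sum has_derivative_times_vanishing
        bounded_linear.has_derivative[OF M'] differentiable_has_derivative diff) auto
  then have "(y has_derivative
      (\<lambda>z. 0 - (\<Sum>b\<in>Basis. (y x0 \<bullet> b) *\<^sub>R M (fderiv (\<lambda>x. L x b) x0 z - 0)))) (at x0)"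
  proof (rule has_derivative_transform_within_open[OF _ W])
    fix x assume x: "x \<in> W"
    have l: "linear (\<lambda>v. L x v - L x0 v)" by (intro linear_compose_sub lin x W)
    have "L x (y x) - L x0 (y x) = (\<Sum>b\<in>Basis. (y x \<bullet> b) *\<^sub>R (L x b - L x0 b))"
      using linear_sum[OF l, of "\<lambda>b. (y x \<bullet> b) *\<^sub>R b" Basis] linear_cmul[OF l] by (simp add: euclidean_representation)
    then have "M (L x (y x) - L x0 (y x)) = (\<Sum>b\<in>Basis. (y x \<bullet> b) *\<^sub>R M (L x b - L x0 b))"
      by (simp add: linear_sum[OF M(1)] linear_cmul[OF M(1)])
    moreover have "M (L x (y x) - L x0 (y x)) = y x0 - y x"
      using M sol[OF x] sol[OF W(2)] by (metis linear_diff)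
    ultimately show "y x0 - (\<Sum>b\<in>Basis. (y x \<bullet> b) *\<^sub>R M (L x b - L x0 b)) = y x"
      by (metis add_diff_cancel_left' add_diff_eq diff_add_cancel)
  qed
  then show ?thesis by simp
qed

text \<open>The derivative of the solution is a polynomial in solutions of the same equation and in derivatives
  of \<open>L\<close>, so differentiability bootstraps to every order.\<close>

lemma Ck_on_inv_family:
  fixes L :: "'a::real_normed_vector \<Rightarrow> 'e::euclidean_space \<Rightarrow> 'e"
  assumes W: "open W" and lin: "\<And>x. x \<in> W \<Longrightarrow> linear (L x)" and inj: "\<And>x. x \<in> W \<Longrightarrow> inj (L x)"
    and smooth: "\<And>v. Cinf_on W (\<lambda>x. L x v)"
  shows "Ck_on k W (\<lambda>x. inv (L x) X)"
proof -
  have sol: "L x (inv (L x) X) = X" if "x \<in> W" for x X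
    using linear_injective_imp_surjective[OF lin[OF that] inj[OF that]] by (simp add: surj_f_inv_f)
  have li: "linear (inv (L x))" if "x \<in> W" for x
  proof -
    obtain M where "linear M" "M \<circ> L x = id"
      using linear_injective_left_inverse[OF lin[OF \<open>x \<in> W\<close>] inj[OF \<open>x \<in> W\<close>]] by blast
    moreover have "M = inv (L x)"
    proof
      show "M y = inv (L x) y" for y
        using \<open>M \<circ> L x = id\<close> sol[OF that, of y] by (metis comp_apply id_apply)
    qed
    ultimately show ?thesis by simp
  qed
  have iL: "inv (L x) (L x v) = v" if "x \<in> W" for x v using inj[OF that] by simp
  have deriv: "((\<lambda>x. inv (L x) X) has_derivative
      (\<lambda>z. - (\<Sum>b\<in>Basis. (inv (L x) X \<bullet> b) *\<^sub>R inv (L x) (fderiv (\<lambda>x. L x b) x z)))) (at x)"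
    if "x \<in> W" for x X
    by (rule inverse_solution_derivative[where L=L and X=X and W=W, OF lin inj[OF that] W that _ sol li[OF that] iL[OF that]])
       (use Cinf_on_differentiable[OF smooth that] in auto)
  show ?thesis
  proof (induction k arbitrary: X)
  case 0
  show ?case
    using has_derivative_continuous[OF deriv[of _ X]] by (simp add: continuous_at_imp_continuous_on)
next
  case (Suc k)
  show ?case
  proof (rule Ck_on_derivI[OF W deriv])
    fix v
    have "Ck_on k W (\<lambda>x. - (\<Sum>b\<in>Basis. (inv (L x) X \<bullet> b) *\<^sub>R
        (\<Sum>b'\<in>Basis. (fderiv (\<lambda>x. L x b) x v \<bullet> b') *\<^sub>R inv (L x) b')))"
      using Suc Cinf_on_frechet_derivative[OF smooth]
      by (intro Ck_on_bounded_linear[OF W bounded_linear_minus[OF bounded_linear_ident]]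
          Ck_on_sum[OF W] Ck_on_bilinear[OF W bounded_bilinear_scaleR]
          Ck_on_bounded_linear[OF W bounded_linear_inner_left]) auto
    then show "Ck_on k W (\<lambda>x. - (\<Sum>b\<in>Basis. (inv (L x) X \<bullet> b) *\<^sub>R
        inv (L x) (fderiv (\<lambda>x. L x b) x v)))"
    proof (rule Ck_on_cong[OF W])
      fix x assume "x \<in> W"
      have eq: "inv (L x) w = (\<Sum>b'\<in>Basis. (w \<bullet> b') *\<^sub>R inv (L x) b')" for w
        using linear_sum[OF li[OF \<open>x \<in> W\<close>], of "\<lambda>b. (w \<bullet> b) *\<^sub>R b" Basis]
          linear_cmul[OF li[OF \<open>x \<in> W\<close>]] by (simp add: euclidean_representation)
      show "- (\<Sum>b\<in>Basis. (inv (L x) X \<bullet> b) *\<^sub>R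
          (\<Sum>b'\<in>Basis. (fderiv (\<lambda>x. L x b) x v \<bullet> b') *\<^sub>R inv (L x) b'))
        = - (\<Sum>b\<in>Basis. (inv (L x) X \<bullet> b) *\<^sub>R inv (L x) (fderiv (\<lambda>x. L x b) x v))"
        by (simp only: flip: eq)
    qed
  qed
qed
qed

text \<open>Composing with a left inverse of \<open>L x0\<close>, which is injective on the common range \<open>S\<close>, reduces to
  the case of invertible endomorphisms.\<close>

lemma Cinf_on_inverse_solution:
  fixes L :: "'a::real_normed_vector \<Rightarrow> 'e::euclidean_space \<Rightarrow> 'v::euclidean_space"
  assumes W: "open W"
    and lin: "\<And>x. x \<in> W \<Longrightarrow> linear (L x)" and bij: "\<And>x. x \<in> W \<Longrightarrow> bij_betw (L x) UNIV S"
    and smooth: "\<And>v. Cinf_on W (\<lambda>x. L x v)" and X: "X \<in> S"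
  shows "Cinf_on W (\<lambda>x. inv (L x) X)"
proof (cases "W = {}")
  case True
  show ?thesis unfolding True by (intro allI Ck_on_local) auto
next
  case False
  then obtain x0 where x0: "x0 \<in> W" by blast
  have inj: "inj (L x)" if "x \<in> W" for x using bij[OF that] by (simp add: bij_betw_def)
  obtain M where M: "linear M" "M \<circ> L x0 = id"
    using linear_injective_left_inverse[OF lin[OF x0] inj[OF x0]] by blast
  have MS: "L x0 (M Z) = Z" if "Z \<in> S" for Z
  proof -
    obtain v where "Z = L x0 v" using bij[OF x0] \<open>Z \<in> S\<close> unfolding bij_betw_def by blast
    then show ?thesis using M(2) by (metis comp_apply id_apply)
  qed
  have LS: "L x v \<in> S" if "x \<in> W" for x v using bij[OF that] unfolding bij_betw_def by blast
  have injM: "inj (M \<circ> L x)" if "x \<in> W" for x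
  proof (rule injI)
    fix v w assume "(M \<circ> L x) v = (M \<circ> L x) w"
    then have "L x v = L x w" using MS LS[OF that] by (metis comp_apply)
    then show "v = w" using inj[OF that] by (simp add: inj_eq)
  qed
  have M': "bounded_linear M" using M(1) by (simp add: linear_conv_bounded_linear)
  have "Cinf_on W (\<lambda>x. (M \<circ> L x) v)" for v
    unfolding comp_apply by (intro allI Ck_on_bounded_linear[OF W M'] smooth[rule_format])
  then have "Ck_on k W (\<lambda>x. inv (M \<circ> L x) (M X))" for k
    by (intro Ck_on_inv_family[OF W _ injM] linear_compose[OF lin M(1)])
  moreover have "inv (M \<circ> L x) (M X) = inv (L x) X" if x: "x \<in> W" for x
  proof -
    have "L x (inv (L x) X) = X" using bij[OF x] X by (metis bij_betw_imp_surj_on f_inv_into_f)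
    then have "(M \<circ> L x) (inv (L x) X) = M X" by simp
    then show ?thesis using inv_f_f[OF injM[OF x], of "inv (L x) X"] by simp
  qed
  ultimately show ?thesis using Ck_on_cong[OF W, of _ "\<lambda>x. inv (M \<circ> L x) (M X)"] by simp
qed

section \<open>The groups, their Lie algebras and the matrix exponential\<close>

lemma bounded_bilinear_matrix_mult:
  "bounded_bilinear (\<lambda>(A::real^'n^'m) (B::real^'k^'n). A ** B)"
proof -
  have "bilinear (\<lambda>(A::real^'n^'m) (B::real^'k^'n). A ** B)"
    unfolding bilinear_def
    by (auto intro!: linearI simp: matrix_matrix_mult_def vec_eq_iff algebra_simps sum.distrib sum_distrib_left)
  then show ?thesis by (simp add: bilinear_conv_bounded_bilinear)
qed

lemmas matrix_mult_add_left = bounded_bilinear.add_left[OF bounded_bilinear_matrix_mult]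
  and matrix_mult_add_right = bounded_bilinear.add_right[OF bounded_bilinear_matrix_mult]
  and matrix_mult_scaleR_left = bounded_bilinear.scaleR_left[OF bounded_bilinear_matrix_mult]
  and matrix_mult_scaleR_right = bounded_bilinear.scaleR_right[OF bounded_bilinear_matrix_mult]
  and matrix_mult_minus_left = bounded_bilinear.minus_left[OF bounded_bilinear_matrix_mult]
  and matrix_mult_minus_right = bounded_bilinear.minus_right[OF bounded_bilinear_matrix_mult]
  and bounded_linear_matrix_mult_left = bounded_bilinear.bounded_linear_left[OF bounded_bilinear_matrix_mult]
  and bounded_linear_matrix_mult_right = bounded_bilinear.bounded_linear_right[OF bounded_bilinear_matrix_mult]

lemma mexp_series:
  fixes X :: "real^'n^'n"
  defines "P \<equiv> \<lambda>i. ((\<lambda>B. X ** B) ^^ i) (mat 1)"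
  shows "summable (\<lambda>i. (t ^ i / fact i) *\<^sub>R P i)"
proof -
  obtain K where K: "K > 0" "\<And>A B. norm ((A::real^'n^'n) ** (B::real^'n^'n)) \<le> norm A * norm B * K"
    using bounded_bilinear.pos_bounded[OF bounded_bilinear_matrix_mult] by blast
  have P: "norm (P i) \<le> (norm X * K) ^ i * norm (mat 1 :: real^'n^'n)" for i
  proof (induction i)
    case (Suc i)
    have "norm (P (Suc i)) \<le> norm X * norm (P i) * K" using K(2)[of X "P i"] by (simp add: P_def)
    also have "\<dots> \<le> norm X * ((norm X * K) ^ i * norm (mat 1 :: real^'n^'n)) * K"
      using Suc K(1) by (intro mult_right_mono mult_left_mono) auto
    finally show ?case by (simp add: mult_ac)
  qed (simp add: P_def)
  show ?thesis
  proof (rule summable_comparison_test')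
    show "summable (\<lambda>i. norm (mat 1 :: real^'n^'n) * (inverse (fact i) * (\<bar>t\<bar> * (norm X * K)) ^ i))"
      using summable_exp_generic[of "\<bar>t\<bar> * (norm X * K)"] by (intro summable_mult) simp
    show "norm ((t ^ i / fact i) *\<^sub>R P i) \<le> norm (mat 1 :: real^'n^'n) * (inverse (fact i) * (\<bar>t\<bar> * (norm X * K)) ^ i)" for i
      using mult_left_mono[OF P[of i], of "\<bar>t\<bar> ^ i / fact i"]
      by (simp add: abs_mult power_abs divide_inverse power_mult_distrib mult_ac)
  qed
qed

lemma mexp_scaled:
  fixes X :: "real^'n^'n"
  shows "mexp (t *\<^sub>R X) = (\<Sum>i. (t ^ i / fact i) *\<^sub>R ((\<lambda>B. X ** B) ^^ i) (mat 1))"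
proof -
  have "((\<lambda>B. (t *\<^sub>R X) ** B) ^^ i) (mat 1) = t ^ i *\<^sub>R ((\<lambda>B. X ** B) ^^ i) (mat 1)" for i
    by (induction i) (simp_all add: matrix_mult_scaleR_left
        matrix_mult_scaleR_right mult.commute)
  then show ?thesis by (simp add: mexp_def)
qed

lemma mexp_0: "mexp (0 *\<^sub>R X) = mat 1" for X :: "real^'n^'n"
proof -
  have "(\<Sum>i. (0 ^ i / fact i) *\<^sub>R ((\<lambda>B. X ** B) ^^ i) (mat 1)) = (\<Sum>i\<in>{0}. (0 ^ i / fact i) *\<^sub>R ((\<lambda>B. X ** B) ^^ i) (mat 1))"
    by (rule suminf_finite) auto
  then show ?thesis unfolding mexp_scaled by simp
qed

text \<open>Each matrix entry of \<open>mexp (t X)\<close> is an everywhere convergent power series in \<open>t\<close>, which may be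
  differentiated term by term.\<close>

lemma mexp_derivative:
  fixes X :: "real^'n^'n"
  shows "((\<lambda>t. mexp (t *\<^sub>R X)) has_vector_derivative (X ** mexp (t *\<^sub>R X))) (at t)"
proof -
  define P where "P = (\<lambda>i. ((\<lambda>B. X ** B) ^^ i) (mat 1))"
  have S: "summable (\<lambda>i. (t ^ i / fact i) *\<^sub>R P i)" for t unfolding P_def by (rule mexp_series)
  have M: "mexp (t *\<^sub>R X) = (\<Sum>i. (t ^ i / fact i) *\<^sub>R P i)" for t unfolding P_def by (rule mexp_scaled)
  have comp: "mexp (t *\<^sub>R X) $ a $ b = (\<Sum>i. (P i $ a $ b / fact i) * t ^ i)"
    and scomp: "summable (\<lambda>i. (P i $ a $ b / fact i) * t ^ i)" for t a b
  proof -
    have L: "bounded_linear (\<lambda>Z::real^'n^'n. Z $ a $ b)"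
      using bounded_linear_compose[OF bounded_linear_vec_nth bounded_linear_vec_nth] .
    show "mexp (t *\<^sub>R X) $ a $ b = (\<Sum>i. (P i $ a $ b / fact i) * t ^ i)"
      using bounded_linear.suminf[OF L S[of t]] by (simp add: M mult_ac)
    show "summable (\<lambda>i. (P i $ a $ b / fact i) * t ^ i)"
      using bounded_linear.summable[OF L S[of t]] by (simp add: mult_ac)
  qed
  have d: "((\<lambda>t. mexp (t *\<^sub>R X) $ a $ b) has_real_derivative (X ** mexp (t *\<^sub>R X)) $ a $ b) (at t)" for a b
  proof -
    have "((\<lambda>t. \<Sum>i. (P i $ a $ b / fact i) * t ^ i) has_real_derivative
        (\<Sum>i. diffs (\<lambda>i. P i $ a $ b / fact i) i * t ^ i)) (at t)"
      by (rule termdiffs_strong_converges_everywhere[OF scomp])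
    moreover have "diffs (\<lambda>i. P i $ a $ b / fact i) i = P (Suc i) $ a $ b / fact i" for i
      using of_nat_neq_0[where 'a=real, of i] by (simp add: diffs_def fact_Suc del: of_nat_Suc)
    moreover have "(X ** mexp (t *\<^sub>R X)) $ a $ b = (\<Sum>i. P (Suc i) $ a $ b / fact i * t ^ i)"
    proof -
      have L: "bounded_linear (\<lambda>Z::real^'n^'n. (X ** Z) $ a $ b)"
        using bounded_linear_compose[OF bounded_linear_compose[OF bounded_linear_vec_nth bounded_linear_vec_nth]
            bounded_linear_matrix_mult_right] .
      show ?thesis
        using bounded_linear.suminf[OF L S[of t]]
        by (simp add: M P_def mult_ac matrix_mult_scaleR_right)
    qed
    ultimately show ?thesis by (simp add: comp)
  qed
  show ?thesis
    unfolding has_vector_derivative_def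
  proof (subst has_derivative_componentwise_within, rule ballI)
    fix i :: "real^'n^'n" assume "i \<in> Basis"
    then obtain a b where i: "i = axis a (axis b 1)" by (auto simp: Basis_vec_def)
    show "((\<lambda>t. mexp (t *\<^sub>R X) \<bullet> i) has_derivative (\<lambda>r. r *\<^sub>R (X ** mexp (t *\<^sub>R X)) \<bullet> i)) (at t)"
      using d[of a b] unfolding has_field_derivative_def i
      by (simp add: inner_axis mult_commute_abs)
  qed
qed

lemma Cinf_on_mexp: "Cinf_on W (\<lambda>t. mexp (t *\<^sub>R X))" for X :: "real^'n^'n"
proof
  fix k
  have "Ck_on k UNIV (\<lambda>t. mexp (t *\<^sub>R X))"
  proof (induction k)
    case 0
    show ?case
      using has_vector_derivative_continuous[OF mexp_derivative[of X]] by (simp add: continuous_at_imp_continuous_on)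
  next
    case (Suc k)
    show ?case
    proof (rule Ck_on_derivI[OF open_UNIV mexp_derivative[unfolded has_vector_derivative_def]])
      show "Ck_on k UNIV (\<lambda>t. v *\<^sub>R (X ** mexp (t *\<^sub>R X)))" for v
        by (intro Ck_on_bounded_linear[OF open_UNIV bounded_linear_scaleR_right]
            Ck_on_bounded_linear[OF open_UNIV bounded_linear_matrix_mult_right] Suc)
    qed
  qed
  then show "Ck_on k W (\<lambda>t. mexp (t *\<^sub>R X))" by (rule Ck_on_subset) simp
qed

lemma derivative_zero_constant:
  fixes f :: "real \<Rightarrow> 'a::real_inner"
  assumes "\<And>t. (f has_vector_derivative 0) (at t)"
  shows "f t = f s"
  using has_vector_derivative_zero_constant[of UNIV f] assms by (metis UNIV_I convex_UNIV has_vector_derivative_at_within)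

lemma bounded_linear_transpose: "bounded_linear (transpose :: real^'n^'m \<Rightarrow> _)"
  unfolding linear_conv_bounded_linear[symmetric]
  by (rule linearI) (simp_all add: transpose_def vec_eq_iff)

lemmas linear_transpose = bounded_linear.linear[OF bounded_linear_transpose]

text \<open>For skew \<open>X\<close> the derivative of the left-hand side with respect to \<open>t\<close> vanishes identically.\<close>

lemma transpose_mexp_mult:
  fixes X :: "real^'n^'n"
  assumes "transpose X = - X"
  shows "transpose (mexp (t *\<^sub>R X)) ** mexp (t *\<^sub>R X) = mat 1"
proof -
  let ?M = "\<lambda>t. mexp (t *\<^sub>R X)"
  have d: "((\<lambda>t. transpose (?M t) ** ?M t) has_vector_derivative
      transpose (?M t) ** (X ** ?M t) + transpose (X ** ?M t) ** ?M t) (at t)" for t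
    by (intro bounded_bilinear.has_vector_derivative[OF bounded_bilinear_matrix_mult] mexp_derivative
        bounded_linear.has_vector_derivative[OF bounded_linear_transpose])
  have z: "transpose (?M t) ** (X ** ?M t) + transpose (X ** ?M t) ** ?M t = 0" for t
    by (simp add: matrix_transpose_mul assms matrix_mul_assoc matrix_mult_minus_right
        matrix_mult_minus_left)
  from derivative_zero_constant[of "\<lambda>t. transpose (?M t) ** ?M t", OF d[unfolded z], of t 0] show ?thesis
    using mexp_0[of X] by (simp add: transpose_mat)
qed

text \<open>\<open>emb 1\<close> is the inclusion of O(n-1) into Euc(n) and \<open>emb 0\<close> that of its Lie algebra, see \<open>Hgrp_emb\<close>
  and \<open>halg_emb\<close>.\<close>

definition emb :: "real \<Rightarrow> real^'k^'k \<Rightarrow> 'k::finite mat" where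
  "emb s g = block s 0 (block s 0 g)"

lemma Hgrp_emb: "Hgrp = emb 1 ` {g. orthogonal_matrix g}"
  by (auto simp: Hgrp_def emb_def)

lemma halg_emb: "halg = emb 0 ` {B. transpose B = - B}"
  by (auto simp: halg_def emb_def)

lemma emb_nth:
  "emb s g $ i $ j = (case (i, j) of (None, None) \<Rightarrow> s | (Some None, Some None) \<Rightarrow> s
     | (Some (Some a), Some (Some b)) \<Rightarrow> g $ a $ b | _ \<Rightarrow> 0)"
  by (auto simp: emb_def block_def split: option.splits)

lemma mvec_nth:
  "mvec v0 v w $ i $ j = (case (i, j) of
      (Some None, None) \<Rightarrow> v0
    | (Some None, Some (Some b)) \<Rightarrow> - w $ b
    | (Some (Some a), None) \<Rightarrow> v $ a
    | (Some (Some a), Some None) \<Rightarrow> w $ a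
    | _ \<Rightarrow> 0)"
  by (simp add: mvec_def)

lemma sum_option: "(\<Sum>x\<in>UNIV. f x) = f None + (\<Sum>x\<in>UNIV. f (Some x))"
  for f :: "'a::finite option \<Rightarrow> 'b::ab_group_add"
  by (simp add: UNIV_option_conv sum.reindex)

lemma emb_mult: "emb s g ** emb t h = emb (s * t) (g ** h)"
  by (auto simp: vec_eq_iff matrix_matrix_mult_def emb_nth sum_option split: option.splits)

lemma transpose_emb: "transpose (emb s g) = emb s (transpose g)"
  by (auto simp: vec_eq_iff transpose_def emb_nth split: option.splits)

lemma emb_mat_1: "emb 1 (mat 1) = mat 1"
  by (auto simp: vec_eq_iff mat_def emb_nth split: option.splits)

lemma emb_inj: "emb s g = emb t h \<longleftrightarrow> s = t \<and> g = h"
proof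
  assume "emb s g = emb t h"
  then have e: "emb s g $ i $ j = emb t h $ i $ j" for i j by simp
  show "s = t \<and> g = h"
    using e[of None None] e[of "Some (Some _)" "Some (Some _)"] by (auto simp: emb_nth vec_eq_iff)
qed auto

lemma emb_0_lin:
  "emb 0 A + emb 0 B = emb 0 (A + B)" "emb 0 A - emb 0 B = emb 0 (A - B)"
  "a *\<^sub>R emb 0 A = emb 0 (a *\<^sub>R A)" "- emb 0 A = emb 0 (- A)" "emb 0 0 = 0"
  by (auto simp: vec_eq_iff emb_nth split: option.splits)

lemma mvec_lin:
  "mvec a v w + mvec a' v' w' = mvec (a + a') (v + v') (w + w')"
  "mvec a v w - mvec a' v' w' = mvec (a - a') (v - v') (w - w')"
  "c *\<^sub>R mvec a v w = mvec (c * a) (c *\<^sub>R v) (c *\<^sub>R w)" "mvec 0 0 0 = 0"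
  by (auto simp: vec_eq_iff mvec_nth split: option.splits)

text \<open>The Lie algebra o(n-1) acts on \<open>mcompl\<close> trivially on the first coordinate and by the standard
  representation on both copies of R^(n-1).\<close>

lemma lie_emb_mvec: "lie (emb 0 B) (mvec v0 v w) = mvec 0 (B *v v) (B *v w)" if "transpose B = - B"
proof -
  have B: "B $ i $ j = - B $ j $ i" for i j
    using that unfolding skew_iff by (simp add: eq_neg_iff_add_eq_0)
  have S: "(\<Sum>a\<in>UNIV. w $ a * B $ a $ b) = - (\<Sum>a\<in>UNIV. B $ b $ a * w $ a)" for b
    unfolding sum_negf[symmetric] by (rule sum.cong) (simp_all add: B[of _ b] mult.commute)
  show ?thesis
    by (auto simp: vec_eq_iff lie_def matrix_matrix_mult_def matrix_vector_mult_def emb_nth mvec_nth sum_option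
        S sum_negf split: option.splits)
qed

lemma emb_mvec_emb: "emb 1 g ** mvec v0 v w ** emb 1 (transpose g) = mvec v0 (g *v v) (g *v w)"
  by (auto simp: vec_eq_iff matrix_matrix_mult_def matrix_vector_mult_def transpose_def emb_nth mvec_nth sum_option
      sum_negf mult.commute split: option.splits)

lemma matrix_inv_orthogonal: "orthogonal_matrix (A::real^'n^'n) \<Longrightarrow> matrix_inv A = transpose A"
proof -
  assume A: "orthogonal_matrix A"
  then have "A ** matrix_inv A = mat 1"
    unfolding matrix_inv_def orthogonal_matrix_def by (metis (mono_tags, lifting) someI_ex)
  then have "transpose A ** (A ** matrix_inv A) = transpose A" by simp
  then show ?thesis using A by (simp add: matrix_mul_assoc orthogonal_matrix_def)
qed

lemma matrix_inv_emb: "orthogonal_matrix g \<Longrightarrow> matrix_inv (emb 1 g) = emb 1 (transpose g)"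
  using matrix_inv_orthogonal[of "emb 1 g"]
  by (simp add: orthogonal_matrix_def transpose_emb emb_mult emb_mat_1)

lemma Ad_emb_mvec: "orthogonal_matrix g \<Longrightarrow> Ad (emb 1 g) (mvec v0 v w) = mvec v0 (g *v v) (g *v w)"
  by (simp add: Ad_def matrix_inv_emb emb_mvec_emb)

lemma Ad_emb_emb: "orthogonal_matrix g \<Longrightarrow> Ad (emb 1 g) (emb s B) = emb s (g ** B ** transpose g)"
  by (simp add: Ad_def matrix_inv_emb emb_mult)

lemma Hgrp_inv: "h \<in> Hgrp \<Longrightarrow> matrix_inv h \<in> Hgrp"
  by (auto simp: Hgrp_emb matrix_inv_emb orthogonal_matrix_transpose)

lemma Hgrp_mat_1: "mat 1 \<in> Hgrp"
  unfolding Hgrp_emb using emb_mat_1 orthogonal_matrix_id by (metis image_eqI mem_Collect_eq)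

lemma Hgrp_inverse:
  assumes "h \<in> Hgrp"
  shows "h ** matrix_inv h = mat 1" "matrix_inv h ** h = mat 1" "matrix_inv (matrix_inv h) = h"
  using assms
  by (auto simp: Hgrp_emb matrix_inv_emb orthogonal_matrix_transpose)
     (auto simp: emb_mult orthogonal_matrix_def emb_mat_1)

lemma matrix_inv_Hgrp: "h \<in> Hgrp \<Longrightarrow> matrix_inv h = transpose h"
  by (auto simp: Hgrp_emb matrix_inv_emb transpose_emb)

lemma Ad_matrix_inv: "h \<in> Hgrp \<Longrightarrow> Ad (matrix_inv h) X = transpose h ** X ** h"
  by (simp add: Ad_def Hgrp_inverse(3)) (simp add: matrix_inv_Hgrp)

lemma Ad_Ad_inv: "h \<in> Hgrp \<Longrightarrow> Ad h (Ad (matrix_inv h) X) = X" "h \<in> Hgrp \<Longrightarrow> Ad (matrix_inv h) (Ad h X) = X"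
proof -
  assume h: "h \<in> Hgrp"
  have "Ad h (Ad (matrix_inv h) X) = (h ** matrix_inv h) ** X ** (h ** matrix_inv h)"
    by (simp only: Ad_def Hgrp_inverse(3)[OF h] matrix_mul_assoc)
  then show "Ad h (Ad (matrix_inv h) X) = X"
    by (simp only: Hgrp_inverse[OF h] matrix_mul_lid matrix_mul_rid)
  have "Ad (matrix_inv h) (Ad h X) = (matrix_inv h ** h) ** X ** (matrix_inv h ** h)"
    by (simp only: Ad_def Hgrp_inverse(3)[OF h] matrix_mul_assoc)
  then show "Ad (matrix_inv h) (Ad h X) = X"
    by (simp only: Hgrp_inverse[OF h] matrix_mul_lid matrix_mul_rid)
qed

lemma bounded_linear_Ad: "bounded_linear (Ad h)"
  unfolding Ad_def
  using bounded_linear_compose[OF bounded_linear_matrix_mult_left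
     bounded_linear_matrix_mult_right] .

lemmas linear_Ad = bounded_linear.linear[OF bounded_linear_Ad]

lemma bounded_bilinear_lie: "bounded_bilinear (lie :: real^'n^'n \<Rightarrow> _)"
proof -
  have "bilinear (lie :: real^'n^'n \<Rightarrow> _)"
    unfolding bilinear_def lie_def
    by (auto intro!: linearI simp: matrix_mult_add_left
      matrix_mult_add_right
      matrix_mult_scaleR_left
      matrix_mult_scaleR_right algebra_simps)
  then show ?thesis by (simp add: bilinear_conv_bounded_bilinear)
qed

lemma Ad_lie: "h \<in> Hgrp \<Longrightarrow> Ad h (lie X Y) = lie (Ad h X) (Ad h Y)"
proof -
  assume h: "h \<in> Hgrp"
  have "Ad h (X ** Y) = Ad h X ** Ad h Y" for X Y
  proof -
    have "Ad h X ** Ad h Y = h ** X ** (matrix_inv h ** h) ** Y ** matrix_inv h"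
      by (simp add: Ad_def matrix_mul_assoc)
    then show ?thesis by (simp add: Hgrp_inverse[OF h] Ad_def matrix_mul_assoc)
  qed
  then show ?thesis unfolding lie_def by (simp add: linear_diff[OF linear_Ad])
qed

lemma bounded_linear_pr_m: "bounded_linear (pr_m :: 'k::finite mat \<Rightarrow> _)"
  unfolding linear_conv_bounded_linear[symmetric]
  by (rule linearI)
     (auto simp: pr_m_def vec_eq_iff mvec_nth m0_def m1_def m2_def split: option.splits)

lemmas linear_pr_m = bounded_linear.linear[OF bounded_linear_pr_m]

lemma euc_split:
  assumes "X \<in> euc"
  obtains B v0 v w where "transpose B = - B" "X = emb 0 B + mvec v0 v w"
proof -
  have "pr_h X \<in> halg" by (rule pr_h_euc[OF assms])
  then obtain B where "transpose B = - B" "pr_h X = emb 0 B" by (auto simp: halg_emb)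
  moreover have "X = pr_h X + mvec (m0 X) (m1 X) (m2 X)" by (simp add: pr_h_def pr_m_def)
  ultimately show ?thesis using that by metis
qed

lemma subspace_euc: "subspace (euc :: 'k::finite mat set)"
proof -
  have 1: "block 0 v A + block 0 w B = block 0 (v + w) (A + B)" "c *\<^sub>R block 0 v A = block 0 (c *\<^sub>R v) (c *\<^sub>R A)"
    for v w :: "real^'b::finite" and A B and c :: real
    by (auto simp: block_def vec_eq_iff split: option.splits)
  have 0: "block 0 0 0 = (0::real^('b::finite) option^'b option)"
    by (auto simp: block_def vec_eq_iff split: option.splits)
  show ?thesis
    unfolding subspace_def euc_def
  proof (intro conjI ballI allI)
    show "0 \<in> {block 0 v B |v B. transpose B = - B}"
      by (intro CollectI exI[of _ 0]) (auto simp: 0 transpose_def vec_eq_iff)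
    fix x y :: "'k mat" and c :: real
    assume x: "x \<in> {block 0 v B |v B. transpose B = - B}"
    then obtain v A where vA: "x = block 0 v A" "transpose A = - A" by auto
    have "transpose (c *\<^sub>R A) = - (c *\<^sub>R A)"
      using vA(2) by (simp add: linear_cmul[OF linear_transpose])
    then show "c *\<^sub>R x \<in> {block 0 v B |v B. transpose B = - B}"
      unfolding vA(1) 1 by blast
    assume "y \<in> {block 0 v B |v B. transpose B = - B}"
    then obtain w B where y: "y = block 0 w B" "transpose B = - B" by auto
    have "transpose (A + B) = - (A + B)"
      using vA(2) y(2) by (simp add: linear_add[OF linear_transpose])
    then show "x + y \<in> {block 0 v B |v B. transpose B = - B}"
      unfolding vA(1) y(1) 1 by blast
  qed
qed

lemma pr_m_emb_mvec: "pr_m (emb 0 B) = 0" "pr_m (mvec v0 v w) = mvec v0 v w"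
  "pr_m (emb 0 B + mvec v0 v w) = mvec v0 v w" "pr_h (emb 0 B + mvec v0 v w) = emb 0 B"
proof -
  show 1: "pr_m (emb 0 B) = 0"
    by (auto simp: pr_m_def m0_def m1_def m2_def vec_eq_iff emb_nth mvec_nth split: option.splits)
  show 2: "pr_m (mvec v0 v w) = mvec v0 v w" by (simp add: pr_m_def)
  show 3: "pr_m (emb 0 B + mvec v0 v w) = mvec v0 v w"
    using 1 2 by (simp add: linear_add[OF linear_pr_m])
  show "pr_h (emb 0 B + mvec v0 v w) = emb 0 B" by (simp add: pr_h_def 3)
qed

lemma skew_conj: "transpose B = - B \<Longrightarrow> transpose (g ** B ** transpose g) = - (g ** B ** transpose (g::real^'n^'n))"
  by (simp add: matrix_transpose_mul matrix_mul_assoc matrix_mult_minus_right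
        matrix_mult_minus_left)

lemma pr_m_Ad:
  assumes "h \<in> Hgrp" "X \<in> euc"
  shows "pr_m (Ad h X) = Ad h (pr_m X)" "Ad h X \<in> euc"
proof -
  obtain g where g: "h = emb 1 g" "orthogonal_matrix g" using assms by (auto simp: Hgrp_emb)
  obtain B v0 v w where X: "transpose B = - B" "X = emb 0 B + mvec v0 v w" using assms(2) by (rule euc_split)
  have A: "Ad h X = emb 0 (g ** B ** transpose g) + mvec v0 (g *v v) (g *v w)"
    unfolding X g by (simp add: linear_add[OF linear_Ad] Ad_emb_mvec Ad_emb_emb g)
  show "pr_m (Ad h X) = Ad h (pr_m X)"
    unfolding A unfolding X(2) pr_m_emb_mvec by (simp add: g Ad_emb_mvec)
  have "emb 0 (g ** B ** transpose g) \<in> euc"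
    using halg_subset_euc skew_conj[OF X(1)] by (auto simp: halg_emb)
  moreover have "mvec v0 (g *v v) (g *v w) \<in> euc" using mcompl_subset_euc by (auto simp: mcompl_def)
  ultimately show "Ad h X \<in> euc" unfolding A by (rule subspace_add[OF subspace_euc])
qed

lemma Ad_mcompl: "h \<in> Hgrp \<Longrightarrow> X \<in> mcompl \<Longrightarrow> Ad h X \<in> mcompl"
  by (fastforce simp: Hgrp_emb mcompl_def Ad_emb_mvec)

text \<open>All powers of \<open>emb 0 B\<close> are block diagonal, so the exponential is computed in the lower right
  block, where it is orthogonal.\<close>

lemma mexp_in_Hgrp:
  assumes "Z \<in> halg"
  shows "mexp (t *\<^sub>R Z) \<in> Hgrp"
proof -
  obtain B where B: "Z = emb 0 B" "transpose B = - B" using assms by (auto simp: halg_emb)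
  let ?M = "\<lambda>t. mexp (t *\<^sub>R Z)"
  \<comment> \<open>The zeroth power is the identity and lies in the image of \<open>emb 1\<close>, the higher powers lie in the
  image of \<open>emb 0\<close>; the factor \<open>0 ^ i\<close> covers both cases.\<close>
  have "((\<lambda>i. (\<lambda>B. Z ** B) ^^ i) (Suc i)) (mat 1) = emb 0 (((\<lambda>C. B ** C) ^^ Suc i) (mat 1))" for i
    by (induction i) (simp_all add: B emb_mult flip: emb_mat_1)
  then have "((\<lambda>B. Z ** B) ^^ i) (mat 1) = emb (0 ^ i) (((\<lambda>C. B ** C) ^^ i) (mat 1))" for i
    by (cases i) (auto simp: emb_mat_1)
  then have "?M t = (\<Sum>i. (t ^ i / fact i) *\<^sub>R emb (0 ^ i) (((\<lambda>C. B ** C) ^^ i) (mat 1)))"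
    by (simp add: mexp_scaled)
  also have "\<dots> = (\<Sum>i. emb (0 ^ i) ((t ^ i / fact i) *\<^sub>R ((\<lambda>C. B ** C) ^^ i) (mat 1)))"
  proof (rule suminf_cong)
    show "(t ^ i / fact i) *\<^sub>R emb (0 ^ i) (((\<lambda>C. B ** C) ^^ i) (mat 1))
      = emb (0 ^ i) ((t ^ i / fact i) *\<^sub>R ((\<lambda>C. B ** C) ^^ i) (mat 1))" for i
      by (cases i) (simp_all add: emb_0_lin)
  qed
  also have "\<dots> = emb 1 (mexp (t *\<^sub>R B))"
  proof (rule sums_unique[symmetric])
    have "bounded_linear (\<lambda>(s, g). emb s g :: 'a mat)"
      unfolding linear_conv_bounded_linear[symmetric]
      by (rule linearI) (auto simp: vec_eq_iff emb_nth split: option.splits)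
    moreover have "(\<lambda>i. (0 ^ i :: real, (t ^ i / fact i) *\<^sub>R ((\<lambda>C. B ** C) ^^ i) (mat 1))) sums (1, mexp (t *\<^sub>R B))"
      using summable_sums[OF mexp_series[of t B]] powser_sums_zero[of "\<lambda>_. 1::real"]
      unfolding sums_def sum_prod by (intro tendsto_Pair) (auto simp: mexp_scaled)
    ultimately show "(\<lambda>i. emb (0 ^ i) ((t ^ i / fact i) *\<^sub>R ((\<lambda>C. B ** C) ^^ i) (mat 1))) sums emb 1 (mexp (t *\<^sub>R B))"
      using bounded_linear.sums by fastforce
  qed
  finally have "?M t = emb 1 (mexp (t *\<^sub>R B))" .
  moreover have "orthogonal_matrix (mexp (t *\<^sub>R B))"
    using transpose_mexp_mult[OF B(2)] by (simp add: orthogonal_matrix)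
  ultimately show ?thesis by (auto simp: Hgrp_emb)
qed

lemma skew_lin:
  "transpose A = - A \<Longrightarrow> transpose B = - B \<Longrightarrow> transpose (A + B) = - (A + B)"
  "transpose A = - A \<Longrightarrow> transpose (c *\<^sub>R A) = - (c *\<^sub>R A)"
  "transpose 0 = - (0::real^'n^'n)"
  for A B :: "real^'n^'n"
  by (simp_all add: linear_add[OF linear_transpose]
        linear_cmul[OF linear_transpose]
        linear_0[OF linear_transpose])

lemma lie_euc:
  assumes "X \<in> euc" "Y \<in> euc"
  shows "lie X Y \<in> euc"
proof -
  have m: "block 0 v A ** block 0 w B = block 0 (A *v w) (A ** B)"
    for v w :: "real^'m::finite" and A B :: "real^'m^'m"
    by (auto simp: vec_eq_iff matrix_matrix_mult_def matrix_vector_mult_def block_def sum_option split: option.splits)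
  have d: "block 0 v A - block 0 w B = block 0 (v - w) (A - B)" for v w :: "real^'m::finite" and A B :: "real^'m^'m"
    by (auto simp: vec_eq_iff block_def split: option.splits)
  obtain v A w B where X: "X = block 0 v A" "transpose A = - A" and Y: "Y = block 0 w B" "transpose B = - B"
    using assms by (auto simp: euc_def)
  have "transpose (A ** B - B ** A) = - (A ** B - B ** A)"
    by (simp add: linear_diff[OF linear_transpose] matrix_transpose_mul X Y
        matrix_mult_minus_left matrix_mult_minus_right)
  then show ?thesis unfolding lie_def X(1) Y(1) m d euc_def by blast
qed

section \<open>Tangent vectors and forms in charts\<close>

text \<open>The vector comes before the point: with a fixed vector this is a coefficient function of the form,
  as differentiated in \<open>ext_deriv\<close>.\<close>

definition local_form ::
  "('p, 'e::real_normed_vector) chart set \<Rightarrow> ('p, 'e) chart \<Rightarrow> ('p \<Rightarrow> ('p, 'e) tvec \<Rightarrow> 'v) \<Rightarrow> 'e \<Rightarrow> 'e \<Rightarrow> 'v" where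
  "local_form A c \<omega> v x = \<omega> (chart_inv c x) (coord_vec A c (chart_inv c x) v)"

abbreviation chart_dom :: "('p, 'e) chart \<Rightarrow> 'e set" where
  "chart_dom c \<equiv> snd c ` fst c"

locale smooth_manifold =
  fixes A :: "('p::topological_space, 'e::euclidean_space) chart set"
  assumes atlas: "smooth_atlas A"
begin

abbreviation change :: "('p, 'e) chart \<Rightarrow> ('p, 'e) chart \<Rightarrow> 'p \<Rightarrow> 'e \<Rightarrow> 'e" where
  "change c d u \<equiv> fderiv (snd d \<circ> chart_inv c) (snd c u)"

lemma chart_facts:
  assumes "c \<in> A"
  shows open_chart: "open (fst c)" and open_chart_dom: "open (chart_dom c)"
    and continuous_chart: "continuous_on (fst c) (snd c)"
    and continuous_chart_inv: "continuous_on (chart_dom c) (chart_inv c)"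
    and chart_inv_chart: "u \<in> fst c \<Longrightarrow> chart_inv c (snd c u) = u"
    and chart_chart_inv: "x \<in> chart_dom c \<Longrightarrow> snd c (chart_inv c x) = x"
    and chart_inv_in: "x \<in> chart_dom c \<Longrightarrow> chart_inv c x \<in> fst c"
  using assms atlas by (auto simp: smooth_atlas_def is_chart_def homeomorphism_def)

lemma chart_at: "chart_at A u \<in> A" "u \<in> fst (chart_at A u)"
proof -
  have "\<exists>c. c \<in> A \<and> u \<in> fst c" using atlas unfolding smooth_atlas_def by blast
  from someI_ex[OF this] show "chart_at A u \<in> A" "u \<in> fst (chart_at A u)"
    by (simp_all add: chart_at_def)
qed

lemma open_chart_preimage:
  assumes "c \<in> A" "open S"
  shows "open {x \<in> chart_dom c. chart_inv c x \<in> S}"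
proof -
  have "open (chart_inv c -` S \<inter> chart_dom c)"
    using continuous_on_open_vimage[OF open_chart_dom[OF assms(1)], THEN iffD1, OF continuous_chart_inv[OF assms(1)]] assms(2)
    by blast
  then show ?thesis by (simp add: vimage_def Int_def conj_commute)
qed

lemma overlap_eq: "c \<in> A \<Longrightarrow> snd c ` (fst c \<inter> S) = {x \<in> chart_dom c. chart_inv c x \<in> S}"
  by (auto simp: chart_facts)

lemma open_overlap: "c \<in> A \<Longrightarrow> d \<in> A \<Longrightarrow> open (snd c ` (fst c \<inter> fst d))"
  unfolding overlap_eq by (intro open_chart_preimage open_chart)

lemma Cinf_on_change:
  assumes "c \<in> A" "d \<in> A"
  shows "Cinf_on (snd c ` (fst c \<inter> fst d)) (snd d \<circ> chart_inv c)"
  using assms atlas smooth_on_open_iff[OF open_overlap[OF assms]] unfolding smooth_atlas_def by blast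

lemma change_has_derivative:
  assumes "c \<in> A" "d \<in> A" "u \<in> fst c" "u \<in> fst d"
  shows "((snd d \<circ> chart_inv c) has_derivative change c d u) (at (snd c u))"
  using assms by (intro differentiable_has_derivative Cinf_on_differentiable[OF Cinf_on_change]) auto

lemma linear_change:
  assumes "c \<in> A" "d \<in> A" "u \<in> fst c" "u \<in> fst d"
  shows "linear (change c d u)"
  using change_has_derivative[OF assms] has_derivative_linear by blast

lemma change_self:
  assumes "c \<in> A" "u \<in> fst c"
  shows "change c c u v = v"
proof -
  have "((snd c \<circ> chart_inv c) has_derivative (\<lambda>v. v)) (at (snd c u))"
    using assms by (intro has_derivative_transform_within_open[OF has_derivative_ident open_chart_dom[OF assms(1)]])
      (auto simp: chart_facts)
  then show ?thesis by (simp add: frechet_derivative_eqI)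
qed

lemma change_change:
  assumes "c \<in> A" "d \<in> A" "e \<in> A" "u \<in> fst c" "u \<in> fst d" "u \<in> fst e"
  shows "change d e u (change c d u v) = change c e u v"
proof -
  have "((snd e \<circ> chart_inv d) \<circ> (snd d \<circ> chart_inv c) has_derivative change d e u \<circ> change c d u) (at (snd c u))"
    using assms change_has_derivative[of d e u] change_has_derivative[of c d u]
    by (intro diff_chain_at) (simp_all add: chart_facts)
  then have "((snd e \<circ> chart_inv c) has_derivative change d e u \<circ> change c d u) (at (snd c u))"
    using assms
    by (elim has_derivative_transform_within_open[OF _ open_overlap[of c d]]) (auto simp: chart_facts)
  from frechet_derivative_eqI[OF this] show ?thesis by simp
qed

lemma coord_vec_self: "c \<in> A \<Longrightarrow> u \<in> fst c \<Longrightarrow> coord_vec A c u v c = v"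
  by (simp add: coord_vec_def change_self)

lemma coord_vec_in_tangent_space: "c \<in> A \<Longrightarrow> u \<in> fst c \<Longrightarrow> coord_vec A c u v \<in> tangent_space A u"
  by (simp add: tangent_space_def coord_vec_def change_change del: comp_apply)

lemma tangent_change:
  "\<xi> \<in> tangent_space A u \<Longrightarrow> c \<in> A \<Longrightarrow> d \<in> A \<Longrightarrow> u \<in> fst c \<Longrightarrow> u \<in> fst d \<Longrightarrow> \<xi> d = change c d u (\<xi> c)"
  unfolding tangent_space_def by blast

lemma coord_vec_coord: "\<xi> \<in> tangent_space A u \<Longrightarrow> c \<in> A \<Longrightarrow> u \<in> fst c \<Longrightarrow> coord_vec A c u (\<xi> c) = \<xi>"
proof
  fix d assume a: "\<xi> \<in> tangent_space A u" "c \<in> A" "u \<in> fst c"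
  show "coord_vec A c u (\<xi> c) d = \<xi> d"
  proof (cases "d \<in> A \<and> u \<in> fst d")
    case True
    then show ?thesis by (simp add: coord_vec_def tangent_change[OF a(1,2) _ a(3), of d])
  next
    case False
    then have "\<xi> d = 0" using a(1) unfolding tangent_space_def by blast
    with False show ?thesis by (auto simp: coord_vec_def)
  qed
qed

lemma coord_vec_change:
  "c \<in> A \<Longrightarrow> d \<in> A \<Longrightarrow> u \<in> fst c \<Longrightarrow> u \<in> fst d \<Longrightarrow> coord_vec A d u (change c d u v) = coord_vec A c u v"
  by (rule ext) (simp add: coord_vec_def change_change)

lemma coord_vec_add:
  "c \<in> A \<Longrightarrow> u \<in> fst c \<Longrightarrow> coord_vec A c u (v + w) = (\<lambda>d. coord_vec A c u v d + coord_vec A c u w d)"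
  by (rule ext) (simp add: coord_vec_def linear_add[OF linear_change])

lemma coord_vec_scale:
  "c \<in> A \<Longrightarrow> u \<in> fst c \<Longrightarrow> coord_vec A c u (a *\<^sub>R v) = (\<lambda>d. a *\<^sub>R coord_vec A c u v d)"
  by (rule ext) (simp add: coord_vec_def linear_cmul[OF linear_change])

lemma tangent_space_closed:
  assumes "\<xi> \<in> tangent_space A u"
  shows tangent_add: "\<eta> \<in> tangent_space A u \<Longrightarrow> (\<lambda>c. \<xi> c + \<eta> c) \<in> tangent_space A u"
    and tangent_scale: "(\<lambda>c. a *\<^sub>R \<xi> c) \<in> tangent_space A u"
proof -
  let ?c = "chart_at A u"
  show "(\<lambda>c. \<xi> c + \<eta> c) \<in> tangent_space A u" if "\<eta> \<in> tangent_space A u"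
    using coord_vec_add[OF chart_at, of u "\<xi> ?c" "\<eta> ?c"] coord_vec_coord[OF assms chart_at] coord_vec_coord[OF that chart_at]
      coord_vec_in_tangent_space[OF chart_at] by metis
  show "(\<lambda>c. a *\<^sub>R \<xi> c) \<in> tangent_space A u"
    using coord_vec_scale[OF chart_at, of u a "\<xi> ?c"] coord_vec_coord[OF assms chart_at]
      coord_vec_in_tangent_space[OF chart_at] by metis
qed

lemma bij_coord_vec:
  assumes "c \<in> A" "u \<in> fst c"
  shows "bij_betw (coord_vec A c u) UNIV (tangent_space A u)"
proof (rule bij_betwI[where g="\<lambda>\<xi>. \<xi> c"])
  show "coord_vec A c u \<in> UNIV \<rightarrow> tangent_space A u" using coord_vec_in_tangent_space assms by blast
qed (simp_all add: assms coord_vec_self coord_vec_coord)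

lemma one_form_facts:
  assumes "one_form A V \<omega>"
  shows one_form_in: "\<xi> \<in> tangent_space A u \<Longrightarrow> \<omega> u \<xi> \<in> V"
    and one_form_off: "\<xi> \<notin> tangent_space A u \<Longrightarrow> \<omega> u \<xi> = 0"
    and one_form_add: "\<xi> \<in> tangent_space A u \<Longrightarrow> \<eta> \<in> tangent_space A u \<Longrightarrow> \<omega> u (\<lambda>c. \<xi> c + \<eta> c) = \<omega> u \<xi> + \<omega> u \<eta>"
    and one_form_scale: "\<xi> \<in> tangent_space A u \<Longrightarrow> \<omega> u (\<lambda>c. a *\<^sub>R \<xi> c) = a *\<^sub>R \<omega> u \<xi>"
  using assms by (auto simp: one_form_def)

lemma linear_local_form:
  assumes "one_form A V \<omega>" "c \<in> A" "x \<in> chart_dom c"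
  shows "linear (\<lambda>v. local_form A c \<omega> v x)"
  unfolding local_form_def
  using chart_inv_in[OF assms(2,3)] assms(2)
  by (intro linearI)
     (simp_all add: coord_vec_add coord_vec_scale one_form_add[OF assms(1)] one_form_scale[OF assms(1)]
        coord_vec_in_tangent_space)

lemma Cinf_on_local_form:
  assumes "one_form A V \<omega>" "c \<in> A"
  shows "Cinf_on (chart_dom c) (local_form A c \<omega> v)"
  using assms smooth_on_open_iff[OF open_chart_dom[OF assms(2)]]
  unfolding one_form_def local_form_def by blast

lemma local_form_change:
  assumes "c \<in> A" "d \<in> A" "u \<in> fst c" "u \<in> fst d"
  shows "local_form A d \<omega> (change c d u v) (snd d u) = local_form A c \<omega> v (snd c u)"
  using assms by (simp add: local_form_def chart_facts coord_vec_change)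

lemma local_form_chart:
  assumes "\<xi> \<in> tangent_space A u" "c \<in> A" "u \<in> fst c"
  shows "local_form A c \<omega> (\<xi> c) (snd c u) = \<omega> u \<xi>"
  using assms by (simp add: local_form_def chart_facts coord_vec_coord)

definition local_d ::
  "('p, 'e) chart \<Rightarrow> ('p \<Rightarrow> ('p, 'e) tvec \<Rightarrow> 'v::real_normed_vector) \<Rightarrow> 'e \<Rightarrow> 'e \<Rightarrow> 'e \<Rightarrow> 'v" where
  "local_d c \<omega> x v w = fderiv (local_form A c \<omega> w) x v - fderiv (local_form A c \<omega> v) x w"

lemma ext_deriv_chart_at: "ext_deriv A \<omega> u \<xi> \<eta> = local_d (chart_at A u) \<omega> (snd (chart_at A u) u) (\<xi> (chart_at A u)) (\<eta> (chart_at A u))"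
  by (simp add: ext_deriv_def local_d_def local_form_def[abs_def] Let_def)

text \<open>The definition of \<open>ext_deriv\<close> uses a chosen chart at each point. Any other chart around the point
  gives the same value, since the coefficients in two charts are pullbacks of each other along the
  coordinate change.\<close>

lemma ext_deriv_chart:
  assumes \<omega>: "one_form A V \<omega>" and c: "c \<in> A" "u \<in> fst c"
    and \<xi>: "\<xi> \<in> tangent_space A u" and \<eta>: "\<eta> \<in> tangent_space A u"
  shows "ext_deriv A \<omega> u \<xi> \<eta> = local_d c \<omega> (snd c u) (\<xi> c) (\<eta> c)"
proof -
  define d where "d = chart_at A u"
  have d: "d \<in> A" "u \<in> fst d" unfolding d_def by (rule chart_at)+
  let ?F = "snd d \<circ> chart_inv c"
  have "local_d c \<omega> (snd c u) (\<xi> c) (\<eta> c) = local_d d \<omega> (?F (snd c u)) (change c d u (\<xi> c)) (change c d u (\<eta> c))"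
    unfolding local_d_def
  proof (rule exterior_derivative_pullback[where V="chart_dom d"])
    show "open (snd c ` (fst c \<inter> fst d))" by (rule open_overlap[OF c(1) d(1)])
    show "Ck_on 2 (snd c ` (fst c \<inter> fst d)) ?F" using Cinf_on_change[OF c(1) d(1)] by blast
    show "?F ` snd c ` (fst c \<inter> fst d) \<subseteq> chart_dom d" using c by (auto simp: chart_facts)
    show "linear (\<lambda>w. local_form A d \<omega> w y)" if "y \<in> chart_dom d" for y
      by (rule linear_local_form[OF \<omega> d(1) that])
    show "local_form A d \<omega> w differentiable at y" if "y \<in> chart_dom d" for w y
      by (rule Cinf_on_differentiable[OF Cinf_on_local_form[OF \<omega> d(1)] that])
    show "local_form A c \<omega> v x = local_form A d \<omega> (fderiv ?F x v) (?F x)"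
      if "x \<in> snd c ` (fst c \<inter> fst d)" for x v
    proof -
      obtain u' where u': "x = snd c u'" "u' \<in> fst c" "u' \<in> fst d" using \<open>x \<in> _\<close> by blast
      show ?thesis using local_form_change[of c d u' \<omega> v] u' c d by (simp add: chart_facts)
    qed
  qed (use c d open_chart_dom in auto)
  then show ?thesis
    using c d by (simp add: ext_deriv_chart_at flip: d_def tangent_change[OF \<xi>] tangent_change[OF \<eta>])
      (simp add: chart_facts)
qed

text \<open>The definition of \<open>tangent_map\<close> uses a chosen chart at the source; by the chain rule any charts at
  source and target may be used. The neighbourhood \<open>N\<close> ensures that the coordinate expressions are
  related not only at \<open>u\<close> but near \<open>u\<close>.\<close>

lemma tangent_map_chart:
  assumes c: "c \<in> A" "u \<in> fst c" and d: "d \<in> A" "f u \<in> fst d" and \<xi>: "\<xi> \<in> tangent_space A u"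
    and f: "((snd d \<circ> f \<circ> chart_inv c) has_derivative F) (at (snd c u))"
    and near: "open N" "u \<in> N" "N \<subseteq> fst c" "f ` N \<subseteq> fst d"
  shows "tangent_map A A f u \<xi> = coord_vec A d (f u) (F (\<xi> c))"
proof
  fix e
  define c0 where "c0 = chart_at A u"
  have c0: "c0 \<in> A" "u \<in> fst c0" unfolding c0_def by (rule chart_at)+
  show "tangent_map A A f u \<xi> e = coord_vec A d (f u) (F (\<xi> c)) e"
  proof (cases "e \<in> A \<and> f u \<in> fst e")
    case False
    then show ?thesis by (auto simp: tangent_map_def coord_vec_def)
  next
    case True
    have fu: "(snd d \<circ> f \<circ> chart_inv c) (snd c u) = snd d (f u)" "(snd c \<circ> chart_inv c0) (snd c0 u) = snd c u"
      using c c0 by (simp_all add: chart_facts)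
    have "((snd d \<circ> f \<circ> chart_inv c) \<circ> (snd c \<circ> chart_inv c0) has_derivative F \<circ> change c0 c u) (at (snd c0 u))"
      using f by (intro diff_chain_at change_has_derivative c c0) (simp only: fu)
    moreover have "((snd e \<circ> chart_inv d) has_derivative change d e (f u)) (at (((snd d \<circ> f \<circ> chart_inv c) \<circ> (snd c \<circ> chart_inv c0)) (snd c0 u)))"
      using change_has_derivative[of d e "f u"] d True fu by (simp add: o_def)
    ultimately have "((snd e \<circ> chart_inv d) \<circ> ((snd d \<circ> f \<circ> chart_inv c) \<circ> (snd c \<circ> chart_inv c0))
        has_derivative change d e (f u) \<circ> (F \<circ> change c0 c u)) (at (snd c0 u))"
      by (rule diff_chain_at)
    then have "((snd e \<circ> f \<circ> chart_inv c0) has_derivative change d e (f u) \<circ> (F \<circ> change c0 c u)) (at (snd c0 u))"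
    proof (rule has_derivative_transform_within_open)
      show "open {x \<in> chart_dom c0. chart_inv c0 x \<in> N}" by (rule open_chart_preimage[OF c0(1) near(1)])
      show "snd c0 u \<in> {x \<in> chart_dom c0. chart_inv c0 x \<in> N}" using c0 near by (simp add: chart_facts)
      show "((snd e \<circ> chart_inv d) \<circ> ((snd d \<circ> f \<circ> chart_inv c) \<circ> (snd c \<circ> chart_inv c0))) x = (snd e \<circ> f \<circ> chart_inv c0) x"
        if "x \<in> {x \<in> chart_dom c0. chart_inv c0 x \<in> N}" for x
      proof -
        have "chart_inv c0 x \<in> fst c" "f (chart_inv c0 x) \<in> fst d" using that near by auto
        then show ?thesis using c d by (simp add: chart_facts)
      qed
    qed
    from frechet_derivative_eqI[OF this] show ?thesis
      using True tangent_change[OF \<xi> c0(1) c(1) c0(2) c(2)] by (simp add: tangent_map_def coord_vec_def Let_def c0_def)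
  qed
qed

lemma ext_deriv_alternating: "ext_deriv A \<omega> u \<eta> \<xi> = - ext_deriv A \<omega> u \<xi> \<eta>"
  by (simp add: ext_deriv_chart_at local_d_def)

lemma local_d_linear:
  assumes \<omega>: "one_form A V \<omega>" and c: "c \<in> A" and x: "x \<in> chart_dom c"
  shows "linear (local_d c \<omega> x v)" and "local_d c \<omega> x w v = - local_d c \<omega> x v w"
proof -
  have d: "local_form A c \<omega> v differentiable (at x)" for v
    by (rule Cinf_on_differentiable[OF Cinf_on_local_form[OF \<omega> c] x])
  have lf: "fderiv (local_form A c \<omega> (a *\<^sub>R v + b *\<^sub>R w)) x z
      = a *\<^sub>R fderiv (local_form A c \<omega> v) x z + b *\<^sub>R fderiv (local_form A c \<omega> w) x z" for a b v w z
  proof -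
    have "(local_form A c \<omega> (a *\<^sub>R v + b *\<^sub>R w) has_derivative (\<lambda>z. a *\<^sub>R fderiv (local_form A c \<omega> v) x z
        + b *\<^sub>R fderiv (local_form A c \<omega> w) x z)) (at x)"
    proof (rule has_derivative_transform_within_open[OF _ open_chart_dom[OF c] x])
      show "((\<lambda>x. a *\<^sub>R local_form A c \<omega> v x + b *\<^sub>R local_form A c \<omega> w x) has_derivative
        (\<lambda>z. a *\<^sub>R fderiv (local_form A c \<omega> v) x z + b *\<^sub>R fderiv (local_form A c \<omega> w) x z)) (at x)"
        by (intro has_derivative_add has_derivative_scaleR_right differentiable_has_derivative d)
      show "a *\<^sub>R local_form A c \<omega> v y + b *\<^sub>R local_form A c \<omega> w y = local_form A c \<omega> (a *\<^sub>R v + b *\<^sub>R w) y"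
        if "y \<in> chart_dom c" for y
        by (simp add: linear_add[OF linear_local_form[OF \<omega> c that]] linear_cmul[OF linear_local_form[OF \<omega> c that]])
    qed
    from frechet_derivative_eqI[OF this] show ?thesis by simp
  qed
  have l: "linear (fderiv (local_form A c \<omega> v) x)" for v
    by (rule linear_frechet_derivative[OF d])
  show "linear (local_d c \<omega> x v)"
    using lf[of 1 _ 1] lf[of _ _ 0]
    by (intro linearI) (simp_all add: local_d_def linear_add[OF l] linear_cmul[OF l] algebra_simps)
  show "local_d c \<omega> x w v = - local_d c \<omega> x v w" by (simp add: local_d_def)
qed

lemma local_d_expand:
  assumes \<omega>: "one_form A V \<omega>" and c: "c \<in> A" and x: "x \<in> chart_dom c"
  shows "local_d c \<omega> x v w = (\<Sum>b\<in>Basis. \<Sum>b'\<in>Basis. ((v \<bullet> b) * (w \<bullet> b')) *\<^sub>R local_d c \<omega> x b b')"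
proof -
  note l = local_d_linear[OF \<omega> c x]
  have 1: "local_d c \<omega> x v w = (\<Sum>b'\<in>Basis. (w \<bullet> b') *\<^sub>R local_d c \<omega> x v b')" for v w
    by (subst euclidean_representation[of w, symmetric]) (simp only: linear_sum[OF l(1)] linear_cmul[OF l(1)])
  have 2: "local_d c \<omega> x v b' = (\<Sum>b\<in>Basis. (v \<bullet> b) *\<^sub>R local_d c \<omega> x b b')" for v b'
    unfolding l(2)[of _ b'] 1[of b' v] by (simp add: sum_negf)
  have "local_d c \<omega> x v w = (\<Sum>b'\<in>Basis. (w \<bullet> b') *\<^sub>R local_d c \<omega> x v b')" by (rule 1)
  also have "\<dots> = (\<Sum>b'\<in>Basis. \<Sum>b\<in>Basis. ((v \<bullet> b) * (w \<bullet> b')) *\<^sub>R local_d c \<omega> x b b')"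
    unfolding 2[of v] by (simp add: scaleR_sum_right mult.commute)
  also have "\<dots> = (\<Sum>b\<in>Basis. \<Sum>b'\<in>Basis. ((v \<bullet> b) * (w \<bullet> b')) *\<^sub>R local_d c \<omega> x b b')"
    by (rule sum.swap)
  finally show ?thesis .
qed

lemma ext_deriv_linear:
  assumes \<omega>: "one_form A V \<omega>"
  shows "ext_deriv A \<omega> u \<xi> (\<lambda>c. a *\<^sub>R \<eta> c + b *\<^sub>R \<zeta> c) = a *\<^sub>R ext_deriv A \<omega> u \<xi> \<eta> + b *\<^sub>R ext_deriv A \<omega> u \<xi> \<zeta>"
proof -
  note l = local_d_linear(1)[OF \<omega> chart_at(1)[of u] imageI[OF chart_at(2)[of u]]]
  show ?thesis by (simp add: ext_deriv_chart_at linear_add[OF l] linear_cmul[OF l])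
qed

lemma one_form_zero:
  assumes "one_form A V \<omega>"
  shows "(\<lambda>c. 0) \<in> tangent_space A u" "\<omega> u (\<lambda>c. 0) = 0"
proof -
  have t: "coord_vec A (chart_at A u) u 0 \<in> tangent_space A u" by (rule coord_vec_in_tangent_space[OF chart_at])
  from tangent_scale[OF t, of 0] show "(\<lambda>c. 0) \<in> tangent_space A u" by simp
  from one_form_scale[OF assms t, of 0] show "\<omega> u (\<lambda>c. 0) = 0" by simp
qed

lemma one_form_lin:
  assumes "one_form A V \<omega>" "\<xi> \<in> tangent_space A u" "\<eta> \<in> tangent_space A u"
  shows "\<omega> u (\<lambda>c. a *\<^sub>R \<xi> c + b *\<^sub>R \<eta> c) = a *\<^sub>R \<omega> u \<xi> + b *\<^sub>R \<omega> u \<eta>"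
    "(\<lambda>c. a *\<^sub>R \<xi> c + b *\<^sub>R \<eta> c) \<in> tangent_space A u"
  using assms tangent_scale[OF assms(2), of a] tangent_scale[OF assms(3), of b]
  by (simp_all add: one_form_add[OF assms(1)] one_form_scale[OF assms(1)] tangent_add)

lemma one_form_compose:
  assumes \<omega>: "one_form A V \<omega>" and L: "bounded_linear L" and V: "L ` V \<subseteq> V'"
  shows "one_form A V' (\<lambda>u \<xi>. L (\<omega> u \<xi>))"
    and "local_form A c (\<lambda>u \<xi>. L (\<omega> u \<xi>)) v = (\<lambda>x. L (local_form A c \<omega> v x))"
proof -
  show lf: "local_form A c (\<lambda>u \<xi>. L (\<omega> u \<xi>)) v = (\<lambda>x. L (local_form A c \<omega> v x))" for c v
    by (simp add: local_form_def fun_eq_iff)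
  have "smooth_on (chart_dom c) (local_form A c (\<lambda>u \<xi>. L (\<omega> u \<xi>)) v)" if "c \<in> A" for c v
    unfolding smooth_on_open_iff[OF open_chart_dom[OF that]] lf
    using Cinf_on_local_form[OF \<omega> that] Ck_on_bounded_linear[OF open_chart_dom[OF that] L] by blast
  then show "one_form A V' (\<lambda>u \<xi>. L (\<omega> u \<xi>))"
    unfolding one_form_def
    using V one_form_facts[OF \<omega>] linear_add[OF bounded_linear.linear[OF L]] linear_cmul[OF bounded_linear.linear[OF L]]
      linear_0[OF bounded_linear.linear[OF L]]
    by (auto simp: local_form_def[abs_def])
qed

lemma one_form_sum:
  assumes \<omega>: "one_form A V \<omega>" and \<theta>: "one_form A V' \<theta>" and S: "V \<subseteq> S" "V' \<subseteq> S" "subspace S"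
  shows "one_form A S (\<lambda>u \<xi>. \<omega> u \<xi> + \<theta> u \<xi>)"
proof -
  have "smooth_on (chart_dom c) (\<lambda>x. local_form A c \<omega> v x + local_form A c \<theta> v x)" if "c \<in> A" for c v
    unfolding smooth_on_open_iff[OF open_chart_dom[OF that]]
    using Cinf_on_local_form[OF \<omega> that] Cinf_on_local_form[OF \<theta> that] Ck_on_add[OF open_chart_dom[OF that]] by blast
  moreover have "\<omega> u \<xi> + \<theta> u \<xi> \<in> S" if "\<xi> \<in> tangent_space A u" for u \<xi>
    using one_form_in[OF \<omega> that] one_form_in[OF \<theta> that] S by (auto intro: subspace_add)
  ultimately show ?thesis
    unfolding one_form_def
    by (auto simp: local_form_def one_form_off[OF \<omega>] one_form_off[OF \<theta>] one_form_add[OF \<omega>] one_form_add[OF \<theta>]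
        one_form_scale[OF \<omega>] one_form_scale[OF \<theta>] scaleR_add_right)
qed

lemma ext_deriv_compose:
  assumes \<omega>: "one_form A V \<omega>" and L: "bounded_linear L"
  shows "ext_deriv A (\<lambda>u \<xi>. L (\<omega> u \<xi>)) u \<xi> \<eta> = L (ext_deriv A \<omega> u \<xi> \<eta>)"
proof -
  define c where "c = chart_at A u"
  have c: "c \<in> A" "u \<in> fst c" unfolding c_def by (rule chart_at)+
  have "local_form A c \<omega> v differentiable (at (snd c u))" for v
    using c by (intro Cinf_on_differentiable[OF Cinf_on_local_form[OF \<omega> c(1)]]) auto
  moreover have "local_form A c (\<lambda>u \<xi>. L (\<omega> u \<xi>)) v = (\<lambda>x. L (local_form A c \<omega> v x))" for v
    by (simp add: local_form_def fun_eq_iff)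
  ultimately show ?thesis
    by (simp add: ext_deriv_chart_at local_d_def frechet_derivative_bounded_linear[OF L]
        linear_diff[OF bounded_linear.linear[OF L]] flip: c_def)
qed

end

section \<open>The right action in charts\<close>

locale smooth_action = smooth_manifold A
  for A :: "('p::topological_space, 'e::euclidean_space) chart set" +
  fixes r :: "'p \<Rightarrow> 'k::finite mat \<Rightarrow> 'p"
  assumes smooth_r: "smooth_map_on (prod_atlas A euclidean_atlas) A (UNIV \<times> Hgrp) (\<lambda>(u, h). r u h)"
    and r_one: "r u (mat 1) = u"
begin

text \<open>The coordinate expression of the action, extended smoothly from the group to a neighbourhood in the
  space of all matrices; the extension \<open>G\<close> has its meaning only at elements of \<open>Hgrp\<close>.\<close>

lemma local_action:
  assumes c: "c \<in> A" "u \<in> fst c" and d: "d \<in> A" "r u h0 \<in> fst d" and h0: "h0 \<in> Hgrp"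
  obtains W G where "open W" "(snd c u, h0) \<in> W" "Cinf_on W G"
    "\<And>x h. (x, h) \<in> W \<Longrightarrow> x \<in> chart_dom c"
    "\<And>x h. (x, h) \<in> W \<Longrightarrow> h \<in> Hgrp \<Longrightarrow> r (chart_inv c x) h \<in> fst d \<and> G (x, h) = snd d (r (chart_inv c x) h)"
proof -
  let ?\<rho> = "\<lambda>(u, h). r u h"
  define pc :: "('p \<times> 'k mat, 'e \<times> 'k mat) chart" where "pc = (fst c \<times> UNIV, map_prod (snd c) id)"
  define S where "S = snd pc ` (fst pc \<inter> UNIV \<times> Hgrp \<inter> ?\<rho> -` fst d)"
  have "pc \<in> prod_atlas A euclidean_atlas"
    using c unfolding prod_atlas_def euclidean_atlas_def pc_def by force
  then have sm: "smooth_on S (snd d \<circ> ?\<rho> \<circ> chart_inv pc)"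
    using smooth_r d unfolding smooth_map_on_def S_def by blast
  have pci: "chart_inv pc (x, h) = (chart_inv c x, h)" if "x \<in> chart_dom c" for x h
    unfolding chart_inv_def
  proof (rule inv_into_f_eq)
    have "inj_on (snd c) (fst c)" by (metis chart_inv_chart[OF c(1)] inj_on_inverseI)
    then show "inj_on (snd pc) (fst pc)" by (auto simp: pc_def inj_on_def)
    show "(inv_into (fst c) (snd c) x, h) \<in> fst pc" "snd pc (inv_into (fst c) (snd c) x, h) = (x, h)"
      using chart_inv_in[OF c(1) that] chart_chart_inv[OF c(1) that] by (simp_all add: pc_def chart_inv_def)
  qed
  have "(u, h0) \<in> fst pc \<inter> UNIV \<times> Hgrp \<inter> ?\<rho> -` fst d" using c d h0 by (simp add: pc_def)
  then have "(snd c u, h0) \<in> S" unfolding S_def by (rule image_eqI[rotated]) (simp add: pc_def)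
  then obtain W0 G where W0: "open W0" "(snd c u, h0) \<in> W0" "Cinf_on W0 G"
    "\<forall>y \<in> S \<inter> W0. (snd d \<circ> ?\<rho> \<circ> chart_inv pc) y = G y"
    using sm[unfolded smooth_on_def, rule_format, OF \<open>(snd c u, h0) \<in> S\<close>] by blast
  have "continuous_on (UNIV \<times> Hgrp) ?\<rho>" using smooth_r by (simp add: smooth_map_on_def)
  then obtain O' where O': "open O'" "O' \<inter> (UNIV \<times> Hgrp) = ?\<rho> -` fst d \<inter> (UNIV \<times> Hgrp)"
    unfolding continuous_on_open_invariant using open_chart[OF d(1)] by blast
  define V where "V = (\<lambda>(x, h). (chart_inv c x, h)) -` O' \<inter> chart_dom c \<times> UNIV"
  have op: "open (chart_dom c \<times> (UNIV :: 'k mat set))" by (intro open_Times open_chart_dom[OF c(1)] open_UNIV)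
  have "continuous_on (chart_dom c \<times> UNIV) (\<lambda>y. (chart_inv c (fst y), snd y))"
    by (intro continuous_intros continuous_on_compose2[OF continuous_chart_inv[OF c(1)]]) auto
  then have "continuous_on (chart_dom c \<times> UNIV) (\<lambda>(x, h). (chart_inv c x, h))" by (simp add: case_prod_beta')
  then have "open V" unfolding V_def using continuous_on_open_vimage[OF op] O'(1) by blast
  have key: "r (chart_inv c x) h \<in> fst d \<and> G (x, h) = snd d (r (chart_inv c x) h)"
    if "(x, h) \<in> W0 \<inter> V" "h \<in> Hgrp" for x h
  proof -
    have x: "x \<in> chart_dom c" "(chart_inv c x, h) \<in> O'" using that by (auto simp: V_def)
    then have "(chart_inv c x, h) \<in> ?\<rho> -` fst d \<inter> (UNIV \<times> Hgrp)" using O'(2) that(2) by blast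
    then have rd: "r (chart_inv c x) h \<in> fst d" by simp
    have "(chart_inv c x, h) \<in> fst pc \<inter> UNIV \<times> Hgrp \<inter> ?\<rho> -` fst d"
      using rd that(2) chart_inv_in[OF c(1) x(1)] by (simp add: pc_def)
    then have "(x, h) \<in> S" unfolding S_def
      by (rule image_eqI[rotated]) (simp add: pc_def chart_chart_inv[OF c(1) x(1)])
    then have "G (x, h) = snd d (r (chart_inv c x) h)"
      using W0(4)[rule_format, of "(x, h)"] that(1) pci[OF x(1)] by simp
    with rd show ?thesis by simp
  qed
  show ?thesis
  proof (rule that[of "W0 \<inter> V" G])
    have "(u, h0) \<in> O' \<inter> (UNIV \<times> Hgrp)" unfolding O'(2) using d h0 by simp
    then show "(snd c u, h0) \<in> W0 \<inter> V" using W0(2) c by (auto simp: V_def chart_inv_chart)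
    show "Cinf_on (W0 \<inter> V) G" using W0(3) by (meson Ck_on_subset Int_lower1)
  qed (use \<open>open V\<close> W0 key in \<open>auto simp: V_def\<close>)
qed

lemma local_translation:
  assumes c: "c \<in> A" "u \<in> fst c" and d: "d \<in> A" "r u h \<in> fst d" and h: "h \<in> Hgrp"
  obtains U F where "open U" "snd c u \<in> U" "U \<subseteq> chart_dom c" "Cinf_on U F"
    "\<And>x. x \<in> U \<Longrightarrow> r (chart_inv c x) h \<in> fst d" "\<And>x. x \<in> U \<Longrightarrow> F x = snd d (r (chart_inv c x) h)"
proof -
  obtain W G where W: "open W" "(snd c u, h) \<in> W" "Cinf_on W G"
    "\<And>x h. (x, h) \<in> W \<Longrightarrow> x \<in> chart_dom c"
    "\<And>x h. (x, h) \<in> W \<Longrightarrow> h \<in> Hgrp \<Longrightarrow> r (chart_inv c x) h \<in> fst d \<and> G (x, h) = snd d (r (chart_inv c x) h)"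
    using local_action[OF c d h] by blast
  define U where "U = (\<lambda>x. (x, h)) -` W"
  have "open U" unfolding U_def by (intro open_vimage W continuous_intros)
  moreover have "Cinf_on U (\<lambda>x. G (x, h))"
    using Cinf_on_Pair[OF \<open>open U\<close> Cinf_on_bounded_linear'[OF bounded_linear_ident], of "\<lambda>_. h"] Ck_on_const
    by (intro Cinf_on_compose[OF \<open>open U\<close> W(1) _ _ W(3)]) (auto simp: U_def)
  ultimately show ?thesis
    using W h by (intro that[of U "\<lambda>x. G (x, h)"]) (auto simp: U_def)
qed

lemma tangent_translation:
  assumes c: "c \<in> A" and d: "d \<in> A" and U: "open U" "U \<subseteq> chart_dom c" "Cinf_on U F"
    "\<And>x. x \<in> U \<Longrightarrow> r (chart_inv c x) h \<in> fst d" "\<And>x. x \<in> U \<Longrightarrow> F x = snd d (r (chart_inv c x) h)"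
    and x: "x \<in> U" and \<xi>: "\<xi> \<in> tangent_space A (chart_inv c x)"
  shows "tangent_map A A (\<lambda>u. r u h) (chart_inv c x) \<xi>
    = coord_vec A d (r (chart_inv c x) h) (fderiv F x (\<xi> c))"
proof (rule tangent_map_chart[where N="chart_inv c ` U"])
  have sx: "snd c (chart_inv c x) = x" if "x \<in> U" for x using that U c by (simp add: chart_chart_inv subset_iff)
  have "chart_inv c ` U = snd c -` U \<inter> fst c"
  proof (intro equalityI subsetI)
    fix u assume "u \<in> chart_inv c ` U"
    then show "u \<in> snd c -` U \<inter> fst c" using sx chart_inv_in[OF c] U(2) by auto
  next
    fix u assume "u \<in> snd c -` U \<inter> fst c"
    then show "u \<in> chart_inv c ` U" using chart_inv_chart[OF c, of u] by (metis IntD1 IntD2 image_eqI vimageD)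
  qed
  moreover have "open (snd c -` U \<inter> fst c)"
    using continuous_on_open_vimage[OF open_chart[OF c]] continuous_chart[OF c] U(1) by blast
  ultimately show "open (chart_inv c ` U)" by simp
  show "((snd d \<circ> (\<lambda>u. r u h) \<circ> chart_inv c) has_derivative fderiv F x) (at (snd c (chart_inv c x)))"
    unfolding sx[OF x]
    by (rule has_derivative_transform_within_open[OF differentiable_has_derivative[OF Cinf_on_differentiable[OF U(3) x]] U(1) x])
      (simp add: U(5))
  show "chart_inv c ` U \<subseteq> fst c" "chart_inv c x \<in> fst c" using U(2) c x by (auto simp: chart_facts subset_iff)
qed (use c d U x \<xi> in auto)

lemma tangent_translation_in:
  assumes \<xi>: "\<xi> \<in> tangent_space A u" and h: "h \<in> Hgrp"
  shows "tangent_map A A (\<lambda>u. r u h) u \<xi> \<in> tangent_space A (r u h)"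
proof -
  let ?c = "chart_at A u" and ?d = "chart_at A (r u h)"
  note c = chart_at[of u] and d = chart_at[of "r u h"]
  obtain U F where U: "open U" "snd ?c u \<in> U" "U \<subseteq> chart_dom ?c" "Cinf_on U F"
    "\<And>x. x \<in> U \<Longrightarrow> r (chart_inv ?c x) h \<in> fst ?d" "\<And>x. x \<in> U \<Longrightarrow> F x = snd ?d (r (chart_inv ?c x) h)"
    using local_translation[OF c d h] by blast
  show ?thesis
    using tangent_translation[OF c(1) d(1) U(1,3,4,5,6,2), of \<xi>] \<xi> c d
      coord_vec_in_tangent_space[OF d] by (simp add: chart_inv_chart)
qed

text \<open>The coordinate expression of the form is, up to the linear map \<open>Ad (matrix_inv h)\<close>, its own pullback
  along the coordinate expression of the right translation.\<close>

lemma ext_deriv_equivariant: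
  assumes \<omega>: "one_form A V \<omega>" and eq: "equivariant_form A r \<omega>" and h: "h \<in> Hgrp"
    and \<xi>: "\<xi> \<in> tangent_space A u" and \<eta>: "\<eta> \<in> tangent_space A u"
  shows "ext_deriv A \<omega> (r u h) (tangent_map A A (\<lambda>u. r u h) u \<xi>) (tangent_map A A (\<lambda>u. r u h) u \<eta>)
    = Ad (matrix_inv h) (ext_deriv A \<omega> u \<xi> \<eta>)"
proof -
  define c d where "c = chart_at A u" and "d = chart_at A (r u h)"
  have c: "c \<in> A" "u \<in> fst c" and d: "d \<in> A" "r u h \<in> fst d" unfolding c_def d_def by (rule chart_at)+
  obtain U F where U: "open U" "snd c u \<in> U" "U \<subseteq> chart_dom c" "Cinf_on U F"
    "\<And>x. x \<in> U \<Longrightarrow> r (chart_inv c x) h \<in> fst d" "\<And>x. x \<in> U \<Longrightarrow> F x = snd d (r (chart_inv c x) h)"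
    using local_translation[OF c d h] by blast
  let ?T = "tangent_map A A (\<lambda>u. r u h)"
  let ?x = "snd c u"
  have T: "?T (chart_inv c x) \<xi> = coord_vec A d (r (chart_inv c x) h) (fderiv F x (\<xi> c))"
    if "x \<in> U" "\<xi> \<in> tangent_space A (chart_inv c x)" for x \<xi>
    by (rule tangent_translation[OF c(1) d(1) U(1,3,4,5,6) that])
  have Tc: "?T u \<xi> d = fderiv F ?x (\<xi> c)" if "\<xi> \<in> tangent_space A u" for \<xi>
    using T[OF U(2), of \<xi>] that c d by (simp add: chart_inv_chart coord_vec_self)
  have Fx: "F ?x = snd d (r u h)" using U(2,6) c by (simp add: chart_inv_chart)
  let ?L = "Ad (matrix_inv h) :: 'k mat \<Rightarrow> 'k mat"
  have "ext_deriv A \<omega> (r u h) (?T u \<xi>) (?T u \<eta>)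
    = local_d d \<omega> (F ?x) (fderiv F ?x (\<xi> c)) (fderiv F ?x (\<eta> c))"
    using ext_deriv_chart[OF \<omega> d] tangent_translation_in[OF \<xi> h] tangent_translation_in[OF \<eta> h]
    by (simp add: Tc \<xi> \<eta> Fx)
  also have "\<dots> = fderiv (\<lambda>x. ?L (local_form A c \<omega> (\<eta> c) x)) ?x (\<xi> c)
      - fderiv (\<lambda>x. ?L (local_form A c \<omega> (\<xi> c) x)) ?x (\<eta> c)"
    unfolding local_d_def
  proof (rule exterior_derivative_pullback[where V="chart_dom d" and \<beta>="\<lambda>v x. ?L (local_form A c \<omega> v x)", symmetric])
    show "Ck_on 2 U F" using U(4) by blast
    show "F ` U \<subseteq> chart_dom d" using U(5,6) by auto
    show "linear (\<lambda>w. local_form A d \<omega> w y)" if "y \<in> chart_dom d" for y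
      by (rule linear_local_form[OF \<omega> d(1) that])
    show "local_form A d \<omega> w differentiable at y" if "y \<in> chart_dom d" for w y
      by (rule Cinf_on_differentiable[OF Cinf_on_local_form[OF \<omega> d(1)] that])
    show "?L (local_form A c \<omega> v x) = local_form A d \<omega> (fderiv F x v) (F x)" if "x \<in> U" for x v
    proof -
      let ?u = "chart_inv c x"
      have u: "?u \<in> fst c" using U(3) that c by (auto simp: chart_inv_in)
      have cv: "coord_vec A c ?u v \<in> tangent_space A ?u" by (rule coord_vec_in_tangent_space[OF c(1) u])
      have "?L (local_form A c \<omega> v x) = \<omega> (r ?u h) (?T ?u (coord_vec A c ?u v))"
        using eq h cv unfolding equivariant_form_def local_form_def by simp
      also have "\<dots> = \<omega> (r ?u h) (coord_vec A d (r ?u h) (fderiv F x v))"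
        using T[OF that cv] by (simp add: coord_vec_self[OF c(1) u])
      also have "\<dots> = local_form A d \<omega> (fderiv F x v) (F x)"
        using U(5,6)[OF that] by (simp add: local_form_def chart_inv_chart[OF d(1)])
      finally show ?thesis .
    qed
  qed (use U open_chart_dom[OF d(1)] in auto)
  also have "\<dots> = ?L (local_d c \<omega> ?x (\<xi> c) (\<eta> c))"
  proof -
    have "local_form A c \<omega> v differentiable (at ?x)" for v
      using U(2,3) by (intro Cinf_on_differentiable[OF Cinf_on_local_form[OF \<omega> c(1)]]) auto
    then show ?thesis
      by (simp add: local_d_def frechet_derivative_bounded_linear[OF bounded_linear_Ad]
          linear_diff[OF linear_Ad])
  qed
  also have "\<dots> = ?L (ext_deriv A \<omega> u \<xi> \<eta>)" using ext_deriv_chart[OF \<omega> c \<xi> \<eta>] by simp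
  finally show ?thesis .
qed

text \<open>The infinitesimal version of equivariance for a horizontal form. The form is pulled back
  along \<open>\<Phi>(x, t) = x exp(t Z)\<close>. Equivariance computes the pullback on vectors \<open>(v, 0)\<close> as
  \<open>Ad (exp (- t Z)) \<theta>\<close>, horizontality computes it on \<open>(0, 1)\<close> as 0 along \<open>t = 0\<close>, and its exterior
  derivative on the pair \<open>(0, 1)\<close>, \<open>(v, 0)\<close> is \<open>d\<theta>(\<zeta>_Z, v)\<close>.\<close>

lemma ext_deriv_fundamental_field:
  assumes \<theta>: "one_form A V \<theta>" and eq: "equivariant_form A r \<theta>"
    and hor: "\<And>u. \<theta> u (fundamental_field A r Z u) = 0"
    and Z: "Z \<in> halg" and \<eta>: "\<eta> \<in> tangent_space A u"
  shows "ext_deriv A \<theta> u (fundamental_field A r Z u) \<eta> = - lie Z (\<theta> u \<eta>)"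
    and fundamental_field_tangent: "fundamental_field A r Z u \<in> tangent_space A u"
proof -
  define c where "c = chart_at A u"
  have c: "c \<in> A" "u \<in> fst c" unfolding c_def by (rule chart_at)+
  let ?x = "snd c u"
  define m where "m = (\<lambda>t. mexp (t *\<^sub>R Z))"
  have m0: "m 0 = mat 1" unfolding m_def by (rule mexp_0)
  have mH: "m t \<in> Hgrp" for t unfolding m_def by (rule mexp_in_Hgrp[OF Z])
  have m': "(m has_vector_derivative Z ** m t) (at t)" for t unfolding m_def by (rule mexp_derivative)
  have mC: "Cinf_on T m" for T unfolding m_def by (rule Cinf_on_mexp)
  have ru: "r u (mat 1) \<in> fst c" using c by (simp add: r_one)
  obtain W G where W: "open W" "(?x, mat 1) \<in> W" "Cinf_on W G"
    "\<And>x h. (x, h) \<in> W \<Longrightarrow> x \<in> chart_dom c"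
    "\<And>x h. (x, h) \<in> W \<Longrightarrow> h \<in> Hgrp \<Longrightarrow> r (chart_inv c x) h \<in> fst c \<and> G (x, h) = snd c (r (chart_inv c x) h)"
    using local_action[OF c c(1) ru Hgrp_mat_1] by blast
  define U where "U = (\<lambda>y. (fst y, m (snd y))) -` W"
  define \<Phi> where "\<Phi> = (\<lambda>y. G (fst y, m (snd y)))"
  have "continuous_on UNIV m" using Ck_on_imp_continuous_on mC by blast
  then have "continuous_on UNIV (\<lambda>y. (fst y, m (snd y)))"
    by (intro continuous_on_Pair continuous_on_fst continuous_on_id
        continuous_on_compose2[of UNIV m _ snd] continuous_on_snd subset_UNIV)
  then have "open U" unfolding U_def by (intro open_vimage W(1))
  have pC: "Cinf_on U (\<lambda>y. (fst y, m (snd y)))"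
    using Cinf_on_compose[OF \<open>open U\<close> open_UNIV subset_UNIV Cinf_on_bounded_linear'[OF bounded_linear_snd] mC]
    by (intro Cinf_on_Pair[OF \<open>open U\<close>] Cinf_on_bounded_linear'[OF bounded_linear_fst])
  have \<Phi>C: "Cinf_on U \<Phi>"
    unfolding \<Phi>_def by (rule Cinf_on_compose[OF \<open>open U\<close> W(1) _ pC W(3)]) (auto simp: U_def)
  have x0: "(?x, 0) \<in> U" using W(2) by (simp add: U_def m0)
  have Udom: "x \<in> chart_dom c" if "(x, t) \<in> U" for x t using W(4) that by (auto simp: U_def)
  have \<Phi>: "r (chart_inv c x) (m t) \<in> fst c" "\<Phi> (x, t) = snd c (r (chart_inv c x) (m t))" if "(x, t) \<in> U" for x t
    using W(5)[OF _ mH] that by (auto simp: U_def \<Phi>_def)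
  have \<Phi>0: "\<Phi> (x, 0) = x" if "(x, 0) \<in> U" for x
    using \<Phi>(2)[OF that] chart_chart_inv[OF c(1) Udom[OF that]] by (simp add: m0 r_one)
  let ?D = "\<lambda>y. frechet_derivative \<Phi> (at y)"
  have D: "(\<Phi> has_derivative ?D y) (at y)" if "y \<in> U" for y
    by (intro differentiable_has_derivative Cinf_on_differentiable[OF \<Phi>C that])
  have slice: "open {x. (x, t) \<in> U}" "open {t. (x, t) \<in> U}" for x t
  proof -
    have "open ((\<lambda>x. (x, t)) -` U)" "open ((\<lambda>t. (x, t)) -` U)"
      by (intro open_vimage \<open>open U\<close> continuous_intros)+
    then show "open {x. (x, t) \<in> U}" "open {t. (x, t) \<in> U}" by (simp_all add: vimage_def)
  qed
  \<comment> \<open>At \<open>t = 0\<close> the \<open>t\<close>-derivative of \<open>\<Phi>\<close> is the coordinate vector of the fundamental field.\<close>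
  have zeta: "fundamental_field A r Z (chart_inv c x) = coord_vec A c (chart_inv c x) (?D (x, 0) (0, 1))"
    if xU: "(x, 0) \<in> U" for x
  proof
    fix e
    let ?u = "chart_inv c x"
    have u: "?u \<in> fst c" "snd c ?u = x" using Udom[OF xU] c(1) by (simp_all add: chart_facts)
    show "fundamental_field A r Z ?u e = coord_vec A c ?u (?D (x, 0) (0, 1)) e"
    proof (cases "e \<in> A \<and> ?u \<in> fst e")
      case False
      then show ?thesis
        using mexp_0[of Z] by (auto simp: fundamental_field_def velocity0_def coord_vec_def r_one)
    next
      case True
      have "((\<lambda>t. \<Phi> (x, t)) has_vector_derivative ?D (x, 0) (0, 1)) (at 0)"
        using directional_derivative[OF Cinf_on_differentiable[OF \<Phi>C xU], of "(0, 1)"] by simp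
      then have 1: "((\<lambda>t. \<Phi> (x, t)) has_derivative (\<lambda>s. s *\<^sub>R ?D (x, 0) (0, 1))) (at 0)"
        by (simp add: has_vector_derivative_def)
      have "((snd e \<circ> chart_inv c) has_derivative change c e ?u) (at (\<Phi> (x, 0)))"
        using change_has_derivative[of c e ?u] True c u by (simp add: \<Phi>0[OF xU])
      from diff_chain_at[OF 1 this]
      have 2: "((\<lambda>t. snd e (chart_inv c (\<Phi> (x, t)))) has_derivative (\<lambda>s. change c e ?u (s *\<^sub>R ?D (x, 0) (0, 1)))) (at 0)"
        by (simp add: o_def)
      have "((snd e \<circ> (\<lambda>t. r ?u (m t))) has_derivative (\<lambda>s. change c e ?u (s *\<^sub>R ?D (x, 0) (0, 1)))) (at 0)"
        by (rule has_derivative_transform_within_open[OF 2 slice(2)[of x]])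
           (use xU \<Phi> c(1) in \<open>auto simp: chart_inv_chart\<close>)
      then have "((snd e \<circ> (\<lambda>t. r ?u (m t))) has_vector_derivative change c e ?u (?D (x, 0) (0, 1))) (at 0)"
        using linear_cmul[OF linear_change[of c e ?u]] True c u by (simp add: has_vector_derivative_def)
      from vector_derivative_at[OF this] show ?thesis
        using True mexp_0[of Z] by (simp add: fundamental_field_def velocity0_def coord_vec_def m_def r_one)
    qed
  qed
  have zeta_u: "fundamental_field A r Z u = coord_vec A c u (?D (?x, 0) (0, 1))"
    using zeta[OF x0] c by (simp add: chart_inv_chart)
  then show T: "fundamental_field A r Z u \<in> tangent_space A u"
    using coord_vec_in_tangent_space[OF c] by simp
  \<comment> \<open>The pullback of \<open>\<theta>\<close> along \<open>\<Phi>\<close>.\<close>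
  define \<beta> where "\<beta> = (\<lambda>v y. local_form A c \<theta> (?D y v) (\<Phi> y))"
  have \<beta>1: "\<beta> (v, 0) (x, t) = transpose (m t) ** local_form A c \<theta> v x ** m t" if xU: "(x, t) \<in> U" for v x t
  proof -
    let ?u = "chart_inv c x"
    let ?S = "{x. (x, t) \<in> U}"
    have u: "?u \<in> fst c" using Udom[OF xU] c(1) by (simp add: chart_facts)
    have cv: "coord_vec A c ?u v \<in> tangent_space A ?u" by (rule coord_vec_in_tangent_space[OF c(1) u])
    have sC: "Cinf_on ?S (\<lambda>x. \<Phi> (x, t))"
      using Cinf_on_Pair[OF slice(1) Cinf_on_bounded_linear'[OF bounded_linear_ident], of t "\<lambda>_. t"] Ck_on_const
      by (intro Cinf_on_compose[OF slice(1) \<open>open U\<close> _ _ \<Phi>C]) auto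
    have "((\<lambda>x. (x, t)) has_derivative (\<lambda>v. (v, 0))) (at x)" by (auto intro!: derivative_eq_intros)
    from diff_chain_at[OF this D[OF xU]]
    have sD: "fderiv (\<lambda>x. \<Phi> (x, t)) x v = ?D (x, t) (v, 0)" for v
      by (simp add: o_def frechet_derivative_eqI)
    have "tangent_map A A (\<lambda>u. r u (m t)) ?u (coord_vec A c ?u v)
      = coord_vec A c (r ?u (m t)) (fderiv (\<lambda>x. \<Phi> (x, t)) x (coord_vec A c ?u v c))"
      by (rule tangent_translation[OF c(1) c(1) slice(1) _ sC _ _ _ cv]) (use xU Udom \<Phi> in auto)
    also have "\<dots> = coord_vec A c (r ?u (m t)) (?D (x, t) (v, 0))"
      by (simp add: sD coord_vec_self[OF c(1) u])
    finally have "\<beta> (v, 0) (x, t) = \<theta> (r ?u (m t)) (tangent_map A A (\<lambda>u. r u (m t)) ?u (coord_vec A c ?u v))"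
      using \<Phi>[OF xU] by (simp add: \<beta>_def local_form_def chart_inv_chart[OF c(1)])
    also have "\<dots> = Ad (matrix_inv (m t)) (local_form A c \<theta> v x)"
      using eq mH cv unfolding equivariant_form_def local_form_def by simp
    finally show ?thesis by (simp add: Ad_matrix_inv[OF mH])
  qed
  have \<beta>2: "\<beta> (0, 1) (x, 0) = 0" if "(x, 0) \<in> U" for x
    using hor[of "chart_inv c x"] unfolding zeta[OF that] by (simp add: \<beta>_def \<Phi>0[OF that] local_form_def)
  have \<Phi>U: "\<Phi> ` U \<subseteq> chart_dom c" using \<Phi> by auto
  have lin: "linear (\<lambda>w. local_form A c \<theta> w y)" if "y \<in> chart_dom c" for y
    by (rule linear_local_form[OF \<theta> c(1) that])
  have diff: "local_form A c \<theta> w differentiable at y" if "y \<in> chart_dom c" for w y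
    by (rule Cinf_on_differentiable[OF Cinf_on_local_form[OF \<theta> c(1)] that])
  have \<beta>_eq: "\<beta> v y = local_form A c \<theta> (?D y v) (\<Phi> y)" for v y by (simp add: \<beta>_def)
  note pull = pullback_form[where \<beta>=\<beta> and \<alpha>="local_form A c \<theta>",
      OF \<open>open U\<close> \<Phi>C[rule_format] \<Phi>U open_chart_dom[OF c(1)] lin diff \<beta>_eq x0, folded local_d_def]
  let ?v = "\<eta> c"
  \<comment> \<open>The two terms of the exterior derivative of the pullback are derivatives along the lines
  \<open>t \<mapsto> (x, t)\<close> and \<open>s \<mapsto> (x + s v, 0)\<close>, on which the pullback is known explicitly.\<close>
  have d1: "fderiv (\<beta> (?v, 0)) (?x, 0) (0, 1) = - lie Z (\<theta> u \<eta>)"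
  proof -
    let ?Y = "local_form A c \<theta> ?v ?x"
    have "((\<lambda>t. \<beta> (?v, 0) (?x, t)) has_vector_derivative fderiv (\<beta> (?v, 0)) (?x, 0) (0, 1)) (at 0)"
      using directional_derivative[OF pull(1)[of "(?v, 0)"], of "(0, 1)"] by simp
    moreover have "((\<lambda>t. transpose (m t) ** ?Y ** m t) has_vector_derivative
        (transpose (m 0) ** ?Y) ** (Z ** m 0) + (transpose (Z ** m 0) ** ?Y) ** m 0) (at 0)"
      by (intro bounded_bilinear.has_vector_derivative[OF bounded_bilinear_matrix_mult] m'
          bounded_linear.has_vector_derivative[OF bounded_linear_transpose]
          bounded_linear.has_vector_derivative[OF bounded_linear_matrix_mult_left])
    then have "((\<lambda>t. \<beta> (?v, 0) (?x, t)) has_vector_derivative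
        (transpose (m 0) ** ?Y) ** (Z ** m 0) + (transpose (Z ** m 0) ** ?Y) ** m 0) (at 0)"
      unfolding has_vector_derivative_def
      by (rule has_derivative_transform_within_open[OF _ slice(2)[of ?x]]) (use x0 \<beta>1 in auto)
    ultimately have "fderiv (\<beta> (?v, 0)) (?x, 0) (0, 1)
        = (transpose (m 0) ** ?Y) ** (Z ** m 0) + (transpose (Z ** m 0) ** ?Y) ** m 0"
      by (rule vector_derivative_unique_at)
    also have "\<dots> = ?Y ** Z + transpose Z ** ?Y" by (simp add: m0 transpose_mat)
    also have "transpose Z = - Z" using Z by (auto simp: halg_emb transpose_emb emb_0_lin)
    finally show ?thesis
      using local_form_chart[OF \<eta> c, of \<theta>]
      by (simp add: lie_def matrix_mult_minus_left)
  qed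
  have d2: "fderiv (\<beta> (0, 1)) (?x, 0) (?v, 0) = 0"
  proof -
    have "((\<lambda>s. \<beta> (0, 1) (?x + s *\<^sub>R ?v, 0)) has_vector_derivative fderiv (\<beta> (0, 1)) (?x, 0) (?v, 0)) (at 0)"
      using directional_derivative[OF pull(1)[of "(0, 1)"], of "(?v, 0)"] by simp
    moreover have "((\<lambda>s. \<beta> (0, 1) (?x + s *\<^sub>R ?v, 0)) has_vector_derivative 0) (at 0)"
      unfolding has_vector_derivative_def
    proof (rule has_derivative_transform_within_open)
      show "((\<lambda>s. 0) has_derivative (\<lambda>s. s *\<^sub>R 0)) (at (0::real))" by simp
      have "open ((\<lambda>s. (?x + s *\<^sub>R ?v, 0)) -` U)" by (intro open_vimage \<open>open U\<close> continuous_intros)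
      then show "open {s. (?x + s *\<^sub>R ?v, 0) \<in> U}" by (simp add: vimage_def)
    qed (use x0 \<beta>2 in auto)
    ultimately show ?thesis by (rule vector_derivative_unique_at)
  qed
  have D1: "?D (?x, 0) (?v, 0) = ?v"
  proof -
    have "((\<lambda>x. (x, 0::real)) has_derivative (\<lambda>v. (v, 0))) (at ?x)" by (auto intro!: derivative_eq_intros)
    from diff_chain_at[OF this D[OF x0]]
    have "((\<lambda>x. \<Phi> (x, 0)) has_derivative (\<lambda>v. ?D (?x, 0) (v, 0))) (at ?x)" by (simp add: o_def)
    moreover have "((\<lambda>x. \<Phi> (x, 0)) has_derivative (\<lambda>v. v)) (at ?x)"
      by (rule has_derivative_transform_within_open[OF has_derivative_ident slice(1)[of 0]]) (use x0 \<Phi>0 in auto)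
    ultimately show ?thesis by (metis has_derivative_unique)
  qed
  have "ext_deriv A \<theta> u (fundamental_field A r Z u) \<eta>
    = local_d c \<theta> (\<Phi> (?x, 0)) (?D (?x, 0) (0, 1)) (?D (?x, 0) (?v, 0))"
    using ext_deriv_chart[OF \<theta> c T \<eta>] c by (simp add: zeta_u coord_vec_self \<Phi>0[OF x0] D1)
  also have "\<dots> = - lie Z (\<theta> u \<eta>)"
    using pull(2)[of "(?v, 0)" "(0, 1)"] by (simp add: d1 d2)
  finally show "ext_deriv A \<theta> u (fundamental_field A r Z u) \<eta> = - lie Z (\<theta> u \<eta>)" .
qed

end

section \<open>The linear algebra of normality\<close>

text \<open>An inner product \<open>ip\<close> that is given on \<open>S\<close> alone represents every linear functional. The map \<open>R\<close> with
  \<open>ip v e = R v \<bullet> e\<close> for a Euclidean orthonormal basis \<open>E\<close> of \<open>S\<close> is injective on \<open>S\<close> by positivity, hence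
  maps \<open>S\<close> onto itself. This is what makes the adjoint in \<open>spencer_adj\<close> exist.\<close>

lemma riesz_on_subspace:
  fixes S :: "'a::euclidean_space set"
  assumes S: "subspace S"
    and lin: "\<And>X Y Z a b. X \<in> S \<Longrightarrow> Y \<in> S \<Longrightarrow> Z \<in> S \<Longrightarrow> ip (a *\<^sub>R X + b *\<^sub>R Y) Z = a * ip X Z + b * ip Y Z"
    and sym: "\<And>X Y. X \<in> S \<Longrightarrow> Y \<in> S \<Longrightarrow> ip X Y = ip Y X"
    and pos: "\<And>X. X \<in> S \<Longrightarrow> X \<noteq> 0 \<Longrightarrow> ip X X > (0::real)"
    and \<phi>: "linear \<phi>"
  shows "\<exists>b\<in>S. \<forall>X\<in>S. \<phi> X = ip X b"
proof -
  obtain E where E: "E \<subseteq> S" "pairwise orthogonal E" "\<And>x. x \<in> E \<Longrightarrow> norm x = 1" "independent E" "span E = S"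
    using orthonormal_basis_subspace[OF S] by metis
  have fin: "finite E" using E(4) by (rule independent_imp_finite)
  have delta: "e \<bullet> f = (if e = f then 1 else 0)" if "e \<in> E" "f \<in> E" for e f
    using E(2,3) that by (auto simp: pairwise_def orthogonal_def norm_eq_1)
  have rep: "v = (\<Sum>f\<in>E. (v \<bullet> f) *\<^sub>R f)" if "v \<in> S" for v
  proof -
    obtain c where c: "v = (\<Sum>f\<in>E. c f *\<^sub>R f)" using \<open>v \<in> S\<close> E(5) span_finite[OF fin] by auto
    have "v \<bullet> e = c e" if "e \<in> E" for e
      using that by (simp add: c inner_sum_left delta if_distrib cong: if_cong) (simp add: fin)
    then show ?thesis using c by simp
  qed
  have sumS: "(\<Sum>f\<in>F. c f *\<^sub>R f) \<in> S" if "F \<subseteq> E" for c F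
    using that E(1) by (intro subspace_sum[OF S] subspace_scale[OF S]) auto
  have lin_sum: "ip (\<Sum>f\<in>F. c f *\<^sub>R f) Z = (\<Sum>f\<in>F. c f * ip f Z)" if "F \<subseteq> E" "Z \<in> S" for F c Z
    using finite_subset[OF that(1) fin] that(1)
  proof (induction F rule: finite_induct)
    case empty
    show ?case using lin[of 0 0 Z 0 0] that(2) S by (simp add: subspace_0)
  next
    case (insert f F)
    then show ?case
      using lin[of f "\<Sum>f\<in>F. c f *\<^sub>R f" Z "c f" 1] sumS[of F c] E(1) that(2) by auto
  qed
  define R where "R = (\<lambda>v. \<Sum>e\<in>E. (\<Sum>f\<in>E. (v \<bullet> f) * ip f e) *\<^sub>R e)"
  have "linear R" unfolding R_def
    by (rule linearI) (simp_all add: inner_add_left distrib_right sum.distrib scaleR_add_left scaleR_sum_right sum_distrib_left mult.assoc)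
  have R: "R v = (\<Sum>e\<in>E. ip v e *\<^sub>R e)" if "v \<in> S" for v
  proof -
    have "(\<Sum>f\<in>E. (v \<bullet> f) * ip f e) = ip v e" if "e \<in> E" for e
    proof -
      have "e \<in> S" using that E(1) by blast
      show ?thesis unfolding lin_sum[OF order_refl \<open>e \<in> S\<close>, symmetric] rep[OF \<open>v \<in> S\<close>, symmetric] ..
    qed
    then show ?thesis by (simp add: R_def)
  qed
  have ipR: "ip v e = R v \<bullet> e" if "v \<in> S" "e \<in> E" for v e
    using that(2) by (simp add: R[OF that(1)] inner_sum_left delta if_distrib cong: if_cong) (simp add: fin)
  have "inj_on R S"
  proof (rule linear_injective_on_subspace_0[OF \<open>linear R\<close> S, THEN iffD2], intro ballI impI)
    fix v assume v: "v \<in> S" "R v = 0"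
    have "ip v v = (\<Sum>f\<in>E. (v \<bullet> f) * ip f v)"
      unfolding lin_sum[OF order_refl v(1), symmetric] rep[OF v(1), symmetric] ..
    also have "\<dots> = 0" using ipR[OF v(1)] v E(1) by (auto intro!: sum.neutral simp: sym subset_iff)
    finally show "v = 0" using pos[OF v(1)] by force
  qed
  have "R ` S = S"
  proof (rule subspace_dim_equal)
    show "subspace (R ` S)" by (rule linear_subspace_image[OF \<open>linear R\<close> S])
    show "R ` S \<subseteq> S" using sumS[of E] by (auto simp: R)
    show "dim S \<le> dim (R ` S)" using dim_image_eq[OF \<open>linear R\<close>, of S] \<open>inj_on R S\<close> S by (simp add: span_eq_iff[THEN iffD2])
  qed (rule S)
  moreover have "(\<Sum>e\<in>E. \<phi> e *\<^sub>R e) \<in> S" by (rule sumS) simp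
  ultimately obtain b where b: "b \<in> S" "R b = (\<Sum>e\<in>E. \<phi> e *\<^sub>R e)" by (metis imageE)
  have be: "ip b e = \<phi> e" if "e \<in> E" for e
    using that by (simp add: ipR[OF b(1) that] b(2) inner_sum_left delta if_distrib cong: if_cong) (simp add: fin)
  have "\<phi> X = ip X b" if "X \<in> S" for X
  proof -
    have "\<phi> X = \<phi> (\<Sum>f\<in>E. (X \<bullet> f) *\<^sub>R f)" by (rule arg_cong[OF rep[OF that]])
    also have "\<dots> = (\<Sum>f\<in>E. (X \<bullet> f) * ip f b)"
      unfolding linear_sum[OF \<phi>] linear_cmul[OF \<phi>] real_scaleR_def
    proof (intro sum.cong refl)
      fix f assume f: "f \<in> E"
      then have "f \<in> S" using E(1) by blast
      then show "(X \<bullet> f) * \<phi> f = (X \<bullet> f) * ip f b" by (simp only: be[OF f, symmetric] sym[OF b(1)])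
    qed
    also have "\<dots> = ip X b" unfolding lin_sum[OF order_refl b(1), symmetric] rep[OF that, symmetric] ..
    finally show ?thesis .
  qed
  with b(1) show ?thesis by blast
qed

text \<open>The embeddings of the three summands of \<open>mcompl\<close>; for the one-dimensional summand, the image of 1.\<close>

abbreviation e0 :: "'k::finite mat" where "e0 \<equiv> mvec 1 0 0"
abbreviation ev :: "real^'k \<Rightarrow> 'k::finite mat" where "ev v \<equiv> mvec 0 v 0"
abbreviation bv :: "real^'k \<Rightarrow> 'k::finite mat" where "bv w \<equiv> mvec 0 0 w"

lemma mvec_eq_iff: "mvec a v w = mvec a' v' w' \<longleftrightarrow> a = a' \<and> v = v' \<and> w = w'"
  by (metis mvec_coords)

lemma mvec_in_mcompl [simp]: "mvec a v w \<in> mcompl"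
  by (auto simp: mcompl_def)

lemma sum_mbasis: "(\<Sum>x\<in>mbasis. f x) = f e0 + (\<Sum>i\<in>UNIV. f (ev (axis i 1))) + (\<Sum>i\<in>UNIV. f (bv (axis i 1)))"
  for f :: "'k::finite mat \<Rightarrow> 'a::comm_monoid_add"
proof -
  have n: "axis i (1::real) \<noteq> 0" "0 \<noteq> axis i (1::real)" for i :: 'k by (simp_all add: axis_eq_0_iff eq_commute[of 0])
  have 1: "inj (\<lambda>i::'k. ev (axis i 1))" "inj (\<lambda>i::'k. bv (axis i 1))"
    by (auto simp: inj_def mvec_eq_iff axis_eq_axis)
  have 2: "(\<Sum>x\<in>mbasis. f x) = (\<Sum>x\<in>{e0} \<union> range (\<lambda>i. ev (axis i 1)). f x) + (\<Sum>x\<in>range (\<lambda>i. bv (axis i 1)). f x)"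
    unfolding mbasis_def by (rule sum.union_disjoint) (auto simp: mvec_eq_iff n)
  also have "(\<Sum>x\<in>{e0} \<union> range (\<lambda>i. ev (axis i 1)). f x) = f e0 + (\<Sum>x\<in>range (\<lambda>i. ev (axis i 1)). f x)"
    by (subst sum.union_disjoint) (auto simp: mvec_eq_iff n)
  finally show ?thesis by (simp add: sum.reindex 1)
qed

lemma finite_mbasis: "finite mbasis"
  by (simp add: mbasis_def)

lemma mbasis_subset: "mbasis \<subseteq> mcompl"
  by (auto simp: mbasis_def)

lemma vec_axis_sum: "v = (\<Sum>i\<in>UNIV. (v $ i) *\<^sub>R axis i 1)" for v :: "real^'k"
  by (simp add: vec_eq_iff axis_def if_distrib cong: if_cong)

lemma mcompl_expand:
  assumes "X \<in> mcompl"
  shows "X = (\<Sum>x\<in>mbasis. ip_m x X *\<^sub>R x)"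
proof -
  obtain a v w where X: "X = mvec a v w" using assms by (auto simp: mcompl_def)
  have l: "linear (\<lambda>v. ev v)" "linear (\<lambda>v. bv v)" by (auto intro!: linearI simp: mvec_lin)
  have ev: "ev v = (\<Sum>i\<in>UNIV. (v $ i) *\<^sub>R ev (axis i 1))" for v
    by (subst vec_axis_sum[of v]) (simp only: linear_sum[OF l(1)] linear_cmul[OF l(1)])
  have bv: "bv v = (\<Sum>i\<in>UNIV. (v $ i) *\<^sub>R bv (axis i 1))" for v
    by (subst vec_axis_sum[of v]) (simp only: linear_sum[OF l(2)] linear_cmul[OF l(2)])
  have "X = a *\<^sub>R e0 + ev v + bv w" by (simp add: X mvec_lin)
  moreover have "ip_m e0 X = a" "ip_m (ev (axis i 1)) X = v $ i" "ip_m (bv (axis i 1)) X = w $ i" for i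
    by (simp_all add: ip_m_def X inner_axis')
  ultimately show ?thesis by (simp only: sum_mbasis flip: ev bv)
qed

lemma subspace_mcompl: "subspace mcompl"
proof -
  have "0 \<in> mcompl" using mvec_in_mcompl[of 0 0 0] by (simp only: mvec_lin)
  moreover have "X + Y \<in> mcompl" "c *\<^sub>R X \<in> mcompl" if "X \<in> mcompl" "Y \<in> mcompl" for X Y :: "'a mat" and c
  proof -
    obtain a v w a' v' w' where "X = mvec a v w" "Y = mvec a' v' w'" using \<open>X \<in> _\<close> \<open>Y \<in> _\<close> by (auto simp: mcompl_def)
    then show "X + Y \<in> mcompl" "c *\<^sub>R X \<in> mcompl" by (simp_all add: mvec_lin)
  qed
  ultimately show ?thesis by (auto simp: subspace_def)
qed

lemma subspace_halg: "subspace (halg :: 'k::finite mat set)"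
proof -
  have "(0 :: 'k mat) \<in> halg"
    unfolding halg_emb by (rule image_eqI[of _ _ 0]) (simp_all only: emb_0_lin skew_lin mem_Collect_eq)
  then show ?thesis unfolding subspace_def halg_emb by (auto simp: emb_0_lin skew_lin simp del: minus_add_distrib)
qed

text \<open>The sum of the two diagonal blocks of the map \<open>T X\<close> on the two copies of R^(n-1).
  Since o(n-1) acts diagonally on these copies, pairing \<open>T\<close> with the Spencer differential of a map \<open>A\<close>
  sees only this matrix.\<close>

definition contraction :: "('k::finite mat \<Rightarrow> 'k mat \<Rightarrow> 'k mat) \<Rightarrow> 'k mat \<Rightarrow> real^'k^'k" where
  "contraction T X = (\<chi> i j. m1 (T X (ev (axis j 1))) $ i + m2 (T X (bv (axis j 1))) $ i)"

text \<open>The two terms of the Spencer differential contribute equally because \<open>T\<close> is alternating, which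
  cancels the factor 1/2.\<close>

lemma ip_alt_spencer:
  assumes alt: "\<And>x y. x \<in> mbasis \<Longrightarrow> y \<in> mbasis \<Longrightarrow> T y x = - T x y"
  shows "ip_alt (spencer A) T = (\<Sum>x\<in>mbasis. \<Sum>y\<in>mbasis. ip_m (lie (A x) y) (T x y))"
proof -
  have lin: "ip_m (X - Y) Z = ip_m X Z - ip_m Y Z" "ip_m X (- Z) = - ip_m X Z" for X Y Z :: "'a mat"
    by (simp_all add: ip_m_def m0_def m1_def m2_def inner_vec_def algebra_simps sum_subtractf sum_negf)
  have "(\<Sum>x\<in>mbasis. \<Sum>y\<in>mbasis. ip_m (lie (A y) x) (T x y)) = (\<Sum>y\<in>mbasis. \<Sum>x\<in>mbasis. ip_m (lie (A y) x) (T x y))"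
    by (rule sum.swap)
  also have "\<dots> = (\<Sum>x\<in>mbasis. \<Sum>y\<in>mbasis. - ip_m (lie (A x) y) (T x y))"
  proof (intro sum.cong refl)
    fix a b :: "'a mat" assume "a \<in> mbasis" "b \<in> mbasis"
    then show "ip_m (lie (A a) b) (T b a) = - ip_m (lie (A a) b) (T a b)" by (simp only: alt[of a b] lin)
  qed
  finally show ?thesis
    by (simp add: ip_alt_def spencer_def lin sum_subtractf sum_negf)
qed

lemma ip_m_lie_sum:
  assumes C: "transpose C = - C"
  shows "(\<Sum>y\<in>mbasis. ip_m (lie (emb 0 C) y) (T x y)) = (\<Sum>j\<in>UNIV. \<Sum>i\<in>UNIV. C $ i $ j * contraction T x $ i $ j)"
proof -
  have col: "(C *v axis j 1) = column j C" for j by (simp add: matrix_vector_mult_basis)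
  show ?thesis
    by (simp add: sum_mbasis lie_emb_mvec[OF C] ip_m_def col inner_vec_def column_def contraction_def
        sum.distrib[symmetric] distrib_left)
qed

lemma sum_axis_axis: "(\<Sum>j\<in>UNIV. \<Sum>i\<in>UNIV. (if i = a \<and> j = b then (1::real) else 0) * f i j) = f a b"
  for a b :: "'k::finite"
proof -
  have "(\<Sum>i\<in>UNIV. (if i = a \<and> j = b then (1::real) else 0) * f i j) = (if j = b then f a b else 0)" for j
    by (cases "j = b") (simp_all add: if_distrib[of "\<lambda>z. z * _"] cong: if_cong)
  then show ?thesis by simp
qed

lemma skew_pairing_zero_iff:
  fixes P :: "real^'k^'k::finite"
  shows "(\<forall>C. transpose C = - C \<longrightarrow> (\<Sum>j\<in>UNIV. \<Sum>i\<in>UNIV. C $ i $ j * P $ i $ j) = 0) \<longleftrightarrow> transpose P = P"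
proof
  assume L: "\<forall>C. transpose C = - C \<longrightarrow> (\<Sum>j\<in>UNIV. \<Sum>i\<in>UNIV. C $ i $ j * P $ i $ j) = 0"
  have "P $ a $ b = P $ b $ a" for a b
  proof -
    define C :: "real^'k^'k" where
      "C = (\<chi> i j. (if i = a \<and> j = b then 1 else 0) - (if i = b \<and> j = a then 1 else 0))"
    have "transpose C $ i $ j = (- C) $ i $ j" for i j
      unfolding C_def transpose_def vec_lambda_beta vector_uminus_component by (simp add: conj_commute)
    then have "transpose C = - C" by (intro vec_eq_iff[THEN iffD2] allI)
    then have "(\<Sum>j\<in>UNIV. \<Sum>i\<in>UNIV. C $ i $ j * P $ i $ j) = 0" using L by blast
    then show ?thesis by (simp add: C_def left_diff_distrib sum_subtractf sum_axis_axis)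
  qed
  then show "transpose P = P" unfolding transpose_def vec_eq_iff vec_lambda_beta by blast
next
  assume P: "transpose P = P"
  show "\<forall>C. transpose C = - C \<longrightarrow> (\<Sum>j\<in>UNIV. \<Sum>i\<in>UNIV. C $ i $ j * P $ i $ j) = 0"
  proof (intro allI impI)
    fix C :: "real^'k^'k" assume C: "transpose C = - C"
    have "C $ i $ j * P $ i $ j = - (C $ j $ i * P $ j $ i)" for i j
    proof -
      have "C $ i $ j = transpose C $ j $ i" "P $ i $ j = transpose P $ j $ i" by (simp_all add: transpose_def)
      then show ?thesis unfolding C P by simp
    qed
    then have "(\<Sum>j\<in>UNIV. \<Sum>i\<in>UNIV. C $ i $ j * P $ i $ j) = (\<Sum>j\<in>UNIV. \<Sum>i\<in>UNIV. - (C $ j $ i * P $ j $ i))"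
      by (intro sum.cong refl)
    also have "\<dots> = - (\<Sum>j\<in>UNIV. \<Sum>i\<in>UNIV. C $ i $ j * P $ i $ j)"
      by (subst sum.swap) (simp add: sum_negf)
    finally show "(\<Sum>j\<in>UNIV. \<Sum>i\<in>UNIV. C $ i $ j * P $ i $ j) = 0" by simp
  qed
qed

text \<open>The adjoint represents the pairing of \<open>T\<close> with Spencer differentials, so it vanishes iff \<open>T\<close> is orthogonal to the image of the Spencer differential, and by testing
  with maps supported on a single basis vector this means that the contraction is orthogonal to all
  skew matrices. The vanishing of the adjoint carries this information only because the
  adjoint exists and is unique, which is proved here as well: \<open>mk b\<close> is the linear map with prescribed values
  \<open>b\<close> on the basis, and the Riesz representatives of the functionals \<open>q x\<close> are the values of the adjoint.\<close>

lemma spencer_adj_zero_iff: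
  assumes ip: "invariant_ip_h ip" and alt: "\<And>x y. x \<in> mbasis \<Longrightarrow> y \<in> mbasis \<Longrightarrow> T y x = - T x y"
  shows "spencer_adj ip T = (\<lambda>_. 0) \<longleftrightarrow> (\<forall>x\<in>mbasis. transpose (contraction T x) = contraction T x)"
proof -
  define q where "q = (\<lambda>x Z. \<Sum>y\<in>mbasis. ip_m (lie Z y) (T x y))"
  have lin_q: "linear (q x)" for x
  proof -
    have "ip_m (X + Y) Z = ip_m X Z + ip_m Y Z" "ip_m (c *\<^sub>R X) Z = c * ip_m X Z" for X Y Z :: "'a mat" and c
      by (simp_all add: ip_m_def m0_def m1_def m2_def inner_vec_def algebra_simps sum.distrib sum_distrib_left)
    then show ?thesis unfolding q_def
      by (intro linearI) (simp_all add: bounded_bilinear.add_left[OF bounded_bilinear_lie]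
          bounded_bilinear.scaleR_left[OF bounded_bilinear_lie] sum.distrib sum_distrib_left)
  qed
  have ell: "ip_alt (spencer A) T = (\<Sum>x\<in>mbasis. q x (A x))" for A
    unfolding q_def by (rule ip_alt_spencer[OF alt])
  have lin: "ip (a *\<^sub>R X + b *\<^sub>R Y) Z = a * ip X Z + b * ip Y Z" if "X \<in> halg" "Y \<in> halg" "Z \<in> halg" for X Y Z a b
    using ip that by (auto simp: invariant_ip_h_def)
  have sym: "ip X Y = ip Y X" if "X \<in> halg" "Y \<in> halg" for X Y using ip that by (auto simp: invariant_ip_h_def)
  have pos: "ip X X > 0" if "X \<in> halg" "X \<noteq> 0" for X using ip that by (auto simp: invariant_ip_h_def)
  have h0: "0 \<in> halg" by (rule subspace_0[OF subspace_halg])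
  have ip0: "ip X 0 = 0" if "X \<in> halg" for X
    using lin[of X X X 0 0] lin[OF h0 h0 that, of 0 0] sym[OF h0 that] that by simp
  have homD: "A X \<in> halg" "X \<notin> mcompl \<Longrightarrow> A X = 0" if "A \<in> hom_mh" for A X
    using that h0 by (auto simp: hom_mh_def)
  have hom_eq: "A X = (\<Sum>x\<in>mbasis. ip_m x X *\<^sub>R A x)" if A: "A \<in> hom_mh" and X: "X \<in> mcompl" for A X
  proof -
    have "A (\<Sum>x\<in>F. c x *\<^sub>R x) = (\<Sum>x\<in>F. c x *\<^sub>R A x)" if "F \<subseteq> mbasis" for F c
      using finite_subset[OF that finite_mbasis] that
    proof (induction F rule: finite_induct)
      case empty
      have "A (0 *\<^sub>R X + 0 *\<^sub>R X) = 0 *\<^sub>R A X + 0 *\<^sub>R A X" using A X unfolding hom_mh_def by blast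
      then show ?case by simp
    next
      case (insert x F)
      have "(\<Sum>x\<in>F. c x *\<^sub>R x) \<in> mcompl" "x \<in> mcompl"
        using insert mbasis_subset by (auto intro!: subspace_sum[OF subspace_mcompl] subspace_scale[OF subspace_mcompl])
      then have "A (c x *\<^sub>R x + 1 *\<^sub>R (\<Sum>x\<in>F. c x *\<^sub>R x)) = c x *\<^sub>R A x + 1 *\<^sub>R A (\<Sum>x\<in>F. c x *\<^sub>R x)"
        using A unfolding hom_mh_def by blast
      then show ?case using insert by simp
    qed
    from this[of mbasis "\<lambda>x. ip_m x X"] show ?thesis using mcompl_expand[OF X] by simp
  qed
  define mk where "mk = (\<lambda>(b :: 'a mat \<Rightarrow> 'a mat) X. if X \<in> mcompl then (\<Sum>x\<in>mbasis. ip_m x X *\<^sub>R b x) else 0)"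
  have mk: "mk b \<in> hom_mh" if "\<And>x. x \<in> mbasis \<Longrightarrow> b x \<in> halg" for b
  proof -
    have "ip_m x (c *\<^sub>R X + d *\<^sub>R Y) = c * ip_m x X + d * ip_m x Y" for x X Y :: "'a mat" and c d
      by (simp add: ip_m_def m0_def m1_def m2_def inner_vec_def algebra_simps sum.distrib sum_distrib_left)
    moreover have "c *\<^sub>R X + d *\<^sub>R Y \<in> mcompl" if "X \<in> mcompl" "Y \<in> mcompl" for X Y :: "'a mat" and c d
      by (intro subspace_add[OF subspace_mcompl] subspace_scale[OF subspace_mcompl] that)
    ultimately show ?thesis
      using that unfolding hom_mh_def mk_def
      by (auto simp: scaleR_add_left sum.distrib scaleR_sum_right intro!: subspace_sum[OF subspace_halg] subspace_scale[OF subspace_halg])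
  qed
  have mk_x: "mk b x = b x" if "x \<in> mbasis" for b x
  proof -
    have "mk b x = (\<Sum>y\<in>mbasis. (if y = x then b y else 0))"
      using that mbasis_subset mbasis_orthonormal by (auto simp: mk_def intro!: sum.cong)
    then show ?thesis using that by (simp add: finite_mbasis)
  qed
  have ex: "\<exists>b\<in>halg. \<forall>Z\<in>halg. q x Z = ip Z b" for x
    by (rule riesz_on_subspace[OF subspace_halg lin sym pos lin_q])
  then obtain b where b: "\<And>x. b x \<in> halg" "\<And>x Z. Z \<in> halg \<Longrightarrow> q x Z = ip Z (b x)" by metis
  have adj: "\<forall>A\<in>hom_mh. ip_alt (spencer A) T = ip_hom ip A (mk b)"
    unfolding ell ip_hom_def by (intro ballI sum.cong refl) (simp add: mk_x b(2)[OF homD(1)])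
  have uniq: "B = mk b" if B: "B \<in> hom_mh" "\<forall>A\<in>hom_mh. ip_alt (spencer A) T = ip_hom ip A B" for B
  proof -
    have "B x = b x" if "x \<in> mbasis" for x
    proof -
      define Z where "Z = B x - b x"
      have Zh: "Z \<in> halg" unfolding Z_def by (rule subspace_diff[OF subspace_halg homD(1)[OF B(1)] b(1)])
      define A where "A = mk (\<lambda>y. if y = x then Z else 0)"
      have A: "A \<in> hom_mh" unfolding A_def by (rule mk) (use Zh h0 in auto)
      have Ay: "A y = (if y = x then Z else 0)" if "y \<in> mbasis" for y using mk_x[OF that] by (simp add: A_def)
      have ip0': "ip 0 Y = 0" if "Y \<in> halg" for Y using ip0[OF that] sym[OF h0 that] by simp
      have ih: "ip_hom ip A D = ip Z (D x)" if "D \<in> hom_mh" for D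
      proof -
        have "ip_hom ip A D = (\<Sum>y\<in>mbasis. if y = x then ip Z (D y) else 0)"
          using Ay ip0'[OF homD(1)[OF that]] by (auto simp: ip_hom_def intro!: sum.cong)
        then show ?thesis using \<open>x \<in> mbasis\<close> by (simp add: finite_mbasis)
      qed
      have "ip_hom ip A B = ip_hom ip A (mk b)" using A adj B(2) by metis
      then have "ip Z (B x) = ip Z (b x)" using ih B(1) mk[of b] b(1) mk_x[OF that] by simp
      moreover have "ip Z Z = ip (B x) Z - ip (b x) Z"
        using lin[OF homD(1)[OF B(1)] b(1) Zh, of 1 x "-1" x] by (simp add: Z_def)
      moreover note sym[OF Zh homD(1)[OF B(1)], of x] sym[OF Zh b(1), of x]
      ultimately have "ip Z Z = 0" by simp
      then have "Z = 0" using pos[OF Zh] by force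
      then show ?thesis by (simp add: Z_def)
    qed
    note Bb = this
    show ?thesis
    proof
      fix X
      show "B X = mk b X"
      proof (cases "X \<in> mcompl")
        case True
        show ?thesis unfolding hom_eq[OF B(1) True] mk_def using True by (simp add: Bb)
      next
        case False
        then show ?thesis using homD(2)[OF B(1) False] by (simp add: mk_def)
      qed
    qed
  qed
  have adj_eq: "spencer_adj ip T = mk b"
    unfolding spencer_adj_def using adj mk[of b] b(1) uniq by (intro the_equality) blast+
  have "mk b = (\<lambda>_. 0) \<longleftrightarrow> (\<forall>x\<in>mbasis. b x = 0)"
  proof
    assume "mk b = (\<lambda>_. 0)"
    then show "\<forall>x\<in>mbasis. b x = 0" using mk_x[of _ b] by metis
  next
    assume "\<forall>x\<in>mbasis. b x = 0"
    then show "mk b = (\<lambda>_. 0)" by (simp add: mk_def fun_eq_iff)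
  qed
  also have "\<dots> \<longleftrightarrow> (\<forall>x\<in>mbasis. \<forall>Z\<in>halg. q x Z = 0)"
    using b ip0 pos by (metis less_irrefl)
  also have "\<dots> \<longleftrightarrow> (\<forall>x\<in>mbasis. \<forall>C. transpose C = - C \<longrightarrow> (\<Sum>j\<in>UNIV. \<Sum>i\<in>UNIV. C $ i $ j * contraction T x $ i $ j) = 0)"
    unfolding q_def halg_emb by (simp add: ip_m_lie_sum)
  finally show ?thesis unfolding adj_eq skew_pairing_zero_iff .
qed

definition alt_bilinear :: "('k::finite mat \<Rightarrow> 'k mat \<Rightarrow> 'k mat) \<Rightarrow> bool" where
  "alt_bilinear T \<longleftrightarrow> (\<forall>X\<in>mcompl. \<forall>Y\<in>mcompl. T X Y \<in> mcompl \<and> T Y X = - T X Y) \<and>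
     (\<forall>X\<in>mcompl. \<forall>Y\<in>mcompl. \<forall>Z\<in>mcompl. \<forall>a b. T X (a *\<^sub>R Y + b *\<^sub>R Z) = a *\<^sub>R T X Y + b *\<^sub>R T X Z)"

text \<open>Linear maps to \<open>halg\<close>, encoded by the nontrivial block of their values. Linearity is required on all
  matrices, which avoids relativizing to \<open>mcompl\<close>.\<close>

definition skew_hom :: "('k::finite mat \<Rightarrow> real^'k^'k) \<Rightarrow> bool" where
  "skew_hom a \<longleftrightarrow> linear a \<and> (\<forall>X. transpose (a X) = - a X)"

text \<open>The Spencer differential of the map encoded by \<open>a\<close>, see \<open>spencer_of_lie\<close>.\<close>

definition spencer_of :: "('k::finite mat \<Rightarrow> real^'k^'k) \<Rightarrow> 'k mat \<Rightarrow> 'k mat \<Rightarrow> 'k mat" where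
  "spencer_of a X Y = mvec 0 (a X *v m1 Y - a Y *v m1 X) (a X *v m2 Y - a Y *v m2 X)"

lemma spencer_of_lie:
  assumes "skew_hom a" "X \<in> mcompl" "Y \<in> mcompl"
  shows "spencer_of a X Y = lie (emb 0 (a X)) Y - lie (emb 0 (a Y)) X"
proof -
  obtain x0 x1 x2 y0 y1 y2 where "X = mvec x0 x1 x2" "Y = mvec y0 y1 y2" using assms by (auto simp: mcompl_def)
  then show ?thesis using assms(1) by (simp add: spencer_of_def lie_emb_mvec skew_hom_def mvec_lin)
qed

lemma skew_entries: "transpose C = - C \<Longrightarrow> C $ i $ j = - C $ j $ i" for C :: "real^'n^'n"
  unfolding skew_iff by (simp add: eq_neg_iff_add_eq_0)

lemma contraction_spencer_of: "contraction (spencer_of a) X $ i $ j = 2 * a X $ i $ j - (a (ev (axis j 1)) *v m1 X) $ i - (a (bv (axis j 1)) *v m2 X) $ i"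
  by (simp add: contraction_def spencer_of_def matrix_vector_mult_basis column_def)

lemma m_coords_lin: "m0 (X + Y) = m0 X + m0 Y" "m1 (X + Y) = m1 X + m1 Y" "m2 (X + Y) = m2 X + m2 Y"
  "m0 (c *\<^sub>R X) = c * m0 X" "m1 (c *\<^sub>R X) = c *\<^sub>R m1 X" "m2 (c *\<^sub>R X) = c *\<^sub>R m2 X"
  by (simp_all add: m0_def m1_def m2_def vec_eq_iff)

lemma contraction_add: "contraction (\<lambda>X Y. T X Y + S X Y) X = contraction T X + contraction S X"
  by (simp add: contraction_def vec_eq_iff m_coords_lin)

text \<open>On \<open>e0\<close> the contraction of the Spencer differential is \<open>2 a(e0)\<close>, which is both skew and symmetric.
  On the basis vectors of each copy of R^(n-1) symmetry reads \<open>(4 + C + C^2) a = 0\<close> with the cyclic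
  permutation \<open>C\<close> of the three indices, and this operator is injective.\<close>

lemma spencer_of_symmetric_zero:
  assumes a: "skew_hom a" and sym: "\<And>x. x \<in> mbasis \<Longrightarrow> transpose (contraction (spencer_of a) x) = contraction (spencer_of a) x"
    and X: "X \<in> mcompl"
  shows "a X = 0"
proof -
  have sk: "a X $ i $ j = - a X $ j $ i" for X i j using a skew_entries unfolding skew_hom_def by blast
  have sy: "contraction (spencer_of a) x $ i $ j = contraction (spencer_of a) x $ j $ i" if "x \<in> mbasis" for x i j
  proof -
    have "contraction (spencer_of a) x $ i $ j = transpose (contraction (spencer_of a) x) $ j $ i" by (simp add: transpose_def)
    then show ?thesis by (simp only: sym[OF that])
  qed
  have skew3_zero: "f i j = 0"
    if skew: "\<And>k i j. f' k i j = - f' k j i" and eq: "\<And>k i j. 2 * f' k i j - f' j i k = 2 * f' k j i - f' i j k" and f: "f = f' k"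
    for f :: "'a \<Rightarrow> 'a \<Rightarrow> real" and f' k i j
    \<comment> \<open>Adding the equations for the three cyclic permutations gives that the cyclic sum vanishes; the first
    one then says \<open>3 f = 0\<close>.\<close>
    using eq[of k i j] eq[of i j k] eq[of j k i] skew[of k i j] skew[of k j i] skew[of i j k] skew[of i k j] skew[of j k i] skew[of j i k]
    unfolding f by linarith
  have "a x = 0" if x: "x \<in> mbasis" for x
  proof -
    from x consider "x = e0" | k where "x = ev (axis k 1)" | k where "x = bv (axis k 1)" by (auto simp: mbasis_def)
    then have "a x $ i $ j = 0" for i j
    proof cases
      case 1
      then show ?thesis using sy[OF x, of i j] sk[of x i j] by (simp add: contraction_spencer_of)
    next
      case 2
      show ?thesis
      proof (rule skew3_zero[where f'="\<lambda>k i j. a (ev (axis k 1)) $ i $ j" and k=k])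
        show "2 * a (ev (axis k 1)) $ i $ j - a (ev (axis j 1)) $ i $ k = 2 * a (ev (axis k 1)) $ j $ i - a (ev (axis i 1)) $ j $ k" for k i j
          using sy[of "ev (axis k 1)" i j] by (simp add: mbasis_def contraction_spencer_of matrix_vector_mult_basis column_def)
      qed (auto simp: 2 intro: sk)
    next
      case 3
      show ?thesis
      proof (rule skew3_zero[where f'="\<lambda>k i j. a (bv (axis k 1)) $ i $ j" and k=k])
        show "2 * a (bv (axis k 1)) $ i $ j - a (bv (axis j 1)) $ i $ k = 2 * a (bv (axis k 1)) $ j $ i - a (bv (axis i 1)) $ j $ k" for k i j
          using sy[of "bv (axis k 1)" i j] by (simp add: mbasis_def contraction_spencer_of matrix_vector_mult_basis column_def)
      qed (auto simp: 3 intro: sk)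
    qed
    then show ?thesis by (simp add: vec_eq_iff)
  qed
  moreover have "a X = (\<Sum>x\<in>mbasis. ip_m x X *\<^sub>R a x)"
    using a by (subst mcompl_expand[OF X]) (simp add: skew_hom_def linear_sum linear_cmul)
  ultimately show ?thesis by simp
qed

text \<open>The solution of \<open>(4 + C + C^2) a = - t\<close>, where \<open>t k\<close> is twice the skew part of \<open>P k\<close>: the inverse of
  \<open>4 + C + C^2\<close> is \<open>1/3 - (1 + C + C^2)/18\<close>, since the operator is 3 on the arrays with vanishing cyclic sum
  and 6 on the invariant ones.\<close>

definition cyclic_solve :: "('k \<Rightarrow> real^'k^'k) \<Rightarrow> 'k \<Rightarrow> real^'k^'k" where
  "cyclic_solve P k = (\<chi> i j. (let t = (\<lambda>k i j. P k $ i $ j - P k $ j $ i) in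
      - t k i j / 3 + (t k i j + t i j k + t j k i) / 18))"

text \<open>The element to be added to a connection with torsion \<open>T\<close> to make it normal. On \<open>e0\<close> the
  equation is \<open>4 a(e0) = - t\<close>, with \<open>t\<close> twice the skew part of the contraction.\<close>

definition correction :: "('k::finite mat \<Rightarrow> 'k mat \<Rightarrow> 'k mat) \<Rightarrow> 'k mat \<Rightarrow> real^'k^'k" where
  "correction T X = m0 X *\<^sub>R (- (1/4) *\<^sub>R (contraction T e0 - transpose (contraction T e0)))
     + (\<Sum>k\<in>UNIV. m1 X $ k *\<^sub>R cyclic_solve (\<lambda>k. contraction T (ev (axis k 1))) k)
     + (\<Sum>k\<in>UNIV. m2 X $ k *\<^sub>R cyclic_solve (\<lambda>k. contraction T (bv (axis k 1))) k)"

lemma cyclic_solve_skew: "transpose (cyclic_solve P k) = - cyclic_solve P k"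
  by (simp add: skew_iff cyclic_solve_def Let_def field_simps)

lemma skew_hom_correction: "skew_hom (correction T)"
  unfolding skew_hom_def
proof (intro conjI allI)
  have "linear (\<lambda>X. m0 X *\<^sub>R C + (\<Sum>k\<in>UNIV. m1 X $ k *\<^sub>R D k) + (\<Sum>k\<in>UNIV. m2 X $ k *\<^sub>R E k))"
    for C :: "real^'a^'a" and D E
    by (rule linearI) (simp_all add: m_coords_lin scaleR_add_left sum.distrib scaleR_sum_right scaleR_add_right)
  then show "linear (correction T)" unfolding correction_def .
  have s: "transpose (\<Sum>k\<in>F. C k) = - (\<Sum>k\<in>F. C k)" if "\<And>k. transpose (C k) = - C k" for F :: "'a set" and C :: "'a \<Rightarrow> real^'a^'a"
    using that by (simp add: linear_sum[OF linear_transpose] sum_negf)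
  have "transpose (P - transpose P) = - (P - transpose P)" for P :: "real^'a^'a"
    by (simp add: transpose_def vec_eq_iff)
  then show "transpose (correction T X) = - correction T X" for X
    unfolding correction_def by (intro skew_lin s cyclic_solve_skew)
qed

lemma correction_basis:
  "correction T e0 = - (1/4) *\<^sub>R (contraction T e0 - transpose (contraction T e0))"
  "correction T (ev (axis k 1)) = cyclic_solve (\<lambda>k. contraction T (ev (axis k 1))) k"
  "correction T (bv (axis k 1)) = cyclic_solve (\<lambda>k. contraction T (bv (axis k 1))) k"
proof -
  have "(\<Sum>l\<in>UNIV. axis k (1::real) $ l *\<^sub>R C l) = C k" for C :: "'a \<Rightarrow> real^'a^'a"
    by (simp add: axis_def if_distrib[of "\<lambda>z. z *\<^sub>R _"] cong: if_cong)
  then show "correction T e0 = - (1/4) *\<^sub>R (contraction T e0 - transpose (contraction T e0))"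
    "correction T (ev (axis k 1)) = cyclic_solve (\<lambda>k. contraction T (ev (axis k 1))) k"
    "correction T (bv (axis k 1)) = cyclic_solve (\<lambda>k. contraction T (bv (axis k 1))) k"
    by (simp_all add: correction_def)
qed

lemma correction_symmetric:
  assumes "x \<in> mbasis"
  shows "transpose (contraction (\<lambda>X Y. T X Y + spencer_of (correction T) X Y) x) = contraction (\<lambda>X Y. T X Y + spencer_of (correction T) X Y) x"
proof -
  have c: "P k $ j $ i + 2 * cyclic_solve P k $ j $ i - cyclic_solve P i $ j $ k = P k $ i $ j + 2 * cyclic_solve P k $ i $ j - cyclic_solve P j $ i $ k"
    for P :: "'a \<Rightarrow> real^'a^'a" and i j k
    by (simp add: cyclic_solve_def Let_def field_simps)
  from assms consider "x = e0" | k where "x = ev (axis k 1)" | k where "x = bv (axis k 1)" by (auto simp: mbasis_def)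
  then have "contraction (\<lambda>X Y. T X Y + spencer_of (correction T) X Y) x $ j $ i = contraction (\<lambda>X Y. T X Y + spencer_of (correction T) X Y) x $ i $ j" for i j
  proof cases
    case 1
    then show ?thesis by (simp add: contraction_add contraction_spencer_of correction_basis transpose_def field_simps)
  next
    case 2
    then show ?thesis using c[of "\<lambda>k. contraction T (ev (axis k 1))" k j i]
      by (simp add: contraction_add contraction_spencer_of correction_basis matrix_vector_mult_basis column_def)
  next
    case 3
    then show ?thesis using c[of "\<lambda>k. contraction T (bv (axis k 1))" k j i]
      by (simp add: contraction_add contraction_spencer_of correction_basis matrix_vector_mult_basis column_def)
  qed
  then show ?thesis by (intro vec_eq_iff[THEN iffD2] allI) (simp add: transpose_def)
qed

lemma contraction_mult:
  assumes T: "alt_bilinear T" and X: "X \<in> mcompl"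
  shows "contraction T X *v v = m1 (T X (ev v)) + m2 (T X (bv v))"
proof -
  have l: "linear (\<lambda>v. m1 (T X (ev v)) + m2 (T X (bv v)))"
  proof (rule linearI)
    have T': "T X (a *\<^sub>R Y + b *\<^sub>R Z) = a *\<^sub>R T X Y + b *\<^sub>R T X Z" if "Y \<in> mcompl" "Z \<in> mcompl" for Y Z a b
      using T X that unfolding alt_bilinear_def by blast
    fix v w :: "real^'a" and c :: real
    show "m1 (T X (ev (v + w))) + m2 (T X (bv (v + w))) = m1 (T X (ev v)) + m2 (T X (bv v)) + (m1 (T X (ev w)) + m2 (T X (bv w)))"
      using T'[of "ev v" "ev w" 1 1] T'[of "bv v" "bv w" 1 1] by (simp add: mvec_lin m_coords_lin)
    show "m1 (T X (ev (c *\<^sub>R v))) + m2 (T X (bv (c *\<^sub>R v))) = c *\<^sub>R (m1 (T X (ev v)) + m2 (T X (bv v)))"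
      using T'[of "ev v" "ev v" c 0] T'[of "bv v" "bv v" c 0] by (simp add: mvec_lin m_coords_lin scaleR_add_right)
  qed
  have m: "matrix (\<lambda>v. m1 (T X (ev v)) + m2 (T X (bv v))) = contraction T X"
    by (simp add: matrix_def contraction_def vec_eq_iff)
  show ?thesis
    using fun_cong[OF matrix_vector_mul(2)[OF l], of v] unfolding m .
qed

text \<open>The contraction is linear in \<open>X\<close> because \<open>T\<close> is alternating and linear in its second argument. So
  the normality condition, tested on the basis, holds on all of \<open>mcompl\<close>, in particular on the images of
  basis vectors under \<open>Ad\<close>.\<close>

lemma contraction_symmetric_from_basis:
  assumes T: "alt_bilinear T" and sym: "\<And>x. x \<in> mbasis \<Longrightarrow> transpose (contraction T x) = contraction T x" and X: "X \<in> mcompl"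
  shows "transpose (contraction T X) = contraction T X"
proof -
  have T1: "T (a *\<^sub>R X + b *\<^sub>R Y) Z = a *\<^sub>R T X Z + b *\<^sub>R T Y Z" if "X \<in> mcompl" "Y \<in> mcompl" "Z \<in> mcompl" for X Y Z a b
  proof -
    have in_m: "a *\<^sub>R X + b *\<^sub>R Y \<in> mcompl"
      by (intro subspace_add[OF subspace_mcompl] subspace_scale[OF subspace_mcompl] that)
    have alt: "T U Z = - T Z U" if "U \<in> mcompl" for U
      using T that \<open>Z \<in> mcompl\<close> unfolding alt_bilinear_def by (metis minus_minus)
    have "T Z (a *\<^sub>R X + b *\<^sub>R Y) = a *\<^sub>R T Z X + b *\<^sub>R T Z Y"
      using T that unfolding alt_bilinear_def by blast
    then show ?thesis unfolding alt[OF in_m] alt[OF that(1)] alt[OF that(2)] by simp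
  qed
  have p: "contraction T (a *\<^sub>R X + b *\<^sub>R Y) = a *\<^sub>R contraction T X + b *\<^sub>R contraction T Y" if "X \<in> mcompl" "Y \<in> mcompl" for X Y a b
    by (simp add: contraction_def vec_eq_iff T1[OF that] m_coords_lin algebra_simps)
  have "transpose (contraction T (\<Sum>x\<in>F. c x *\<^sub>R x)) = contraction T (\<Sum>x\<in>F. c x *\<^sub>R x)" if "F \<subseteq> mbasis" for F c
    using finite_subset[OF that finite_mbasis] that
  proof (induction F rule: finite_induct)
    case empty
    have "0 \<in> mcompl" by (rule subspace_0[OF subspace_mcompl])
    from p[OF this this, of 0 0] show ?case by (simp add: transpose_def vec_eq_iff)
  next
    case (insert x F)
    have "(\<Sum>x\<in>F. c x *\<^sub>R x) \<in> mcompl" "x \<in> mcompl"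
      using insert mbasis_subset by (auto intro!: subspace_sum[OF subspace_mcompl] subspace_scale[OF subspace_mcompl])
    from p[OF this(2,1), of "c x" 1] insert sym[of x] show ?case
      by (simp add: linear_add[OF linear_transpose]
          linear_cmul[OF linear_transpose])
  qed
  from this[of mbasis "\<lambda>x. ip_m x X"] show ?thesis using mcompl_expand[OF X] by simp
qed

lemma alt_bilinear_add_spencer_of:
  assumes T: "alt_bilinear T" and a: "skew_hom a"
  shows "alt_bilinear (\<lambda>X Y. T X Y + spencer_of a X Y)"
proof -
  have la: "a (X + Y) = a X + a Y" "a (c *\<^sub>R X) = c *\<^sub>R a X" for X Y c
    using a by (simp_all add: skew_hom_def linear_add linear_cmul)
  have 1: "spencer_of a X (c *\<^sub>R Y + d *\<^sub>R Z) = c *\<^sub>R spencer_of a X Y + d *\<^sub>R spencer_of a X Z" for X Y Z c d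
    by (simp add: spencer_of_def m_coords_lin la mvec_lin matrix_vector_right_distrib matrix_vector_mult_add_rdistrib
        matrix_vector_mult_scaleR scaleR_matrix_vector_assoc[symmetric])
      (simp add: algebra_simps)
  have 2: "spencer_of a Y X = - spencer_of a X Y" for X Y
    by (simp add: spencer_of_def vec_eq_iff mvec_nth split: option.splits)
  have 3: "spencer_of a X Y \<in> mcompl" for X Y by (simp add: spencer_of_def)
  show ?thesis
    unfolding alt_bilinear_def
  proof (intro conjI ballI allI)
    fix X Y :: "'a mat" assume XY: "X \<in> mcompl" "Y \<in> mcompl"
    show "T X Y + spencer_of a X Y \<in> mcompl"
      using T XY 3 unfolding alt_bilinear_def by (blast intro: subspace_add[OF subspace_mcompl])
    have "T Y X = - T X Y" using T XY unfolding alt_bilinear_def by blast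
    then show "T Y X + spencer_of a Y X = - (T X Y + spencer_of a X Y)" unfolding 2[of Y X] by simp
    fix Z :: "'a mat" and c d :: real assume "Z \<in> mcompl"
    then have "T X (c *\<^sub>R Y + d *\<^sub>R Z) = c *\<^sub>R T X Y + d *\<^sub>R T X Z"
      using T XY unfolding alt_bilinear_def by blast
    then show "T X (c *\<^sub>R Y + d *\<^sub>R Z) + spencer_of a X (c *\<^sub>R Y + d *\<^sub>R Z) = c *\<^sub>R (T X Y + spencer_of a X Y) + d *\<^sub>R (T X Z + spencer_of a X Z)"
      by (simp add: 1 scaleR_add_right)
  qed
qed

text \<open>Both sides solve the normality equation for \<open>T'\<close>: the contraction of the transformed tensor is
  the conjugate by \<open>g\<close> of the original one, and conjugation by an orthogonal matrix preserves symmetry. So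
  uniqueness of the solution gives equality.\<close>

lemma correction_equivariant:
  assumes T: "alt_bilinear T" and T': "alt_bilinear T'" and g: "orthogonal_matrix g"
    and eq: "\<And>X Y. X \<in> mcompl \<Longrightarrow> Y \<in> mcompl \<Longrightarrow>
      T' X Y = Ad (matrix_inv (emb 1 g)) (T (Ad (emb 1 g) X) (Ad (emb 1 g) Y))"
    and X: "X \<in> mcompl"
  shows "correction T' X = transpose g ** correction T (Ad (emb 1 g) X) ** g"
proof -
  let ?h = "Ad (emb 1 g)"
  have gT: "orthogonal_matrix (transpose g)" using g by (simp add: orthogonal_matrix_transpose)
  have gg: "g ** transpose g = mat 1" "transpose g ** g = mat 1" using g by (simp_all add: orthogonal_matrix_def)
  define a where "a = (\<lambda>X. transpose g ** correction T (?h X) ** g)"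
  have lh: "linear ?h" by (rule linear_Ad)
  have lc: "linear (correction T)" using skew_hom_correction[of T] by (simp add: skew_hom_def)
  have a: "skew_hom a"
    unfolding skew_hom_def
  proof (intro conjI allI)
    show "linear a" unfolding a_def
      by (rule linearI) (simp_all add: linear_add[OF lh] linear_cmul[OF lh] linear_add[OF lc] linear_cmul[OF lc]
          matrix_mult_add_left matrix_mult_add_right
          matrix_mult_scaleR_left matrix_mult_scaleR_right)
    show "transpose (a X) = - a X" for X
      using skew_conj[of "correction T (?h X)" "transpose g"] skew_hom_correction[of T] by (simp add: a_def skew_hom_def transpose_transpose)
  qed
  let ?S = "\<lambda>X Y. T X Y + spencer_of (correction T) X Y" and ?S' = "\<lambda>X Y. T' X Y + spencer_of a X Y"
  have S: "alt_bilinear ?S" by (rule alt_bilinear_add_spencer_of[OF T skew_hom_correction])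
  have S': "alt_bilinear ?S'" by (rule alt_bilinear_add_spencer_of[OF T' a])
  have Ainv: "Ad (matrix_inv (emb 1 g)) (mvec v0 v w) = mvec v0 (transpose g *v v) (transpose g *v w)" for v0 v w
    using Ad_emb_mvec[OF gT] by (simp add: matrix_inv_emb[OF g])
  have S'_eq: "?S' X Y = Ad (matrix_inv (emb 1 g)) (?S (?h X) (?h Y))" if "X \<in> mcompl" "Y \<in> mcompl" for X Y
  proof -
    obtain x0 x1 x2 y0 y1 y2 where XY: "X = mvec x0 x1 x2" "Y = mvec y0 y1 y2"
      using \<open>X \<in> mcompl\<close> \<open>Y \<in> mcompl\<close> by (auto simp: mcompl_def)
    have "spencer_of a X Y = Ad (matrix_inv (emb 1 g)) (spencer_of (correction T) (?h X) (?h Y))"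
      unfolding XY Ad_emb_mvec[OF g] spencer_of_def mvec_coords Ainv a_def
      by (simp add: matrix_vector_mul_assoc[symmetric] matrix_vector_mult_diff_distrib)
    then show ?thesis
      by (simp add: eq[OF that] linear_add[OF linear_Ad])
  qed
  have "transpose (contraction ?S' x) = contraction ?S' x" if x: "x \<in> mcompl" for x
  proof -
    have hx: "?h x \<in> mcompl" using Ad_mcompl[of "emb 1 g" x] x g by (simp add: Hgrp_emb)
    have "contraction ?S' x *v v = (transpose g ** contraction ?S (?h x) ** g) *v v" for v
    proof -
      have m: "m1 (Ad (matrix_inv (emb 1 g)) Z) = transpose g *v m1 Z" "m2 (Ad (matrix_inv (emb 1 g)) Z) = transpose g *v m2 Z"
        if "Z \<in> mcompl" for Z using that by (auto simp: mcompl_def Ainv)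
      have Sm: "?S (?h x) Y \<in> mcompl" if "Y \<in> mcompl" for Y using S hx that unfolding alt_bilinear_def by blast
      have "contraction ?S' x *v v = m1 (?S' x (ev v)) + m2 (?S' x (bv v))" by (rule contraction_mult[OF S' x])
      also have "\<dots> = transpose g *v (m1 (?S (?h x) (ev (g *v v))) + m2 (?S (?h x) (bv (g *v v))))"
        by (simp only: S'_eq[OF x mvec_in_mcompl] Ad_emb_mvec[OF g] matrix_vector_mult_0_right m[OF Sm[OF mvec_in_mcompl]]
            matrix_vector_right_distrib)
      also have "\<dots> = transpose g *v (contraction ?S (?h x) *v (g *v v))" by (simp only: contraction_mult[OF S hx])
      finally show ?thesis by (simp add: matrix_vector_mul_assoc matrix_mul_assoc)
    qed
    then have e: "contraction ?S' x = transpose g ** contraction ?S (?h x) ** g" by (simp add: matrix_eq)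
    have "transpose (contraction ?S (?h x)) = contraction ?S (?h x)"
      by (rule contraction_symmetric_from_basis[OF S correction_symmetric hx])
    then show ?thesis unfolding e by (simp add: matrix_transpose_mul transpose_transpose matrix_mul_assoc)
  qed
  then have sym1: "transpose (contraction ?S' x) = contraction ?S' x" if "x \<in> mbasis" for x using that mbasis_subset by blast
  define d where "d = (\<lambda>X. correction T' X - a X)"
  have d: "skew_hom d"
    using a skew_hom_correction[of T'] unfolding d_def skew_hom_def
    by (auto intro!: linear_compose_sub simp: linear_diff[OF linear_transpose])
  have "d X = 0"
  proof (rule spencer_of_symmetric_zero[OF d _ X])
    fix x :: "'a mat" assume x: "x \<in> mbasis"
    have "contraction (spencer_of d) x = contraction (\<lambda>X Y. T' X Y + spencer_of (correction T') X Y) x - contraction ?S' x"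
      by (simp add: contraction_add vec_eq_iff contraction_spencer_of d_def matrix_vector_mult_diff_rdistrib)
    then show "transpose (contraction (spencer_of d) x) = contraction (spencer_of d) x"
      by (simp add: linear_diff[OF linear_transpose] sym1[OF x] correction_symmetric[OF x])
  qed
  then show ?thesis by (simp add: d_def a_def)
qed

text \<open>The entries of the correction are polynomials in the entries of \<open>T\<close> and of its argument.\<close>

lemma Ck_on_emb_correction:
  fixes T :: "'a::real_normed_vector \<Rightarrow> 'k::finite mat \<Rightarrow> 'k mat \<Rightarrow> 'k mat"
  assumes W: "open W" and T: "\<And>X Y. X \<in> mcompl \<Longrightarrow> Y \<in> mcompl \<Longrightarrow> Ck_on k W (\<lambda>x. T x X Y)"
    and Z: "Ck_on k W Z"
  shows "Ck_on k W (\<lambda>x. emb 0 (correction (T x) (Z x)))"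
proof -
  note [intro] = W
  have P: "Ck_on k W (\<lambda>x. contraction (T x) X $ i $ j)" if "X \<in> mcompl" for X i j
    unfolding contraction_def m1_def m2_def vec_lambda_beta
    by (intro Ck_on_add Ck_on_vec_nth T W that mvec_in_mcompl)
  have cycP: "Ck_on k W (\<lambda>x. cyclic_solve (\<lambda>k. contraction (T x) (f k)) l $ i $ j)" if "\<And>k. f k \<in> mcompl" for f :: "'k \<Rightarrow> 'k mat" and l i j
    unfolding cyclic_solve_def Let_def vec_lambda_beta
    by (intro Ck_on_add Ck_on_diff Ck_on_divide Ck_on_minus P that W)
  have c: "Ck_on k W (\<lambda>x. correction (T x) (Z x) $ i $ j)" for i j
    unfolding correction_def m0_def m1_def m2_def vec_lambda_beta vector_add_component vector_scaleR_component sum_component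
      vector_minus_component transpose_def real_scaleR_def
    by (intro Ck_on_add Ck_on_sum Ck_on_mult Ck_on_diff Ck_on_const Ck_on_vec_nth Z P cycP W mvec_in_mcompl)
  show ?thesis
  proof (intro Ck_on_vec[OF W])
    fix i j
    show "Ck_on k W (\<lambda>x. emb 0 (correction (T x) (Z x)) $ i $ j)"
      by (cases i; cases j; cases "the i"; cases "the j") (auto simp: emb_nth intro: c Ck_on_const)
  qed
qed

section \<open>Change of torsion and uniqueness\<close>

context smooth_action
begin

lemma cartan_facts:
  assumes "cartan_connection A r \<omega>"
  shows cartan_form: "one_form A euc \<omega>" and cartan_bij: "bij_betw (\<omega> u) (tangent_space A u) euc"
    and cartan_equivariant: "equivariant_form A r \<omega>"
    and cartan_fundamental: "X \<in> halg \<Longrightarrow> \<omega> u (fundamental_field A r X u) = X"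
  using assms by (auto simp: cartan_connection_def)

lemma const_field:
  assumes "cartan_connection A r \<omega>" "X \<in> euc"
  shows const_field_in: "const_field A \<omega> X u \<in> tangent_space A u" and cartan_const_field: "\<omega> u (const_field A \<omega> X u) = X"
proof -
  have "X \<in> \<omega> u ` tangent_space A u" using cartan_bij[OF assms(1), of u] assms(2) by (simp add: bij_betw_def)
  then show "const_field A \<omega> X u \<in> tangent_space A u" "\<omega> u (const_field A \<omega> X u) = X"
    by (simp_all add: const_field_def inv_into_into f_inv_into_f)
qed

lemma cartan_inj:
  assumes "cartan_connection A r \<omega>" "\<xi> \<in> tangent_space A u" "\<eta> \<in> tangent_space A u" "\<omega> u \<xi> = \<omega> u \<eta>"
  shows "\<xi> = \<eta>"
  using cartan_bij[OF assms(1), of u] assms(2-4) by (simp add: bij_betw_def inj_on_def)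

lemma const_fieldI:
  assumes "cartan_connection A r \<omega>" "\<xi> \<in> tangent_space A u"
  shows "const_field A \<omega> (\<omega> u \<xi>) u = \<xi>"
  using cartan_bij[OF assms(1), of u] assms(2) by (simp add: bij_betw_def const_field_def)

lemma const_field_linear:
  assumes \<omega>: "cartan_connection A r \<omega>" and X: "X \<in> euc" and Y: "Y \<in> euc"
  shows "const_field A \<omega> (a *\<^sub>R X + b *\<^sub>R Y) u = (\<lambda>c. a *\<^sub>R const_field A \<omega> X u c + b *\<^sub>R const_field A \<omega> Y u c)"
  using one_form_lin[OF cartan_form[OF \<omega>] const_field_in[OF \<omega> X, of u] const_field_in[OF \<omega> Y, of u], of a b]
    const_fieldI[OF \<omega>] cartan_const_field[OF \<omega> X, of u] cartan_const_field[OF \<omega> Y, of u] by metis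

lemma m_part_form:
  assumes "cartan_connection A r \<omega>"
  shows "one_form A mcompl (m_part \<omega>)"
  unfolding m_part_def
  by (rule one_form_compose(1)[OF cartan_form[OF assms] bounded_linear_pr_m]) (auto simp: pr_m_in_mcompl)

text \<open>The decomposition of \<open>euc\<close> into \<open>halg\<close> and \<open>mcompl\<close> is invariant under \<open>Ad\<close>, so \<open>pr_m\<close> commutes with it.\<close>

lemma m_part_equivariant:
  assumes "cartan_connection A r \<omega>"
  shows "equivariant_form A r (m_part \<omega>)"
  unfolding equivariant_form_def m_part_def
proof (intro ballI allI)
  fix h :: "'k mat" and u \<xi> assume h: "h \<in> Hgrp" and \<xi>: "\<xi> \<in> tangent_space A u"
  show "pr_m (\<omega> (r u h) (tangent_map A A (\<lambda>u'. r u' h) u \<xi>)) = Ad (matrix_inv h) (pr_m (\<omega> u \<xi>))"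
    using cartan_equivariant[OF assms] h \<xi> pr_m_Ad(1)[OF Hgrp_inv[OF h] one_form_in[OF cartan_form[OF assms] \<xi>]]
    by (simp add: equivariant_form_def)
qed

lemma m_part_fundamental:
  assumes "cartan_connection A r \<omega>" "X \<in> halg"
  shows "m_part \<omega> u (fundamental_field A r X u) = 0"
  by (simp add: m_part_def cartan_fundamental[OF assms] pr_m_halg[OF assms(2)])

lemma m_part_const_field:
  assumes "cartan_connection A r \<omega>" "X \<in> mcompl"
  shows "m_part \<omega> u (const_field A \<omega> X u) = X"
  using assms mcompl_subset_euc by (auto simp: m_part_def cartan_const_field pr_m_mcompl subset_iff)

lemma fundamental_in:
  assumes "cartan_connection A r \<omega>" "X \<in> halg"
  shows "fundamental_field A r X u \<in> tangent_space A u"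
  using fundamental_field_tangent[OF m_part_form[OF assms(1)] m_part_equivariant[OF assms(1)]
     m_part_fundamental[OF assms] assms(2) one_form_zero(1)[OF m_part_form[OF assms(1)]]] .

lemma ext_deriv_m_part_fundamental:
  assumes "cartan_connection A r \<omega>" "X \<in> halg" "\<eta> \<in> tangent_space A u"
  shows "ext_deriv A (m_part \<omega>) u (fundamental_field A r X u) \<eta> = - lie X (m_part \<omega> u \<eta>)"
  using ext_deriv_fundamental_field(1)[OF m_part_form[OF assms(1)] m_part_equivariant[OF assms(1)]
     m_part_fundamental[OF assms(1,2)] assms(2,3)] .

text \<open>Apart from the constant fields, on which it is evaluated, the torsion depends on the \<open>mcompl\<close>-part of the
  connection only.\<close>

lemma torsion_eq:
  assumes \<omega>: "cartan_connection A r \<omega>" and X: "X \<in> mcompl" and Y: "Y \<in> mcompl"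
  shows "torsion A \<omega> u X Y = ext_deriv A (m_part \<omega>) u (const_field A \<omega> X u) (const_field A \<omega> Y u) + pr_m (lie X Y)"
proof -
  have "X \<in> euc" "Y \<in> euc" using X Y mcompl_subset_euc by auto
  then show ?thesis
    unfolding torsion_def cartan_curvature_def m_part_def
    by (simp add: ext_deriv_compose[OF cartan_form[OF \<omega>] bounded_linear_pr_m]
        linear_add[OF linear_pr_m] cartan_const_field[OF \<omega>])
qed

lemma alt_bilinear_torsion:
  assumes \<omega>: "cartan_connection A r \<omega>"
  shows "alt_bilinear (torsion A \<omega> u)"
  unfolding alt_bilinear_def
proof (intro conjI ballI allI)
  fix X Y :: "'k mat" assume X: "X \<in> mcompl" and Y: "Y \<in> mcompl"
  show "torsion A \<omega> u X Y \<in> mcompl" by (simp add: torsion_def pr_m_in_mcompl)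
  have "lie Y X = - lie X Y" by (simp add: lie_def)
  then show "torsion A \<omega> u Y X = - torsion A \<omega> u X Y"
    by (simp add: torsion_eq[OF \<omega>] X Y ext_deriv_alternating[of _ _ "const_field A \<omega> Y u"]
        linear_neg[OF linear_pr_m])
  fix Z :: "'k mat" and a b :: real assume Z: "Z \<in> mcompl"
  have YZ: "a *\<^sub>R Y + b *\<^sub>R Z \<in> mcompl"
    by (intro subspace_add[OF subspace_mcompl] subspace_scale[OF subspace_mcompl] Y Z)
  have "Y \<in> euc" "Z \<in> euc" using Y Z mcompl_subset_euc by auto
  then show "torsion A \<omega> u X (a *\<^sub>R Y + b *\<^sub>R Z) = a *\<^sub>R torsion A \<omega> u X Y + b *\<^sub>R torsion A \<omega> u X Z"
    unfolding torsion_eq[OF \<omega> X Y] torsion_eq[OF \<omega> X Z] torsion_eq[OF \<omega> X YZ]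
    by (simp add: const_field_linear[OF \<omega>] ext_deriv_linear[OF m_part_form[OF \<omega>]]
       bounded_bilinear.add_right[OF bounded_bilinear_lie] bounded_bilinear.scaleR_right[OF bounded_bilinear_lie]
       linear_add[OF linear_pr_m] linear_cmul[OF linear_pr_m]
       scaleR_add_right)
qed

lemma normal_iff:
  assumes "cartan_connection A r \<omega>" "invariant_ip_h ip"
  shows "normal_connection ip A \<omega> \<longleftrightarrow> (\<forall>u. \<forall>x\<in>mbasis. transpose (contraction (torsion A \<omega> u) x) = contraction (torsion A \<omega> u) x)"
proof -
  have "torsion A \<omega> u y x = - torsion A \<omega> u x y" if "x \<in> mbasis" "y \<in> mbasis" for u x y
    using alt_bilinear_torsion[OF assms(1), of u] that mbasis_subset unfolding alt_bilinear_def by blast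
  then show ?thesis
    unfolding normal_connection_def using spencer_adj_zero_iff[OF assms(2)] by blast
qed

text \<open>The lower right block of \<open>\<omega>1 - \<omega>2\<close> as a function of the \<open>mcompl\<close>-part of the tangent vector. Inserting
  \<open>pr_m\<close> makes it linear on the space of all matrices.\<close>

definition connection_difference :: "('p \<Rightarrow> ('p, 'e) tvec \<Rightarrow> 'k mat) \<Rightarrow> ('p \<Rightarrow> ('p, 'e) tvec \<Rightarrow> 'k mat) \<Rightarrow> 'p \<Rightarrow> 'k mat \<Rightarrow> real^'k^'k" where
  "connection_difference \<omega>1 \<omega>2 u X = (\<chi> i j. (\<omega>1 u (const_field A \<omega>2 (pr_m X) u) - pr_m X) $ Some (Some i) $ Some (Some j))"

lemma connection_difference:
  assumes 1: "cartan_connection A r \<omega>1" and 2: "cartan_connection A r \<omega>2" and m: "m_part \<omega>1 = m_part \<omega>2"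
  shows skew_hom_connection_difference: "skew_hom (connection_difference \<omega>1 \<omega>2 u)"
    and emb_connection_difference: "X \<in> mcompl \<Longrightarrow> \<omega>1 u (const_field A \<omega>2 X u) = X + emb 0 (connection_difference \<omega>1 \<omega>2 u X)"
proof -
  have E: "\<exists>C. transpose C = - C \<and> \<omega>1 u (const_field A \<omega>2 X u) = X + emb 0 C" if X: "X \<in> mcompl" for X
  proof -
    have Xe: "X \<in> euc" using X mcompl_subset_euc by blast
    let ?Z = "\<omega>1 u (const_field A \<omega>2 X u)"
    have "?Z \<in> euc" by (rule one_form_in[OF cartan_form[OF 1] const_field_in[OF 2 Xe]])
    then have "pr_h ?Z \<in> halg" by (rule pr_h_euc)
    moreover have "pr_m ?Z = X" using m_part_const_field[OF 2 X, of u] unfolding m[symmetric] by (simp add: m_part_def)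
    ultimately show ?thesis by (auto simp: pr_h_def halg_emb image_iff algebra_simps)
  qed
  have D: "connection_difference \<omega>1 \<omega>2 u X = C" if "\<omega>1 u (const_field A \<omega>2 (pr_m X) u) = pr_m X + emb 0 C" for X C
    by (simp add: connection_difference_def that emb_nth vec_eq_iff)
  show e: "\<omega>1 u (const_field A \<omega>2 X u) = X + emb 0 (connection_difference \<omega>1 \<omega>2 u X)" if "X \<in> mcompl" for X
    using E[OF that] D[of X] pr_m_mcompl[OF that] by metis
  have sk: "transpose (connection_difference \<omega>1 \<omega>2 u X) = - connection_difference \<omega>1 \<omega>2 u X" for X
    using E[OF pr_m_in_mcompl[of X]] D[of X] by metis
  have l: "connection_difference \<omega>1 \<omega>2 u (a *\<^sub>R X + b *\<^sub>R Y) = a *\<^sub>R connection_difference \<omega>1 \<omega>2 u X + b *\<^sub>R connection_difference \<omega>1 \<omega>2 u Y" for a b X Y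
  proof -
    have XY: "pr_m X \<in> euc" "pr_m Y \<in> euc" using pr_m_in_mcompl mcompl_subset_euc by auto
    have p: "pr_m (a *\<^sub>R X + b *\<^sub>R Y) = a *\<^sub>R pr_m X + b *\<^sub>R pr_m Y"
      by (simp add: linear_add[OF linear_pr_m] linear_cmul[OF linear_pr_m])
    show ?thesis
      unfolding connection_difference_def p const_field_linear[OF 2 XY]
        one_form_lin(1)[OF cartan_form[OF 1] const_field_in[OF 2 XY(1)] const_field_in[OF 2 XY(2)]]
      by (simp add: vec_eq_iff algebra_simps)
  qed
  have "linear (connection_difference \<omega>1 \<omega>2 u)"
    using l[of 1 _ 1] l[of _ _ 0] by (intro linearI) simp_all
  with sk show "skew_hom (connection_difference \<omega>1 \<omega>2 u)" by (simp add: skew_hom_def)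
qed

lemma const_field_connection_difference:
  assumes 1: "cartan_connection A r \<omega>1" and 2: "cartan_connection A r \<omega>2" and m: "m_part \<omega>1 = m_part \<omega>2" and X: "X \<in> mcompl"
  shows "const_field A \<omega>1 X u
    = (\<lambda>c. 1 *\<^sub>R const_field A \<omega>2 X u c + (-1) *\<^sub>R fundamental_field A r (emb 0 (connection_difference \<omega>1 \<omega>2 u X)) u c)"
proof -
  let ?Z = "emb 0 (connection_difference \<omega>1 \<omega>2 u X)"
  have Z: "?Z \<in> halg" using skew_hom_connection_difference[OF 1 2 m] by (auto simp: halg_emb skew_hom_def)
  have "X \<in> euc" using X mcompl_subset_euc by blast
  note f = one_form_lin[OF cartan_form[OF 1] const_field_in[OF 2 this, of u] fundamental_in[OF 1 Z, of u], of 1 "-1"]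
  have "\<omega>1 u (\<lambda>c. 1 *\<^sub>R const_field A \<omega>2 X u c + (-1) *\<^sub>R fundamental_field A r ?Z u c) = X"
    unfolding f(1) by (simp add: emb_connection_difference[OF 1 2 m X] cartan_fundamental[OF 1 Z])
  then show ?thesis using const_fieldI[OF 1 f(2)] by simp
qed

text \<open>In the expansion of \<open>d\<theta>\<close> on the shifted constant fields, the mixed terms are brackets by
  \<open>ext_deriv_m_part_fundamental\<close> and the term with two fundamental fields vanishes; what is left is the
  Spencer differential.\<close>

lemma torsion_change:
  assumes 1: "cartan_connection A r \<omega>1" and 2: "cartan_connection A r \<omega>2" and m: "m_part \<omega>1 = m_part \<omega>2"
    and X: "X \<in> mcompl" and Y: "Y \<in> mcompl"
  shows "torsion A \<omega>1 u X Y = torsion A \<omega>2 u X Y + spencer_of (connection_difference \<omega>1 \<omega>2 u) X Y"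
proof -
  let ?d = "connection_difference \<omega>1 \<omega>2 u"
  let ?E = "ext_deriv A (m_part \<omega>2) u"
  let ?f = "\<lambda>X. fundamental_field A r (emb 0 (?d X)) u"
  let ?c = "\<lambda>X. const_field A \<omega>2 X u"
  have d: "skew_hom ?d" by (rule skew_hom_connection_difference[OF 1 2 m])
  have Z: "emb 0 (?d X) \<in> halg" for X using d by (auto simp: halg_emb skew_hom_def)
  have lin: "?E \<xi> (\<lambda>c. 1 *\<^sub>R \<eta> c + (-1) *\<^sub>R \<zeta> c) = ?E \<xi> \<eta> - ?E \<xi> \<zeta>" for \<xi> \<eta> \<zeta>
    by (subst ext_deriv_linear[OF m_part_form[OF 2]]) simp
  have lin': "?E (\<lambda>c. 1 *\<^sub>R \<eta> c + (-1) *\<^sub>R \<zeta> c) \<xi> = ?E \<eta> \<xi> - ?E \<zeta> \<xi>" for \<xi> \<eta> \<zeta>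
    using lin[of \<xi> \<eta> \<zeta>] by (simp add: ext_deriv_alternating[of _ _ _ \<xi>])
  have cin: "?c X \<in> tangent_space A u" if "X \<in> mcompl" for X
    using const_field_in[OF 2] that mcompl_subset_euc by blast
  have Ef: "?E (?f X) (?c Y) = - lie (emb 0 (?d X)) Y" if "Y \<in> mcompl" for X Y
    using ext_deriv_m_part_fundamental[OF 2 Z cin[OF that]] by (simp add: m_part_const_field[OF 2 that])
  have Eff: "?E (?f X) (?f Y) = 0" for X Y
    using ext_deriv_m_part_fundamental[OF 2 Z fundamental_in[OF 2 Z]]
    by (simp add: m_part_fundamental[OF 2 Z] bounded_bilinear.zero_right[OF bounded_bilinear_lie])
  have "torsion A \<omega>1 u X Y = ?E (\<lambda>c. 1 *\<^sub>R ?c X c + (-1) *\<^sub>R ?f X c) (\<lambda>c. 1 *\<^sub>R ?c Y c + (-1) *\<^sub>R ?f Y c) + pr_m (lie X Y)"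
    unfolding torsion_eq[OF 1 X Y] const_field_connection_difference[OF 1 2 m X] const_field_connection_difference[OF 1 2 m Y] m ..
  also have "\<dots> = ?E (?c X) (?c Y) - ?E (?f X) (?c Y) + ?E (?f Y) (?c X) + ?E (?f X) (?f Y) + pr_m (lie X Y)"
    unfolding lin lin' ext_deriv_alternating[of _ _ "?c X" "?f Y"] by simp
  also have "\<dots> = torsion A \<omega>2 u X Y + spencer_of ?d X Y"
    by (simp add: torsion_eq[OF 2 X Y] Ef X Y Eff spencer_of_lie[OF d X Y])
  finally show ?thesis .
qed

text \<open>The difference of two normal connections has a Spencer differential with symmetric
  contraction, hence vanishes.\<close>

lemma normal_unique:
  assumes 1: "cartan_connection A r \<omega>1" and 2: "cartan_connection A r \<omega>2" and m: "m_part \<omega>1 = m_part \<omega>2"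
    and ip: "invariant_ip_h ip" and n: "normal_connection ip A \<omega>1" "normal_connection ip A \<omega>2"
  shows "\<omega>1 = \<omega>2"
proof (intro ext)
  fix u \<xi>
  let ?d = "connection_difference \<omega>1 \<omega>2 u"
  have d: "skew_hom ?d" by (rule skew_hom_connection_difference[OF 1 2 m])
  have d0: "?d X = 0" if X: "X \<in> mcompl" for X
  proof (rule spencer_of_symmetric_zero[OF d _ X])
    fix x :: "'k mat" assume x: "x \<in> mbasis"
    have x': "x \<in> mcompl" using x mbasis_subset by blast
    have "contraction (torsion A \<omega>1 u) x = contraction (torsion A \<omega>2 u) x + contraction (spencer_of ?d) x"
      unfolding contraction_add[symmetric] unfolding contraction_def by (simp add: torsion_change[OF 1 2 m x'])
    then have "contraction (spencer_of ?d) x = contraction (torsion A \<omega>1 u) x - contraction (torsion A \<omega>2 u) x" by simp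
    then show "transpose (contraction (spencer_of ?d) x) = contraction (spencer_of ?d) x"
      using n x normal_iff[OF 1 ip] normal_iff[OF 2 ip]
      by (simp add: linear_diff[OF linear_transpose])
  qed
  show "\<omega>1 u \<xi> = \<omega>2 u \<xi>"
  proof (cases "\<xi> \<in> tangent_space A u")
    case False
    then show ?thesis by (simp add: one_form_off[OF cartan_form[OF 1]] one_form_off[OF cartan_form[OF 2]])
  next
    case True
    define X Z where "X = pr_m (\<omega>2 u \<xi>)" and "Z = pr_h (\<omega>2 u \<xi>)"
    have w: "\<omega>2 u \<xi> \<in> euc" by (rule one_form_in[OF cartan_form[OF 2] True])
    have X: "X \<in> mcompl" "X \<in> euc" and Z: "Z \<in> halg" "Z \<in> euc"
      using pr_m_in_mcompl mcompl_subset_euc pr_h_euc[OF w] halg_subset_euc unfolding X_def Z_def by auto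
    have XZ: "\<omega>2 u \<xi> = 1 *\<^sub>R X + 1 *\<^sub>R Z" by (simp add: X_def Z_def pr_h_def)
    have cZ: "const_field A \<omega>2 Z u = fundamental_field A r Z u"
      using const_fieldI[OF 2 fundamental_in[OF 2 Z(1)], of u] by (simp add: cartan_fundamental[OF 2 Z(1)])
    have "\<xi> = const_field A \<omega>2 (1 *\<^sub>R X + 1 *\<^sub>R Z) u" using const_fieldI[OF 2 True] by (simp add: XZ)
    also have "\<dots> = (\<lambda>c. 1 *\<^sub>R const_field A \<omega>2 X u c + 1 *\<^sub>R const_field A \<omega>2 Z u c)"
      by (rule const_field_linear[OF 2 X(2) Z(2)])
    finally have "\<omega>1 u \<xi> = 1 *\<^sub>R \<omega>1 u (const_field A \<omega>2 X u) + 1 *\<^sub>R \<omega>1 u (const_field A \<omega>2 Z u)"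
      using one_form_lin(1)[OF cartan_form[OF 1] const_field_in[OF 2 X(2)] const_field_in[OF 2 Z(2)], of u 1 1] by simp
    also have "\<dots> = X + Z"
      by (simp add: emb_connection_difference[OF 1 2 m X(1)] d0[OF X(1)] emb_0_lin cZ cartan_fundamental[OF 1 Z(1)])
    finally show ?thesis using XZ by simp
  qed
qed

lemma const_field_decompose:
  assumes \<omega>: "cartan_connection A r \<omega>" and \<xi>: "\<xi> \<in> tangent_space A u"
  shows "\<xi> = (\<lambda>c. 1 *\<^sub>R const_field A \<omega> (m_part \<omega> u \<xi>) u c + 1 *\<^sub>R fundamental_field A r (pr_h (\<omega> u \<xi>)) u c)"
proof -
  have w: "\<omega> u \<xi> \<in> euc" by (rule one_form_in[OF cartan_form[OF \<omega>] \<xi>])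
  have Z: "pr_h (\<omega> u \<xi>) \<in> halg" by (rule pr_h_euc[OF w])
  have X: "m_part \<omega> u \<xi> \<in> euc" using pr_m_in_mcompl mcompl_subset_euc by (auto simp: m_part_def)
  note f = one_form_lin[OF cartan_form[OF \<omega>] const_field_in[OF \<omega> X, of u] fundamental_in[OF \<omega> Z, of u], of 1 1]
  show ?thesis
    by (rule cartan_inj[OF \<omega> \<xi> f(2)])
      (simp only: f(1) cartan_const_field[OF \<omega> X] cartan_fundamental[OF \<omega> Z], simp add: m_part_def pr_h_def)
qed

section \<open>Normalizing a Cartan connection\<close>

text \<open>Right translation by \<open>h\<close> maps the constant field of \<open>Ad h X\<close> to that of \<open>X\<close>.\<close>

lemma torsion_equivariant:
  assumes \<omega>: "cartan_connection A r \<omega>" and h: "h \<in> Hgrp" and X: "X \<in> mcompl" and Y: "Y \<in> mcompl"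
  shows "torsion A \<omega> (r u h) X Y = Ad (matrix_inv h) (torsion A \<omega> u (Ad h X) (Ad h Y))"
proof -
  let ?T = "tangent_map A A (\<lambda>u. r u h) u"
  have hX: "Ad h X \<in> mcompl" "Ad h Y \<in> mcompl" using Ad_mcompl[OF h] X Y by auto
  have cf: "const_field A \<omega> X (r u h) = ?T (const_field A \<omega> (Ad h X) u)"
    and cin: "const_field A \<omega> (Ad h X) u \<in> tangent_space A u" if X: "X \<in> mcompl" for X
  proof -
    have hX: "Ad h X \<in> euc" using Ad_mcompl[OF h X] mcompl_subset_euc by blast
    show cin: "const_field A \<omega> (Ad h X) u \<in> tangent_space A u" by (rule const_field_in[OF \<omega> hX])
    have "\<omega> (r u h) (?T (const_field A \<omega> (Ad h X) u)) = Ad (matrix_inv h) (Ad h X)"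
      using cartan_equivariant[OF \<omega>] h cin by (simp add: equivariant_form_def cartan_const_field[OF \<omega> hX])
    then show "const_field A \<omega> X (r u h) = ?T (const_field A \<omega> (Ad h X) u)"
      using const_fieldI[OF \<omega> tangent_translation_in[OF cin h]] by (simp add: Ad_Ad_inv(2)[OF h])
  qed
  have "lie X Y \<in> euc" using lie_euc X Y mcompl_subset_euc by blast
  then have "pr_m (lie X Y) = Ad (matrix_inv h) (pr_m (lie (Ad h X) (Ad h Y)))"
    by (simp add: Ad_lie[OF h, symmetric] pr_m_Ad(1)[OF h] Ad_Ad_inv(2)[OF h])
  then show ?thesis
    unfolding torsion_eq[OF \<omega> X Y] torsion_eq[OF \<omega> hX] cf[OF X] cf[OF Y]
      ext_deriv_equivariant[OF m_part_form[OF \<omega>] m_part_equivariant[OF \<omega>] h cin[OF X] cin[OF Y]]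
    by (simp add: linear_add[OF linear_Ad])
qed

text \<open>In a chart the constant fields are the solutions of a linear equation with smooth
  coefficients, hence smooth, and the coefficients of \<open>d\<theta>\<close> are smooth because those of \<open>\<theta>\<close> are.\<close>

lemma Ck_on_torsion:
  assumes \<omega>: "cartan_connection A r \<omega>" and c: "c \<in> A" and X: "X \<in> mcompl" and Y: "Y \<in> mcompl"
  shows "Ck_on k (chart_dom c) (\<lambda>x. torsion A \<omega> (chart_inv c x) X Y)"
proof -
  let ?W = "chart_dom c"
  let ?L = "\<lambda>x v. local_form A c \<omega> v x"
  note W = open_chart_dom[OF c]
  have L: "?L x = \<omega> (chart_inv c x) \<circ> coord_vec A c (chart_inv c x)" for x by (simp add: local_form_def fun_eq_iff)
  have bij: "bij_betw (?L x) UNIV euc" if "x \<in> ?W" for x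
    unfolding L by (rule bij_betw_trans[OF bij_coord_vec[OF c chart_inv_in[OF c that]] cartan_bij[OF \<omega>]])
  have y: "Cinf_on ?W (\<lambda>x. inv (?L x) Z)" if "Z \<in> euc" for Z
    by (rule Cinf_on_inverse_solution[OF W linear_local_form[OF cartan_form[OF \<omega>] c] bij Cinf_on_local_form[OF cartan_form[OF \<omega>] c] that])
  have ye: "inv (?L x) Z = const_field A \<omega> Z (chart_inv c x) c" if "x \<in> ?W" "Z \<in> euc" for x Z
  proof (rule inv_f_eq)
    show "inj (?L x)" using bij[OF that(1)] by (simp add: bij_betw_def)
    show "?L x (const_field A \<omega> Z (chart_inv c x) c) = Z"
      using local_form_chart[OF const_field_in[OF \<omega> that(2)] c chart_inv_in[OF c that(1)], of \<omega>]
      by (simp add: chart_chart_inv[OF c that(1)] cartan_const_field[OF \<omega> that(2)])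
  qed
  have XY: "X \<in> euc" "Y \<in> euc" using X Y mcompl_subset_euc by auto
  have dC: "Ck_on k ?W (\<lambda>x. local_d c (m_part \<omega>) x b b')" for b b'
    unfolding local_d_def
    using Cinf_on_frechet_derivative[OF Cinf_on_local_form[OF m_part_form[OF \<omega>] c]] by (intro Ck_on_diff[OF W]) blast+
  have "Ck_on k ?W (\<lambda>x. (\<Sum>b\<in>Basis. \<Sum>b'\<in>Basis. ((inv (?L x) X \<bullet> b) * (inv (?L x) Y \<bullet> b')) *\<^sub>R local_d c (m_part \<omega>) x b b') + pr_m (lie X Y))"
    by (intro Ck_on_add[OF W] Ck_on_sum[OF W] Ck_on_const Ck_on_bilinear[OF W bounded_bilinear_scaleR] Ck_on_mult[OF W]
        Ck_on_bounded_linear[OF W bounded_linear_inner_left] y[rule_format] XY dC)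
  then show ?thesis
  proof (rule Ck_on_cong[OF W])
    fix x assume x: "x \<in> ?W"
    have u: "chart_inv c x \<in> fst c" by (rule chart_inv_in[OF c x])
    show "(\<Sum>b\<in>Basis. \<Sum>b'\<in>Basis. ((inv (?L x) X \<bullet> b) * (inv (?L x) Y \<bullet> b')) *\<^sub>R local_d c (m_part \<omega>) x b b') + pr_m (lie X Y)
      = torsion A \<omega> (chart_inv c x) X Y"
      unfolding torsion_eq[OF \<omega> X Y] local_d_expand[OF m_part_form[OF \<omega>] c x, symmetric] ye[OF x XY(1)] ye[OF x XY(2)]
        ext_deriv_chart[OF m_part_form[OF \<omega>] c u const_field_in[OF \<omega> XY(1)] const_field_in[OF \<omega> XY(2)]]
        chart_chart_inv[OF c x] ..
  qed
qed

definition normalize :: "('p \<Rightarrow> ('p, 'e) tvec \<Rightarrow> 'k mat) \<Rightarrow> 'p \<Rightarrow> ('p, 'e) tvec \<Rightarrow> 'k mat" where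
  "normalize \<omega> u \<xi> = \<omega> u \<xi> + emb 0 (correction (torsion A \<omega> u) (m_part \<omega> u \<xi>))"

lemma correction_halg: "emb 0 (correction T X) \<in> halg"
  using skew_hom_correction[of T] by (auto simp: halg_emb skew_hom_def)

lemma m_part_normalize: "m_part (normalize \<omega>) = m_part \<omega>"
  by (simp add: m_part_def normalize_def fun_eq_iff linear_add[OF linear_pr_m] pr_m_halg[OF correction_halg])

lemma one_form_normalize:
  assumes \<omega>: "cartan_connection A r \<omega>"
  shows "one_form A euc (normalize \<omega>)"
proof -
  let ?\<beta> = "\<lambda>u \<xi>. emb 0 (correction (torsion A \<omega> u) (m_part \<omega> u \<xi>))"
  have l: "linear (\<lambda>X. emb 0 (correction T X))" for T :: "'k mat \<Rightarrow> 'k mat \<Rightarrow> 'k mat"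
    using skew_hom_correction[of T] unfolding skew_hom_def
    by (intro linearI) (simp_all add: linear_add linear_cmul emb_0_lin)
  have "smooth_on (chart_dom c) (local_form A c ?\<beta> v)" if c: "c \<in> A" for c v
    unfolding smooth_on_open_iff[OF open_chart_dom[OF c]] local_form_def
    using Cinf_on_local_form[OF m_part_form[OF \<omega>] c]
    by (intro allI Ck_on_emb_correction[OF open_chart_dom[OF c]] Ck_on_torsion[OF \<omega> c]) (auto simp: local_form_def[abs_def])
  then have "one_form A halg ?\<beta>"
    unfolding one_form_def
    by (auto simp: correction_halg one_form_off[OF m_part_form[OF \<omega>]] one_form_add[OF m_part_form[OF \<omega>]]
        one_form_scale[OF m_part_form[OF \<omega>]] linear_add[OF l] linear_cmul[OF l] linear_0[OF l] local_form_def[abs_def])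
  from one_form_sum[OF cartan_form[OF \<omega>] this order_refl halg_subset_euc subspace_euc]
  show ?thesis by (simp add: normalize_def[abs_def])
qed

text \<open>Adding to an element of \<open>euc\<close> a vector of \<open>halg\<close> that depends on its \<open>mcompl\<close>-part only is a shear,
  whose inverse subtracts the same vector.\<close>

lemma bij_shear:
  assumes f: "\<And>X. X \<in> mcompl \<Longrightarrow> f X \<in> halg"
  shows "bij_betw (\<lambda>W. W + f (pr_m W)) euc euc"
proof (rule bij_betwI[where g="\<lambda>W. W - f (pr_m W)"])
  have fe: "f (pr_m W) \<in> euc" for W using f pr_m_in_mcompl halg_subset_euc by blast
  show "(\<lambda>W. W + f (pr_m W)) \<in> euc \<rightarrow> euc" "(\<lambda>W. W - f (pr_m W)) \<in> euc \<rightarrow> euc"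
    using fe by (auto intro: subspace_add[OF subspace_euc] subspace_diff[OF subspace_euc])
  have "pr_m (W + f (pr_m W)) = pr_m W" "pr_m (W - f (pr_m W)) = pr_m W" for W
    using f[OF pr_m_in_mcompl] by (simp_all add: linear_add[OF linear_pr_m]
      linear_diff[OF linear_pr_m] pr_m_halg)
  then show "W + f (pr_m W) - f (pr_m (W + f (pr_m W))) = W" "W - f (pr_m W) + f (pr_m (W - f (pr_m W))) = W" for W
    by simp_all
qed

lemma cartan_normalize:
  assumes \<omega>: "cartan_connection A r \<omega>"
  shows "cartan_connection A r (normalize \<omega>)"
  unfolding cartan_connection_def
proof (intro conjI allI ballI)
  show "one_form A euc (normalize \<omega>)" by (rule one_form_normalize[OF \<omega>])
  show "bij_betw (normalize \<omega> u) (tangent_space A u) euc" for u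
    using bij_betw_trans[OF cartan_bij[OF \<omega>, of u] bij_shear[of "\<lambda>X. emb 0 (correction (torsion A \<omega> u) X)"]]
    by (simp add: correction_halg o_def normalize_def[abs_def] m_part_def)
  show "normalize \<omega> u (fundamental_field A r X u) = X" if "X \<in> halg" for X u
    using linear_0[of "correction (torsion A \<omega> u)"] skew_hom_correction[of "torsion A \<omega> u"]
    by (simp add: normalize_def cartan_fundamental[OF \<omega> that] m_part_fundamental[OF \<omega> that] skew_hom_def emb_0_lin)
  show "equivariant_form A r (normalize \<omega>)"
    unfolding equivariant_form_def
  proof (intro ballI allI)
    fix h :: "'k mat" and u \<xi> assume h: "h \<in> Hgrp" and \<xi>: "\<xi> \<in> tangent_space A u"
    obtain g where g: "h = emb 1 g" "orthogonal_matrix g" using h by (auto simp: Hgrp_emb)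
    let ?X = "m_part \<omega> u \<xi>"
    have X: "?X \<in> mcompl" by (rule one_form_in[OF m_part_form[OF \<omega>] \<xi>])
    have "correction (torsion A \<omega> (r u h)) (Ad (matrix_inv h) ?X) = transpose g ** correction (torsion A \<omega> u) (Ad h (Ad (matrix_inv h) ?X)) ** g"
      unfolding g(1)
    proof (rule correction_equivariant[OF alt_bilinear_torsion[OF \<omega>] alt_bilinear_torsion[OF \<omega>] g(2)])
      show "Ad (matrix_inv (emb 1 g)) ?X \<in> mcompl"
        using Ad_mcompl[OF Hgrp_inv[OF h] X] by (simp add: g)
    qed (use torsion_equivariant[OF \<omega> h] in \<open>simp add: g\<close>)
    then have "correction (torsion A \<omega> (r u h)) (Ad (matrix_inv h) ?X) = transpose g ** correction (torsion A \<omega> u) ?X ** g"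
      unfolding Ad_Ad_inv(1)[OF h] .
    then have "emb 0 (correction (torsion A \<omega> (r u h)) (Ad (matrix_inv h) ?X)) = Ad (matrix_inv h) (emb 0 (correction (torsion A \<omega> u) ?X))"
      using Ad_emb_emb[of "transpose g"] g(2)
      by (simp add: g(1) matrix_inv_emb orthogonal_matrix_transpose transpose_transpose)
    moreover have "\<omega> (r u h) (tangent_map A A (\<lambda>u'. r u' h) u \<xi>) = Ad (matrix_inv h) (\<omega> u \<xi>)"
      "m_part \<omega> (r u h) (tangent_map A A (\<lambda>u'. r u' h) u \<xi>) = Ad (matrix_inv h) ?X"
      using cartan_equivariant[OF \<omega>] m_part_equivariant[OF \<omega>] h \<xi> by (simp_all add: equivariant_form_def)
    ultimately show "normalize \<omega> (r u h) (tangent_map A A (\<lambda>u'. r u' h) u \<xi>) = Ad (matrix_inv h) (normalize \<omega> u \<xi>)"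
      by (simp add: normalize_def linear_add[OF linear_Ad])
  qed
qed

text \<open>The difference between the normalized connection and the given one is the correction, so its
  torsion is the one whose contraction was made symmetric in \<open>correction_symmetric\<close>.\<close>

lemma normal_normalize:
  assumes \<omega>: "cartan_connection A r \<omega>" and ip: "invariant_ip_h ip"
  shows "normal_connection ip A (normalize \<omega>)"
  unfolding normal_iff[OF cartan_normalize[OF \<omega>] ip]
proof (intro allI ballI)
  fix u and x :: "'k mat" assume x: "x \<in> mbasis"
  let ?T = "torsion A \<omega> u"
  note N = cartan_normalize[OF \<omega>]
  have d: "connection_difference (normalize \<omega>) \<omega> u X = correction ?T X" if "X \<in> mcompl" for X
  proof -
    have Xe: "X \<in> euc" using that mcompl_subset_euc by blast
    have "normalize \<omega> u (const_field A \<omega> X u) = X + emb 0 (correction ?T X)"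
      by (simp add: normalize_def cartan_const_field[OF \<omega> Xe] m_part_const_field[OF \<omega> that])
    then show ?thesis
      using emb_connection_difference[OF N \<omega> m_part_normalize that, of u] by (simp add: emb_inj)
  qed
  have t: "torsion A (normalize \<omega>) u x Y = ?T x Y + spencer_of (correction ?T) x Y" if Y: "Y \<in> mcompl" for Y
    using x mbasis_subset torsion_change[OF N \<omega> m_part_normalize _ Y, of x u] d[OF Y] d[of x]
    by (auto simp: spencer_of_def)
  have "contraction (torsion A (normalize \<omega>) u) x = contraction (\<lambda>X Y. ?T X Y + spencer_of (correction ?T) X Y) x"
    unfolding contraction_def by (simp add: t)
  then show "transpose (contraction (torsion A (normalize \<omega>) u) x) = contraction (torsion A (normalize \<omega>) u) x"
    using correction_symmetric[OF x] by simp
qed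

text \<open>Both connection forms take the same values on fundamental fields, so \<open>\<gamma> + m_part \<omega>\<close> is \<open>\<omega>\<close> followed by a
  shear of \<open>euc\<close>; this gives bijectivity. Together with \<open>principal_of_cartan\<close> this matches the Cartan
  connections with a given \<open>mcompl\<close>-part with the principal connections.\<close>

lemma cartan_of_principal:
  assumes \<omega>: "cartan_connection A r \<omega>" and \<gamma>: "principal_connection A r \<gamma>"
  shows "cartan_connection A r (\<lambda>u \<xi>. \<gamma> u \<xi> + m_part \<omega> u \<xi>)" (is "cartan_connection A r ?\<omega>")
    and "m_part (\<lambda>u \<xi>. \<gamma> u \<xi> + m_part \<omega> u \<xi>) = m_part \<omega>"
proof -
  have f: "one_form A halg \<gamma>" and e: "equivariant_form A r \<gamma>" and z: "\<And>X u. X \<in> halg \<Longrightarrow> \<gamma> u (fundamental_field A r X u) = X"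
    using \<gamma> by (auto simp: principal_connection_def)
  have "0 \<in> halg" by (rule subspace_0[OF subspace_halg])
  then have \<gamma>h: "\<gamma> u \<xi> \<in> halg" for u \<xi> using one_form_in[OF f] one_form_off[OF f] by metis
  have m: "m_part \<omega> u \<xi> \<in> mcompl" for u \<xi> by (simp add: m_part_def pr_m_in_mcompl)
  show "m_part ?\<omega> = m_part \<omega>"
    by (simp add: m_part_def[of ?\<omega>] fun_eq_iff linear_add[OF linear_pr_m] pr_m_halg[OF \<gamma>h] pr_m_mcompl[OF m])
  show "cartan_connection A r ?\<omega>"
    unfolding cartan_connection_def
  proof (intro conjI allI ballI)
    show "one_form A euc ?\<omega>"
      by (rule one_form_sum[OF f m_part_form[OF \<omega>] halg_subset_euc mcompl_subset_euc subspace_euc])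
    show "equivariant_form A r ?\<omega>"
      using e m_part_equivariant[OF \<omega>]
      by (simp add: equivariant_form_def linear_add[OF linear_Ad])
    show "?\<omega> u (fundamental_field A r X u) = X" if "X \<in> halg" for X u
      by (simp add: z that m_part_fundamental[OF \<omega> that])
    show "bij_betw (?\<omega> u) (tangent_space A u) euc" for u
    proof -
      let ?f = "\<lambda>X. \<gamma> u (const_field A \<omega> X u)"
      have "bij_betw ((\<lambda>W. W + ?f (pr_m W)) \<circ> \<omega> u) (tangent_space A u) euc"
        by (rule bij_betw_trans[OF cartan_bij[OF \<omega>] bij_shear]) (rule \<gamma>h)
      then show ?thesis
      proof (rule bij_betw_cong[THEN iffD1, rotated])
        fix \<xi> assume \<xi>: "\<xi> \<in> tangent_space A u"
        have Z: "pr_h (\<omega> u \<xi>) \<in> halg" by (rule pr_h_euc[OF one_form_in[OF cartan_form[OF \<omega>] \<xi>]])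
        have X: "m_part \<omega> u \<xi> \<in> euc" using m mcompl_subset_euc by blast
        have "\<gamma> u \<xi> = ?f (m_part \<omega> u \<xi>) + pr_h (\<omega> u \<xi>)"
          using arg_cong[OF const_field_decompose[OF \<omega> \<xi>], of "\<gamma> u"]
          unfolding one_form_lin(1)[OF f const_field_in[OF \<omega> X] fundamental_in[OF \<omega> Z]] z[OF Z] by simp
        then show "((\<lambda>W. W + ?f (pr_m W)) \<circ> \<omega> u) \<xi> = \<gamma> u \<xi> + m_part \<omega> u \<xi>"
          by (simp add: m_part_def pr_h_def)
      qed
    qed
  qed
qed

lemma principal_of_cartan:
  assumes \<omega>: "cartan_connection A r \<omega>"
  shows "principal_connection A r (\<lambda>u \<xi>. pr_h (\<omega> u \<xi>))"
proof -
  have L: "bounded_linear (pr_h :: 'k mat \<Rightarrow> _)"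
    unfolding pr_h_def[abs_def] by (intro bounded_linear_sub bounded_linear_ident bounded_linear_pr_m)
  show ?thesis
    unfolding principal_connection_def
  proof (intro conjI ballI allI)
    show "one_form A halg (\<lambda>u \<xi>. pr_h (\<omega> u \<xi>))"
      by (rule one_form_compose(1)[OF cartan_form[OF \<omega>] L]) (use pr_h_euc in blast)
    show "pr_h (\<omega> u (fundamental_field A r X u)) = X" if "X \<in> halg" for X u
      by (simp add: cartan_fundamental[OF \<omega> that] pr_h_def pr_m_halg[OF that])
    show "equivariant_form A r (\<lambda>u \<xi>. pr_h (\<omega> u \<xi>))"
      using cartan_equivariant[OF \<omega>] m_part_equivariant[OF \<omega>]
      by (simp add: equivariant_form_def m_part_def pr_h_def linear_diff[OF linear_Ad])
  qed
qed

end

theorem theorem4p15: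
  fixes AP :: "('p::{t2_space, second_countable_topology}, 'e::euclidean_space) chart set"
    and AN :: "('b::{t2_space, second_countable_topology}, 'f::euclidean_space) chart set"
    and p :: "'p \<Rightarrow> 'b"
    and r :: "'p \<Rightarrow> 'k::finite mat \<Rightarrow> 'p"
    and ip :: "'k mat \<Rightarrow> 'k mat \<Rightarrow> real"
    and \<theta> :: "'p \<Rightarrow> ('p, 'e) tvec \<Rightarrow> 'k mat"
    and n :: nat
  assumes "n = CARD('k option)" and "n \<ge> 3"
    and "smooth_atlas AP"
    and "smooth_atlas AN" and "connected (UNIV :: 'b set)"
    and "principal_bundle AP AN p r"
    and "invariant_ip_h ip"
    and "\<exists>\<omega>'. cartan_connection AP r \<omega>' \<and> m_part \<omega>' = \<theta>"
  shows "(\<exists>!\<omega>. cartan_connection AP r \<omega> \<and> m_part \<omega> = \<theta> \<and> normal_connection ip AP \<omega>) \<and>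
    (\<exists>!\<gamma>. principal_connection AP r \<gamma> \<and> normal_connection ip AP (\<lambda>u \<xi>. \<gamma> u \<xi> + \<theta> u \<xi>))"
proof -
  interpret smooth_action AP r
    using assms(3,6) by unfold_locales (auto simp: principal_bundle_def)
  note ip = \<open>invariant_ip_h ip\<close>
  obtain \<omega>' where \<omega>': "cartan_connection AP r \<omega>'" and m': "m_part \<omega>' = \<theta>" using assms(8) by blast
  define \<omega> where "\<omega> = normalize \<omega>'"
  have \<omega>: "cartan_connection AP r \<omega>" "m_part \<omega> = \<theta>" "normal_connection ip AP \<omega>"
    unfolding \<omega>_def using cartan_normalize[OF \<omega>'] m_part_normalize[of \<omega>'] m' normal_normalize[OF \<omega>' ip] by simp_all
  have uniq: "\<omega>1 = \<omega>" if "cartan_connection AP r \<omega>1" "m_part \<omega>1 = \<theta>" "normal_connection ip AP \<omega>1" for \<omega>1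
    using normal_unique[OF that(1) \<omega>(1) _ ip that(3) \<omega>(3)] that(2) \<omega>(2) by simp
  show ?thesis
  proof
    show "\<exists>!\<omega>. cartan_connection AP r \<omega> \<and> m_part \<omega> = \<theta> \<and> normal_connection ip AP \<omega>"
      using \<omega> uniq by blast
    have split: "(\<lambda>u \<xi>. pr_h (\<omega> u \<xi>) + \<theta> u \<xi>) = \<omega>"
      unfolding \<omega>(2)[symmetric] by (simp add: pr_h_def m_part_def)
    show "\<exists>!\<gamma>. principal_connection AP r \<gamma> \<and> normal_connection ip AP (\<lambda>u \<xi>. \<gamma> u \<xi> + \<theta> u \<xi>)"
    proof (rule ex1I[of _ "\<lambda>u \<xi>. pr_h (\<omega> u \<xi>)"])
      show "principal_connection AP r (\<lambda>u \<xi>. pr_h (\<omega> u \<xi>)) \<and> normal_connection ip AP (\<lambda>u \<xi>. pr_h (\<omega> u \<xi>) + \<theta> u \<xi>)"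
        unfolding split using principal_of_cartan[OF \<omega>(1)] \<omega>(3) by blast
      fix \<gamma> assume \<gamma>: "principal_connection AP r \<gamma> \<and> normal_connection ip AP (\<lambda>u \<xi>. \<gamma> u \<xi> + \<theta> u \<xi>)"
      then have "(\<lambda>u \<xi>. \<gamma> u \<xi> + \<theta> u \<xi>) = \<omega>"
        using cartan_of_principal[OF \<omega>', of \<gamma>] unfolding m' by (intro uniq) auto
      then have "(\<lambda>u \<xi>. \<gamma> u \<xi> + \<theta> u \<xi>) = (\<lambda>u \<xi>. pr_h (\<omega> u \<xi>) + \<theta> u \<xi>)" unfolding split .
      then show "\<gamma> = (\<lambda>u \<xi>. pr_h (\<omega> u \<xi>))" by (simp add: fun_eq_iff)
    qed
  qed
qed

end
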